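(* Let $i\in\{1,2\}$ and $(\xi,\eta;\lambda,\nu)\in(\mathbb Z/2\mathbb Z)^5\times\mathbb C^5$, where $\xi\in(\mathbb Z/2\mathbb Z)^3$, $\eta\in(\mathbb Z/2\mathbb Z)^2$, $\lambda\in\mathbb C^3$, $\nu\in\mathbb C^2$. The following conditions are equivalent: (i) $\mathrm{Diff}_{G_i'}(I(\xi,\lambda),J(\eta,\nu))\neq\{0\}$; (ii) $\dim_{\mathbb C}\mathrm{Diff}_{G_i'}(I(\xi,\lambda),J(\eta,\nu))=1$; (iii) $(\xi,\eta;\lambda,\nu)\in\mathrm{Supp}_i(\mathbb D)$.
   Context: $\mathbb N=\{0,1,2,\dots\}$, $\mathbb N_+=\{1,2,\dots\}$; $[a,b]=\emptyset$ if $b<a$. $G=GL(3,\mathbb R)$, $G'=GL(2,\mathbb R)$; $P=MAN_+\subset G$ is the group of invertible upper triangular matrices, $M=\{\mathrm{diag}(\pm1,\pm1,\pm1)\}$, $A$ = positive diagonal matrices, $N_+$ = upper unipotent. For $\xi\in(\mathbb Z/2\mathbb Z)^3,\lambda\in\mathbb C^3$, $I(\xi,\lambda)=\mathrm{Ind}_P^G(\mathbb C_\xi\boxtimes\mathbb C_\lambda)$ is the unnormalized principal series: smooth $f$ on $G$ with $f(gman)=\prod_j m_j^{-\xi_j}\prod_j a_j^{-\lambda_j}f(g)$ for $m=\mathrm{diag}(m_j)\in M$, $a=\mathrm{diag}(a_j)\in A$, $n\in N_+$, with left translation. $J(\eta,\nu)$ ($\eta\in(\mathbb Z/2\mathbb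 Z)^2,\nu\in\mathbb C^2$) is the analogous principal series of $G'$ induced from its upper triangular subgroup $P'$. Let $\iota_1(g')=\begin{pmatrix}g'&0\\0&1\end{pmatrix}$, $\iota_2(g')=\begin{pmatrix}1&0\\0&g'\end{pmatrix}$, $G_i'=\iota_i(G')$, and regard $J(\eta,\nu)$ as a representation of $G_i'$. $\mathrm{Diff}_{G_i'}(I(\xi,\lambda),J(\eta,\nu))$ is the space of $G_i'$-intertwining differential operators $I(\xi,\lambda)\to J(\eta,\nu)$ (differential symmetry breaking operators), with respect to the natural map $G_i'/\iota_i(P')\to G/P$. $\Phi_{1,a}=\{(\lambda,\nu)\in\mathbb C^5:\nu_1-\lambda_1,\ \nu_2-\lambda_2\in\mathbb N\}$; $\Phi_{1,b}=\{(\lambda,\nu)\in\mathbb C^5:\nu_1-\lambda_1,\,-(\nu_2-\lambda_2)\in\mathbb N_+,\ \nu_1-\lambda_1+\nu_2-\lambda_2\in\mathbb N,\ \nu_1-\lambda_2\in[1,\nu_1-\lambda_1+\nu_2-\lambda_2+1]\cap\mathbb Z\}$; $\Phi_{2,a}=\{(\lambda,\nu)\in\mathbb C^5:\lambda_3-\nu_2,\ \lambda_2-\nu_1\in\mathbb N\}$; $\Phi_{2,b}=\{(\lambda,\nu)\in\mathbb C^5:\lambda_3-\nu_2,\,-(\lambda_2-\nu_1)\in\mathbb N_+,\ \lambda_3-\nu_2+\lambda_2-\nu_1\in\mathbb N,\ \lambda_2-\nu_2\in[1,\lambda_3-\nu_2+\lambda_2-\nu_1+1]\cap\mathbb Z\}$.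 $\Phi_i=\Phi_{i,a}\cup\Phi_{i,b}$. $\mathrm{Supp}_1(\mathbb D)=\{(\xi,\eta;\lambda,\nu):(\lambda,\nu)\in\Phi_1,\ \xi_1+\eta_1\equiv\nu_1-\lambda_1,\ \xi_2+\eta_2\equiv\nu_2-\lambda_2\bmod2\}$; $\mathrm{Supp}_2(\mathbb D)=\{(\xi,\eta;\lambda,\nu):(\lambda,\nu)\in\Phi_2,\ \xi_2+\eta_1\equiv\lambda_2-\nu_1,\ \xi_3+\eta_2\equiv\lambda_3-\nu_2\bmod2\}$. *)

theory Defs
  imports
    "HOL-Analysis.Analysis"
    "HOL-Library.Function_Algebras"
    "HOL-Library.Complex_Order"
    "HOL-Library.Z2"
begin

section \<open>Smooth functions\<close>

fun iter_deriv ::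
  "'a::real_normed_vector list \<Rightarrow> ('a \<Rightarrow> 'b::real_normed_vector) \<Rightarrow> 'a \<Rightarrow> 'b" where
  "iter_deriv [] f = f"
| "iter_deriv (v # vs) f = (\<lambda>x. frechet_derivative (iter_deriv vs f) (at x) v)"

text \<open>
  Only meant for open \<open>S\<close> in a finite-dimensional space. Requiring Frechet differentiability
  of every iterated directional derivative makes all of them continuous, so this is the usual
  notion of a smooth function.
\<close>

definition smooth_on ::
  "'a::real_normed_vector set \<Rightarrow> ('a \<Rightarrow> 'b::real_normed_vector) \<Rightarrow> bool" where
  "smooth_on S f \<longleftrightarrow> (\<forall>vs. \<forall>x\<in>S. iter_deriv vs f differentiable (at x))"


section \<open>General linear groups and principal series\<close>

definition GL :: "(real^'n^'n) set" where
  "GL = {g. invertible g}"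

definition diag_mat :: "real^'n \<Rightarrow> real^'n^'n" where
  "diag_mat d = (\<chi> i j. if i = j then d $ i else 0)"

text \<open>
  The entries are listed one by one because the order on the index type \<open>3\<close> is not the
  intended one: there \<open>3 = 0 < 1 < 2\<close>.
\<close>

definition unipotent3 :: "(real^3^3) set" where
  "unipotent3 = {n. n$1$1 = 1 \<and> n$2$2 = 1 \<and> n$3$3 = 1 \<and>
                    n$2$1 = 0 \<and> n$3$1 = 0 \<and> n$3$2 = 0}"

definition unipotent2 :: "(real^2^2) set" where
  "unipotent2 = {n. n$1$1 = 1 \<and> n$2$2 = 1 \<and> n$2$1 = 0}"

definition sign_char :: "bit^'n \<Rightarrow> real^'n \<Rightarrow> complex" where
  "sign_char \<xi> m = (\<Prod>j\<in>UNIV. if \<xi> $ j = 0 then 1 else inverse (of_real (m $ j)))"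

definition power_char :: "complex^'n \<Rightarrow> real^'n \<Rightarrow> complex" where
  "power_char lam a = (\<Prod>j\<in>UNIV. of_real (a $ j) powr (- (lam $ j)))"

text \<open>
  Functions on the group are represented by functions on all matrices that vanish off the
  group, so that equality of functions is equality on the group. The parameter \<open>N\<close> is the
  unipotent radical of the parabolic subgroup.
\<close>

definition principal_series ::
  "(real^'n^'n) set \<Rightarrow> bit^'n \<Rightarrow> complex^'n \<Rightarrow> (real^'n^'n \<Rightarrow> complex) set" where
  "principal_series N \<xi> lam = {f.
     smooth_on GL f \<and>
     (\<forall>g. g \<notin> GL \<longrightarrow> f g = 0) \<and>
     (\<forall>g\<in>GL. \<forall>m a. \<forall>n\<in>N.
        (\<forall>j. m $ j = 1 \<or> m $ j = - 1) \<longrightarrow> (\<forall>j. 0 < a $ j) \<longrightarrow>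
        f (g ** diag_mat m ** diag_mat a ** n) = sign_char \<xi> m * power_char lam a * f g)}"

definition I_series :: "bit^3 \<Rightarrow> complex^3 \<Rightarrow> (real^3^3 \<Rightarrow> complex) set" where
  "I_series = principal_series unipotent3"

definition J_series :: "bit^2 \<Rightarrow> complex^2 \<Rightarrow> (real^2^2 \<Rightarrow> complex) set" where
  "J_series = principal_series unipotent2"

definition left_translate ::
  "real^'n^'n \<Rightarrow> (real^'n^'n \<Rightarrow> complex) \<Rightarrow> (real^'n^'n \<Rightarrow> complex)" where
  "left_translate h f = (\<lambda>g. f (matrix_inv h ** g))"

definition iota :: "nat \<Rightarrow> real^2^2 \<Rightarrow> real^3^3" where
  "iota i g =
     (if i = 1
      then vector [vector [g$1$1, g$1$2, 0],
                   vector [g$2$1, g$2$2, 0],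
                   vector [0,     0,     1]]
      else vector [vector [1, 0,     0    ],
                   vector [0, g$1$1, g$1$2],
                   vector [0, g$2$1, g$2$2]])"


section \<open>Differential symmetry breaking operators\<close>

text \<open>
  \<open>T\<close> is a differential operator along the map \<open>p\<close>: near every point of the source of \<open>p\<close>,
  \<open>T f\<close> is a finite combination, with smooth coefficients, of partial derivatives of \<open>f\<close>
  evaluated along \<open>p\<close>. For sections of the homogeneous bundles over \<open>G/P\<close> and \<open>G'/P'\<close>,
  regarded as equivariant functions on the groups, this agrees with the description in local
  trivialisations along \<open>G'/P' \<rightarrow> G/P\<close>: derivatives of \<open>f\<close> along the fibres of
  \<open>G \<rightarrow> G/P\<close> are smooth multiples of \<open>f\<close>, and one passes from \<open>G'\<close> to \<open>G'/P'\<close> by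
  local sections.
\<close>

definition diff_op_along ::
  "(real^'n^'n \<Rightarrow> real^'k^'k) \<Rightarrow> (real^'k^'k \<Rightarrow> complex) set \<Rightarrow>
   ((real^'k^'k \<Rightarrow> complex) \<Rightarrow> (real^'n^'n \<Rightarrow> complex)) \<Rightarrow> bool" where
  "diff_op_along p V T \<longleftrightarrow>
     (\<forall>g0\<in>GL. \<exists>U F c.
        open U \<and> g0 \<in> U \<and> U \<subseteq> GL \<and> finite F \<and> (\<forall>vs\<in>F. smooth_on U (c vs)) \<and>
        (\<forall>f\<in>V. \<forall>g\<in>U. T f g = (\<Sum>vs\<in>F. c vs g * iter_deriv vs f (p g))))"

text \<open>
  As with functions, operators are normalised to be \<open>0\<close> outside their domain \<open>I(\<xi>,\<lambda>)\<close>, so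
  that two of them are equal iff they agree on it.
\<close>

definition Diff ::
  "nat \<Rightarrow> bit^3 \<Rightarrow> complex^3 \<Rightarrow> bit^2 \<Rightarrow> complex^2 \<Rightarrow>
   ((real^3^3 \<Rightarrow> complex) \<Rightarrow> (real^2^2 \<Rightarrow> complex)) set" where
  "Diff i \<xi> lam \<eta> \<nu> = {T.
     (\<forall>f. f \<notin> I_series \<xi> lam \<longrightarrow> T f = 0) \<and>
     (\<forall>f\<in>I_series \<xi> lam. T f \<in> J_series \<eta> \<nu>) \<and>
     (\<forall>f1\<in>I_series \<xi> lam. \<forall>f2\<in>I_series \<xi> lam. T (f1 + f2) = T f1 + T f2) \<and>
     (\<forall>c. \<forall>f\<in>I_series \<xi> lam. T (\<lambda>g. c * f g) = (\<lambda>g. c * T f g)) \<and>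
     (\<forall>h\<in>GL. \<forall>f\<in>I_series \<xi> lam.
        T (left_translate (iota i h) f) = left_translate h (T f)) \<and>
     diff_op_along (iota i) (I_series \<xi> lam) T}"

definition op_scale :: "complex \<Rightarrow> ('a \<Rightarrow> 'b \<Rightarrow> complex) \<Rightarrow> 'a \<Rightarrow> 'b \<Rightarrow> complex" where
  "op_scale c T = (\<lambda>f g. c * T f g)"

global_interpretation op_space: vector_space op_scale
  defines op_dim = op_space.dim
  by standard (auto simp: op_scale_def fun_eq_iff algebra_simps)


section \<open>Parameter sets\<close>

definition Npos :: "complex set" where
  "Npos = \<nat> - {0}"

text \<open>
  Below, \<open>{a..b} \<inter> \<int>\<close> is an interval of integers inside the complex numbers: by definition
  of the order there, \<open>a \<le> b\<close> means \<open>Re a \<le> Re b\<close> and \<open>Im a = Im b\<close>.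
\<close>

definition \<Phi>1a :: "((complex^3) \<times> (complex^2)) set" where
  "\<Phi>1a = {(lam, \<nu>). \<nu>$1 - lam$1 \<in> \<nat> \<and> \<nu>$2 - lam$2 \<in> \<nat>}"

definition \<Phi>1b :: "((complex^3) \<times> (complex^2)) set" where
  "\<Phi>1b = {(lam, \<nu>).
     \<nu>$1 - lam$1 \<in> Npos \<and> - (\<nu>$2 - lam$2) \<in> Npos \<and>
     \<nu>$1 - lam$1 + \<nu>$2 - lam$2 \<in> \<nat> \<and>
     \<nu>$1 - lam$2 \<in> {1..\<nu>$1 - lam$1 + \<nu>$2 - lam$2 + 1} \<inter> \<int>}"

definition \<Phi>2a :: "((complex^3) \<times> (complex^2)) set" where
  "\<Phi>2a = {(lam, \<nu>). lam$3 - \<nu>$2 \<in> \<nat> \<and> lam$2 - \<nu>$1 \<in> \<nat>}"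

definition \<Phi>2b :: "((complex^3) \<times> (complex^2)) set" where
  "\<Phi>2b = {(lam, \<nu>).
     lam$3 - \<nu>$2 \<in> Npos \<and> - (lam$2 - \<nu>$1) \<in> Npos \<and>
     lam$3 - \<nu>$2 + lam$2 - \<nu>$1 \<in> \<nat> \<and>
     lam$2 - \<nu>$2 \<in> {1..lam$3 - \<nu>$2 + lam$2 - \<nu>$1 + 1} \<inter> \<int>}"

definition \<Phi> :: "nat \<Rightarrow> ((complex^3) \<times> (complex^2)) set" where
  "\<Phi> i = (if i = 1 then \<Phi>1a \<union> \<Phi>1b else \<Phi>2a \<union> \<Phi>2b)"

definition cong_mod2 :: "bit \<Rightarrow> complex \<Rightarrow> bool" where
  "cong_mod2 b z \<longleftrightarrow> (\<exists>k::int. z = of_int k \<and> b = of_int k)"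

definition Supp :: "nat \<Rightarrow> ((bit^3) \<times> (bit^2) \<times> (complex^3) \<times> (complex^2)) set" where
  "Supp i = {(\<xi>, \<eta>, lam, \<nu>). (lam, \<nu>) \<in> \<Phi> i \<and>
     (if i = 1
      then cong_mod2 (\<xi>$1 + \<eta>$1) (\<nu>$1 - lam$1) \<and> cong_mod2 (\<xi>$2 + \<eta>$2) (\<nu>$2 - lam$2)
      else cong_mod2 (\<xi>$2 + \<eta>$1) (lam$2 - \<nu>$1) \<and> cong_mod2 (\<xi>$3 + \<eta>$2) (lam$3 - \<nu>$2))}"

end

theory Submission
  imports Defs "HOL-Computational_Algebra.Polynomial"
begin

text \<open>
  Equivariance under left translations determines a symmetry breaking operator by its value at the
  identity matrix, which is a combination of iterated derivatives there. Rewriting derivatives by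
  left invariant vector fields and normal ordering (the upper triangular fields act on \<open>I(\<xi>,\<lambda>)\<close> by
  scalars), the operator becomes \<open>f \<mapsto> (D f) \<circ> \<iota>\<close> with \<open>D = \<Sum> \<phi>(a,b,c) E21^a E31^b E32^c\<close>, an element of
  a Verma module. Functions supported near the identity separate the monomials, so the operator
  is intertwining iff \<open>D\<close> is a vector of weight given by \<open>(\<eta>,\<nu>)\<close> that is annihilated by the simple
  root vector of \<open>G'\<close>. The weight restricts \<open>\<phi>\<close> to a finite line, on which annihilation is a
  two-term recurrence. Its solutions are proportional to each other, and a nonzero one exists iff the
  line does not leave the range of nonnegative exponents or one coefficient of the recurrence vanishes:
  these are the two kinds of parameters in \<open>\<Phi>\<close>.
\<close>

section \<open>Calculus of smooth functions\<close>

text \<open>Three obstacles shape the argument. The coefficients of an operator are only locally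
  given smooth functions; evaluation at the identity freezes them to constants. G' is disconnected:
  the Lie algebra sees \<nu> and \<lambda>, but \<xi> and \<eta> are visible only on diagonal
  matrices with an entry -1, whence the separate parity conditions. Separating monomials needs
  global elements of I(\<xi>,\<lambda>), so polynomials on the big cell are multiplied by cutoffs
  that live on the flag variety.

  The interval in the second kind of parameters arises as follows. The weight fixes integers k \<ge>
  0 and l, and the recurrence reads (k - j) u(j) = (j + 1) (\<alpha> + j) u(j + 1) for j < k. The
  left factor never vanishes, so u(k) determines all values, and the only obstruction sits at the
  lower end. For l < 0 \<le> k + l the exponents force j \<ge> -l, but the equation at j = -l - 1
  survives with u(j) = 0. Hence one of the k + l + 1 factors \<alpha> + j with -l - 1 \<le> j < k
  must vanish. In terms of \<nu>1 - \<lambda>2 (for i = 1) or \<lambda>2 - \<nu>2 (for i = 2) this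
  is the interval [1, k + l + 1].\<close>

lemma frechet_derivative_eq_on_open:
  assumes "open S" "x \<in> S" "\<And>y. y \<in> S \<Longrightarrow> f y = g y"
  shows "frechet_derivative f (at x) = frechet_derivative g (at x)"
proof -
  \<comment> \<open>\<open>frechet_derivative\<close> is a choice among all derivatives, so it
    suffices that both functions have the same ones; this also covers points without a
    derivative.\<close>
  have "(f has_derivative D) (at x) \<longleftrightarrow> (g has_derivative D) (at x)" for D
    using assms has_derivative_transform_within_open[of f D x UNIV S g]
      has_derivative_transform_within_open[of g D x UNIV S f] by auto
  then show ?thesis
    by (simp add: frechet_derivative_def)
qed

lemma differentiable_eq_on_open:
  assumes "open S" "x \<in> S" "\<And>y. y \<in> S \<Longrightarrow> f y = g y" "f differentiable (at x)"
  shows "g differentiable (at x)"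
  using assms has_derivative_transform_within_open[of f _ x UNIV S g]
  unfolding differentiable_def by blast

lemma iter_deriv_eq_on_open:
  assumes "open S" "\<And>y. y \<in> S \<Longrightarrow> f y = g y" "x \<in> S"
  shows "iter_deriv vs f x = iter_deriv vs g x"
  using assms(3)
proof (induction vs arbitrary: x)
  case (Cons v vs)
  then show ?case
    using frechet_derivative_eq_on_open[OF assms(1) Cons.prems,
        of "iter_deriv vs f" "iter_deriv vs g"] by simp
qed (use assms in simp)

lemma iter_deriv_append: "iter_deriv (us @ vs) f = iter_deriv us (iter_deriv vs f)"
  by (induction us) auto

lemma smooth_on_cong:
  assumes "open S" "\<And>y. y \<in> S \<Longrightarrow> f y = g y" "smooth_on S f"
  shows "smooth_on S g"
  unfolding smooth_on_def
proof (intro allI ballI)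
  fix vs x assume "x \<in> S"
  then show "iter_deriv vs g differentiable at x"
    using differentiable_eq_on_open[OF assms(1), of x "iter_deriv vs f" "iter_deriv vs g"]
      iter_deriv_eq_on_open[OF assms(1), of f g] assms(2,3) by (simp add: smooth_on_def)
qed

lemma smooth_on_subset: "smooth_on T f \<Longrightarrow> S \<subseteq> T \<Longrightarrow> smooth_on S f"
  by (auto simp: smooth_on_def)

lemma smooth_on_Un: "smooth_on S f \<Longrightarrow> smooth_on T f \<Longrightarrow> smooth_on (S \<union> T) f"
  by (auto simp: smooth_on_def)

lemma smooth_on_differentiable: "smooth_on S f \<Longrightarrow> x \<in> S \<Longrightarrow> f differentiable (at x)"
  unfolding smooth_on_def by (metis iter_deriv.simps(1))

lemma smooth_on_has_derivative:
  "smooth_on S f \<Longrightarrow> x \<in> S \<Longrightarrow> (f has_derivative frechet_derivative f (at x)) (at x)"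
  using smooth_on_differentiable frechet_derivative_works by blast

lemma smooth_on_iter_deriv: "smooth_on S f \<Longrightarrow> smooth_on S (iter_deriv vs f)"
  unfolding smooth_on_def by (metis iter_deriv_append)

lemma smooth_on_deriv: "smooth_on S f \<Longrightarrow> smooth_on S (\<lambda>x. frechet_derivative f (at x) v)"
  using smooth_on_iter_deriv[of S f "[v]"] by simp

text \<open>Smoothness by coinduction: it suffices to find a class of differentiable functions that is
  closed under directional derivatives.\<close>

lemma smooth_on_coinduct:
  assumes S: "open S" and "P f"
    and diff: "\<And>f x. P f \<Longrightarrow> x \<in> S \<Longrightarrow> f differentiable (at x)"
    and step: "\<And>f v. P f \<Longrightarrow> \<exists>h. P h \<and> (\<forall>x\<in>S. h x = frechet_derivative f (at x) v)"
  shows "smooth_on S f"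
proof -
  have "\<exists>h. P h \<and> (\<forall>x\<in>S. h x = iter_deriv vs f x)" for vs
  proof (induction vs)
    case (Cons v vs)
    then obtain h where h: "P h" "\<forall>x\<in>S. h x = iter_deriv vs f x" by blast
    obtain k where k: "P k" "\<forall>x\<in>S. k x = frechet_derivative h (at x) v"
      using step[OF h(1)] by blast
    moreover have "frechet_derivative h (at x) = frechet_derivative (iter_deriv vs f) (at x)"
      if "x \<in> S" for x
      using h(2) that by (intro frechet_derivative_eq_on_open[OF S]) auto
    ultimately show ?case by auto
  qed (use \<open>P f\<close> in auto)
  then show ?thesis
    unfolding smooth_on_def using differentiable_eq_on_open[OF S] diff by metis
qed

lemma smooth_on_const: "open S \<Longrightarrow> smooth_on S (\<lambda>x. c)"
  by (rule smooth_on_coinduct[where P = "\<lambda>f. \<exists>c. f = (\<lambda>x. c)"]) (auto intro!: exI[of _ "\<lambda>x. 0"])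

lemma smooth_on_bounded_linear:
  assumes "open S" "bounded_linear f"
  shows "smooth_on S f"
proof (rule smooth_on_coinduct[where P = "\<lambda>g. g = f \<or> (\<exists>c. g = (\<lambda>x. c))"])
  fix g and v
  assume "g = f \<or> (\<exists>c. g = (\<lambda>x. c))"
  then show "\<exists>h. (h = f \<or> (\<exists>c. h = (\<lambda>x. c))) \<and>
      (\<forall>x\<in>S. h x = frechet_derivative g (at x) v)"
    using frechet_derivative_at[OF bounded_linear_imp_has_derivative[OF assms(2)]]
    by (metis frechet_derivative_const)
qed (use assms bounded_linear_imp_differentiable in auto)

lemma smooth_on_linear:
  fixes f :: "'a::euclidean_space \<Rightarrow> 'b::real_normed_vector"
  shows "open S \<Longrightarrow> linear f \<Longrightarrow> smooth_on S f"
  by (simp add: linear_conv_bounded_linear smooth_on_bounded_linear)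

lemma frechet_derivative_add:
  assumes "f differentiable (at x)" "g differentiable (at x)"
  shows "frechet_derivative (\<lambda>x. f x + g x) (at x) v
    = frechet_derivative f (at x) v + frechet_derivative g (at x) v"
  using frechet_derivative_at[OF has_derivative_add[OF assms[unfolded frechet_derivative_works]]]
  by (simp add: fun_eq_iff)

lemma smooth_on_add:
  assumes S: "open S" and "smooth_on S f" "smooth_on S g"
  shows "smooth_on S (\<lambda>x. f x + g x)"
proof (rule smooth_on_coinduct[where
      P = "\<lambda>h. \<exists>f g. smooth_on S f \<and> smooth_on S g \<and> h = (\<lambda>x. f x + g x)"])
  fix h v assume "\<exists>f g. smooth_on S f \<and> smooth_on S g \<and> h = (\<lambda>x. f x + g x)"
  then obtain f g where fg: "smooth_on S f" "smooth_on S g" "h = (\<lambda>x. f x + g x)" by blast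
  have "frechet_derivative h (at x) v = frechet_derivative f (at x) v + frechet_derivative g (at x) v"
    if "x \<in> S" for x
    unfolding fg(3) using that fg by (intro frechet_derivative_add) (auto intro: smooth_on_differentiable)
  moreover have "smooth_on S (\<lambda>x. frechet_derivative f (at x) v)"
    "smooth_on S (\<lambda>x. frechet_derivative g (at x) v)"
    by (intro smooth_on_deriv fg)+
  ultimately show "\<exists>k. (\<exists>f g. smooth_on S f \<and> smooth_on S g \<and> k = (\<lambda>x. f x + g x)) \<and>
      (\<forall>x\<in>S. k x = frechet_derivative h (at x) v)"
    by (intro exI[of _ "\<lambda>x. frechet_derivative f (at x) v + frechet_derivative g (at x) v"]) auto
qed (use assms smooth_on_differentiable in \<open>auto intro!: differentiable_add\<close>)

lemma smooth_on_sum: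
  assumes "open S" "\<And>i. i \<in> I \<Longrightarrow> smooth_on S (f i)"
  shows "smooth_on S (\<lambda>x. \<Sum>i\<in>I. f i x)"
  using assms(2)
  by (induction I rule: infinite_finite_induct) (auto simp: assms(1) smooth_on_const smooth_on_add)

lemma frechet_derivative_bounded_linear:
  assumes "bounded_linear l" "f differentiable (at x)"
  shows "frechet_derivative (\<lambda>x. l (f x)) (at x) v = l (frechet_derivative f (at x) v)"
  using frechet_derivative_at[OF bounded_linear.has_derivative[OF assms(1)
        assms(2)[unfolded frechet_derivative_works]]]
  by (simp add: fun_eq_iff)

lemma differentiable_bounded_linear:
  assumes "bounded_linear l" "f differentiable (at x)"
  shows "(\<lambda>x. l (f x)) differentiable (at x)"
  using bounded_linear.has_derivative[OF assms(1)] assms(2) unfolding differentiable_def by blast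

lemma smooth_on_bounded_linear_compose:
  assumes S: "open S" and l: "bounded_linear l" and "smooth_on S f"
  shows "smooth_on S (\<lambda>x. l (f x))"
proof (rule smooth_on_coinduct[where P = "\<lambda>h. \<exists>f. smooth_on S f \<and> h = (\<lambda>x. l (f x))"])
  fix h v assume "\<exists>f. smooth_on S f \<and> h = (\<lambda>x. l (f x))"
  then obtain f where f: "smooth_on S f" "h = (\<lambda>x. l (f x))" by blast
  show "\<exists>k. (\<exists>f. smooth_on S f \<and> k = (\<lambda>x. l (f x))) \<and>
      (\<forall>x\<in>S. k x = frechet_derivative h (at x) v)"
    using smooth_on_deriv[OF f(1)] smooth_on_differentiable[OF f(1)]
    by (intro exI[of _ "\<lambda>x. l (frechet_derivative f (at x) v)"] conjI
        exI[of _ "\<lambda>x. frechet_derivative f (at x) v"])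
      (simp_all add: f(2) frechet_derivative_bounded_linear[OF l])
qed (use assms in \<open>auto intro!: differentiable_bounded_linear[OF l] intro: smooth_on_differentiable\<close>)

text \<open>By the Leibniz rule the derivative of one product is a sum of two, so single products
  are not closed under derivatives. Sums of products are, as the coinduction demands.\<close>

inductive sum_of_products for S and b where
  prod: "smooth_on S f \<Longrightarrow> smooth_on S g \<Longrightarrow> sum_of_products S b (\<lambda>x. b (f x) (g x))"
| add: "sum_of_products S b f \<Longrightarrow> sum_of_products S b g \<Longrightarrow> sum_of_products S b (\<lambda>x. f x + g x)"

lemma frechet_derivative_bilinear:
  assumes "bounded_bilinear b" "f differentiable (at x)" "g differentiable (at x)"
  shows "frechet_derivative (\<lambda>x. b (f x) (g x)) (at x) v
    = b (f x) (frechet_derivative g (at x) v) + b (frechet_derivative f (at x) v) (g x)"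
  using frechet_derivative_at[OF bounded_bilinear.FDERIV[OF assms(1)
        assms(2,3)[unfolded frechet_derivative_works]]]
  by (simp add: fun_eq_iff)

lemma smooth_on_bilinear:
  assumes S: "open S" and b: "bounded_bilinear b" and "smooth_on S f" "smooth_on S g"
  shows "smooth_on S (\<lambda>x. b (f x) (g x))"
proof (rule smooth_on_coinduct[where P = "sum_of_products S b"])
  show diff: "h differentiable at x" if "sum_of_products S b h" "x \<in> S" for h x
    using that
  proof induction
    case (prod f g)
    then show ?case
      using bounded_bilinear.FDERIV[OF b smooth_on_has_derivative smooth_on_has_derivative]
      unfolding differentiable_def by blast
  qed (auto intro: differentiable_add)
  show "\<exists>k. sum_of_products S b k \<and> (\<forall>x\<in>S. k x = frechet_derivative h (at x) v)"
    if "sum_of_products S b h" for h v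
    using that
  proof induction
    case (prod f g)
    show ?case
      by (rule exI[of _ "\<lambda>x. b (f x) (frechet_derivative g (at x) v)
            + b (frechet_derivative f (at x) v) (g x)"])
        (auto intro!: sum_of_products.intros prod smooth_on_deriv
          frechet_derivative_bilinear[OF b, symmetric] smooth_on_differentiable[OF prod(1)]
          smooth_on_differentiable[OF prod(2)])
  next
    case (add f g)
    then obtain f' g' where "sum_of_products S b f'" "sum_of_products S b g'"
      "\<forall>x\<in>S. f' x = frechet_derivative f (at x) v" "\<forall>x\<in>S. g' x = frechet_derivative g (at x) v"
      by blast
    then show ?case
      by (intro exI[of _ "\<lambda>x. f' x + g' x"])
        (use add.hyps diff in \<open>auto intro!: sum_of_products.add frechet_derivative_add[symmetric]\<close>)
  qed
qed (use assms in \<open>auto intro: sum_of_products.prod\<close>)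

lemmas smooth_on_mult = smooth_on_bilinear[OF _ bounded_bilinear_mult]
lemmas smooth_on_scaleR = smooth_on_bilinear[OF _ bounded_bilinear_scaleR]

lemma smooth_on_diff:
  assumes "open S" "smooth_on S f" "smooth_on S g"
  shows "smooth_on S (\<lambda>x. f x - g x)"
  using smooth_on_add[OF assms(1,2) smooth_on_bounded_linear_compose[OF assms(1) _ assms(3)],
      of uminus]
  by (simp add: bounded_linear_minus bounded_linear_ident)

lemma smooth_on_prod:
  fixes f :: "'i \<Rightarrow> 'a::real_normed_vector \<Rightarrow> 'b::{real_normed_algebra, comm_monoid_mult, semiring_1}"
  assumes "open S" "\<And>i. i \<in> I \<Longrightarrow> smooth_on S (f i)"
  shows "smooth_on S (\<lambda>x. \<Prod>i\<in>I. f i x)"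
  using assms(2)
  by (induction I rule: infinite_finite_induct)
    (auto simp: assms(1) smooth_on_const intro!: smooth_on_mult)

lemma smooth_on_power:
  fixes f :: "'a::real_normed_vector \<Rightarrow> 'b::real_normed_field"
  shows "open S \<Longrightarrow> smooth_on S f \<Longrightarrow> smooth_on S (\<lambda>x. f x ^ n)"
  by (induction n) (auto simp: smooth_on_const intro!: smooth_on_mult)

lemma frechet_derivative_basis:
  assumes "f differentiable (at x)"
  shows "frechet_derivative f (at x) v = (\<Sum>b\<in>Basis. (v \<bullet> b) *\<^sub>R frechet_derivative f (at x) b)"
proof -
  have "linear (frechet_derivative f (at x))"
    by (rule linear_frechet_derivative[OF assms])
  then have "frechet_derivative f (at x) (\<Sum>b\<in>Basis. (v \<bullet> b) *\<^sub>R b)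
      = (\<Sum>b\<in>Basis. (v \<bullet> b) *\<^sub>R frechet_derivative f (at x) b)"
    by (simp add: linear_sum linear_scale)
  then show ?thesis by (simp add: euclidean_representation)
qed

text \<open>The direction may vary smoothly with the point, as it does for invariant vector fields;
  expansion in a basis reduces this to constant directions.\<close>

lemma smooth_on_frechet_derivative:
  fixes f :: "'a::euclidean_space \<Rightarrow> 'b::real_normed_vector"
  assumes "open S" "smooth_on S f" "smooth_on S w"
  shows "smooth_on S (\<lambda>x. frechet_derivative f (at x) (w x))"
  by (rule smooth_on_cong[OF assms(1) _ smooth_on_sum[of S Basis
          "\<lambda>b x. (w x \<bullet> b) *\<^sub>R frechet_derivative f (at x) b"]])
    (use assms in \<open>auto intro!: smooth_on_scaleR smooth_on_deriv bounded_linear_inner_left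
        smooth_on_bounded_linear_compose[where l = "\<lambda>v. v \<bullet> _"]
        frechet_derivative_basis[symmetric] smooth_on_differentiable[OF assms(2)]\<close>)

text \<open>By the chain rule a directional derivative of \<open>g \<circ> u\<close> is a sum of
  directional derivatives of \<open>g\<close> taken at \<open>u x\<close>, weighted by the
  components of the derivative of \<open>u\<close>. The factor \<open>h\<close> collects these
  weights.\<close>

inductive sum_of_composites for S T u where
  comp: "smooth_on S (h :: _ \<Rightarrow> real) \<Longrightarrow> smooth_on T g \<Longrightarrow>
    sum_of_composites S T u (\<lambda>x. h x *\<^sub>R g (u x))"
| zero: "sum_of_composites S T u (\<lambda>x. 0)"
| add: "sum_of_composites S T u f \<Longrightarrow> sum_of_composites S T u g \<Longrightarrow>
    sum_of_composites S T u (\<lambda>x. f x + g x)"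

lemma sum_of_composites_sum:
  "(\<And>i. i \<in> I \<Longrightarrow> sum_of_composites S T u (f i)) \<Longrightarrow>
    sum_of_composites S T u (\<lambda>x. \<Sum>i\<in>I. f i x)"
  by (induction I rule: infinite_finite_induct) (auto intro: sum_of_composites.intros)

lemma frechet_derivative_comp:
  assumes "u differentiable (at x)" "g differentiable (at (u x))"
  shows "frechet_derivative (\<lambda>x. g (u x)) (at x) v
    = frechet_derivative g (at (u x)) (frechet_derivative u (at x) v)"
  using frechet_derivative_compose[OF assms] assms by (simp add: o_def fun_eq_iff)

lemma smooth_on_compose:
  fixes u :: "'a::euclidean_space \<Rightarrow> 'b::euclidean_space" and g :: "'b \<Rightarrow> 'c::real_normed_vector"
  assumes S: "open S" and g: "smooth_on T g" and u: "smooth_on S u" and uS: "u ` S \<subseteq> T"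
  shows "smooth_on S (\<lambda>x. g (u x))"
proof (rule smooth_on_coinduct[where P = "sum_of_composites S T u"])
  have gu: "(\<lambda>x. g (u x)) differentiable at x" if "smooth_on T g" "x \<in> S" for g :: "'b \<Rightarrow> 'c" and x
    using differentiable_chain_at[OF smooth_on_differentiable[OF u that(2)]
        smooth_on_differentiable[OF that(1)]] uS that(2)
    by (auto simp: o_def)
  show diff: "f differentiable at x" if "sum_of_composites S T u f" "x \<in> S"
    for f :: "'a \<Rightarrow> 'c" and x
    using that
  proof induction
    case (comp h g)
    then show ?case
      using has_derivative_scaleR[OF smooth_on_has_derivative[OF comp(1,3)]
          gu[OF comp(2,3), unfolded frechet_derivative_works]]
      unfolding differentiable_def by blast
  qed (auto intro: differentiable_add)
  show "\<exists>k. sum_of_composites S T u k \<and> (\<forall>x\<in>S. k x = frechet_derivative f (at x) v)"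
    if "sum_of_composites S T u f" for f :: "'a \<Rightarrow> 'c" and v
    using that
  proof induction
    case (comp h g)
    let ?k = "\<lambda>x. frechet_derivative h (at x) v *\<^sub>R g (u x) +
      (\<Sum>b\<in>Basis. (h x * (frechet_derivative u (at x) v \<bullet> b)) *\<^sub>R frechet_derivative g (at (u x)) b)"
    have "?k x = frechet_derivative (\<lambda>x. h x *\<^sub>R g (u x)) (at x) v" if x: "x \<in> S" for x
    proof -
      have dg: "g differentiable at (u x)" and du: "u differentiable at x"
        using smooth_on_differentiable[OF comp(2)] smooth_on_differentiable[OF u x] uS x by auto
      have "frechet_derivative (\<lambda>x. h x *\<^sub>R g (u x)) (at x) v
        = h x *\<^sub>R frechet_derivative (\<lambda>x. g (u x)) (at x) v + frechet_derivative h (at x) v *\<^sub>R g (u x)"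
        using frechet_derivative_bilinear[OF bounded_bilinear_scaleR
            smooth_on_differentiable[OF comp(1) x] gu[OF comp(2) x]] .
      also have "frechet_derivative (\<lambda>x. g (u x)) (at x) v
        = frechet_derivative g (at (u x)) (frechet_derivative u (at x) v)"
        by (rule frechet_derivative_comp[OF du dg])
      also have "\<dots> = (\<Sum>b\<in>Basis. (frechet_derivative u (at x) v \<bullet> b) *\<^sub>R frechet_derivative g (at (u x)) b)"
        by (rule frechet_derivative_basis[OF dg])
      finally show ?thesis
        by (simp add: scaleR_right.sum)
    qed
    moreover have "sum_of_composites S T u ?k"
    proof (rule sum_of_composites.add)
      show "sum_of_composites S T u (\<lambda>x. frechet_derivative h (at x) v *\<^sub>R g (u x))"
        by (rule sum_of_composites.comp[OF smooth_on_deriv[OF comp(1)] comp(2)])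
      show "sum_of_composites S T u (\<lambda>x. \<Sum>b\<in>Basis.
          (h x * (frechet_derivative u (at x) v \<bullet> b)) *\<^sub>R frechet_derivative g (at (u x)) b)"
      proof (rule sum_of_composites_sum)
        fix b :: 'b
        have "smooth_on S (\<lambda>x. h x * (frechet_derivative u (at x) v \<bullet> b))"
          by (rule smooth_on_mult[OF S comp(1) smooth_on_bounded_linear_compose[OF S
                  bounded_linear_inner_left smooth_on_deriv[OF u]]])
        then show "sum_of_composites S T u (\<lambda>x. (h x * (frechet_derivative u (at x) v \<bullet> b)) *\<^sub>R
            frechet_derivative g (at (u x)) b)"
          by (rule sum_of_composites.comp[OF _ smooth_on_deriv[OF comp(2)]])
      qed
    qed
    ultimately show ?case by blast
  next
    case zero
    show ?case by (auto intro!: exI[of _ "\<lambda>x. 0"] sum_of_composites.zero)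
  next
    case (add f g)
    then obtain f' g' where "sum_of_composites S T u f'" "sum_of_composites S T u g'"
      "\<forall>x\<in>S. f' x = frechet_derivative f (at x) v" "\<forall>x\<in>S. g' x = frechet_derivative g (at x) v"
      by blast
    then show ?case
      by (intro exI[of _ "\<lambda>x. f' x + g' x"])
        (use add.hyps diff in \<open>auto intro!: sum_of_composites.add frechet_derivative_add[symmetric]\<close>)
  qed
  show "sum_of_composites S T u (\<lambda>x. g (u x))"
    using sum_of_composites.comp[OF smooth_on_const[OF S, of 1] g] by simp
qed (fact S)

section \<open>Smooth functions of one real variable\<close>

text \<open>For functions whose derivatives of all orders are known in closed form: inverses,
  complex powers, and the flat function exp(-1/t) below. Scalars enter the invariant class because
  the derivative in direction \<open>v\<close> carries the factor \<open>v\<close>.\<close>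

lemma smooth_on_real_sequence:
  fixes F :: "nat \<Rightarrow> real \<Rightarrow> 'b::real_normed_vector"
  assumes S: "open S"
    and F: "\<And>n x. x \<in> S \<Longrightarrow> (F n has_vector_derivative F (Suc n) x) (at x)"
  shows "smooth_on S (F 0)"
proof (rule smooth_on_coinduct[where P = "\<lambda>f. \<exists>c n. f = (\<lambda>x. c *\<^sub>R F n x)"])
  have D: "((\<lambda>x. c *\<^sub>R F n x) has_derivative (\<lambda>v. (v * c) *\<^sub>R F (Suc n) x)) (at x)" if "x \<in> S" for c n x
    using has_derivative_scaleR_right[OF F[OF that, of n, unfolded has_vector_derivative_def], of c]
    by (simp add: mult.commute)
  show "f differentiable at x" if "\<exists>c n. f = (\<lambda>x. c *\<^sub>R F n x)" "x \<in> S"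
    for f :: "real \<Rightarrow> 'b" and x
    using that D unfolding differentiable_def by blast
  show "\<exists>h. (\<exists>c n. h = (\<lambda>x. c *\<^sub>R F n x)) \<and> (\<forall>x\<in>S. h x = frechet_derivative f (at x) v)"
    if ex: "\<exists>c n. f = (\<lambda>x. c *\<^sub>R F n x)" for f :: "real \<Rightarrow> 'b" and v
  proof -
    obtain c n where f: "f = (\<lambda>x. c *\<^sub>R F n x)" using ex by blast
    show ?thesis
      unfolding f
      by (rule exI[of _ "\<lambda>x. (v * c) *\<^sub>R F (Suc n) x"])
        (use frechet_derivative_at[OF D] in \<open>auto simp: fun_eq_iff\<close>)
  qed
  show "\<exists>c n. F 0 = (\<lambda>x. c *\<^sub>R F n x)"
    by (intro exI[of _ 1] exI[of _ 0]) simp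
qed (fact S)

lemma smooth_on_inverse:
  fixes f :: "'a::euclidean_space \<Rightarrow> real"
  assumes "open S" "smooth_on S f" "\<And>x. x \<in> S \<Longrightarrow> f x \<noteq> 0"
  shows "smooth_on S (\<lambda>x. inverse (f x))"
proof (rule smooth_on_compose[OF assms(1) _ assms(2), of "- {0}" inverse])
  define F :: "nat \<Rightarrow> real \<Rightarrow> real" where "F n x = (- 1) ^ n * fact n * inverse x ^ Suc n" for n x
  have "(F n has_vector_derivative F (Suc n) x) (at x)" if "x \<in> - {0}" for n x
  proof -
    have "((\<lambda>x::real. (- 1) ^ n * fact n * inverse x ^ Suc n) has_real_derivative
        (- 1) ^ n * fact n * (of_nat (Suc n) * (- (inverse x ^ Suc (Suc 0))) * inverse x ^ n)) (at x)"
      using that DERIV_power[OF DERIV_inverse[of x UNIV], of "Suc n"]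
      by (intro DERIV_cmult) (simp add: mult_ac)
    then show ?thesis
      unfolding F_def has_real_derivative_iff_has_vector_derivative[symmetric]
      by (simp add: algebra_simps)
  qed
  then have "smooth_on (- {0}) (F 0)"
    by (intro smooth_on_real_sequence) auto
  then show "smooth_on (- {0::real}) inverse"
    by (simp add: F_def[abs_def])
qed (use assms in auto)

lemma smooth_on_divide:
  fixes f g :: "'a::euclidean_space \<Rightarrow> real"
  shows "open S \<Longrightarrow> smooth_on S f \<Longrightarrow> smooth_on S g \<Longrightarrow> (\<And>x. x \<in> S \<Longrightarrow> g x \<noteq> 0) \<Longrightarrow>
    smooth_on S (\<lambda>x. f x / g x)"
  unfolding divide_inverse by (intro smooth_on_mult smooth_on_inverse)

lemma smooth_on_of_real_powr: "smooth_on {0<..} (\<lambda>x. of_real x powr w :: complex)"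
proof -
  define F :: "nat \<Rightarrow> real \<Rightarrow> complex"
    where "F n x = (\<Prod>i<n. w - of_nat i) * of_real x powr (w - of_nat n)" for n x
  have "(F n has_vector_derivative F (Suc n) x) (at x)" if "x \<in> {0<..}" for n x
  proof -
    have "((\<lambda>z. z powr (w - of_nat n)) has_field_derivative
        (w - of_nat n) * of_real x powr (w - of_nat n - 1)) (at (of_real x))"
      using that by (intro has_field_derivative_powr) (auto simp: complex_nonpos_Reals_iff)
    then have "((\<lambda>z. (\<Prod>i<n. w - of_nat i) * z powr (w - of_nat n)) has_field_derivative
        (\<Prod>i<n. w - of_nat i) * ((w - of_nat n) * of_real x powr (w - of_nat n - 1))) (at (of_real x))"
      by (rule DERIV_cmult)
    from has_vector_derivative_real_field[OF this] show ?thesis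
      by (simp add: F_def[abs_def] algebra_simps)
  qed
  then have "smooth_on {0<..} (F 0)"
    by (intro smooth_on_real_sequence) auto
  then show ?thesis
    by (simp add: F_def[abs_def])
qed

section \<open>Derivatives along lines and the symmetry of second derivatives\<close>

lemma smooth_on_line_derivative:
  assumes "smooth_on S f" "p + s *\<^sub>R u \<in> S"
  shows "((\<lambda>s. f (p + s *\<^sub>R u)) has_vector_derivative
    frechet_derivative f (at (p + s *\<^sub>R u)) u) (at s)"
proof -
  have f: "(f has_derivative frechet_derivative f (at (p + s *\<^sub>R u))) (at (p + s *\<^sub>R u))"
    by (rule smooth_on_has_derivative[OF assms])
  have "((\<lambda>s. p + s *\<^sub>R u) has_derivative (\<lambda>k. k *\<^sub>R u)) (at s)"
    by (auto intro!: derivative_eq_intros)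
  from has_derivative_compose[OF this f] show ?thesis
    by (simp add: has_vector_derivative_def linear_scale[OF has_derivative_linear[OF f]])
qed

lemma iter_deriv_bounded_linear:
  assumes "open S" "bounded_linear l" "smooth_on S f" "x \<in> S"
  shows "iter_deriv vs (\<lambda>x. l (f x)) x = l (iter_deriv vs f x)"
  using assms(4)
proof (induction vs arbitrary: x)
  case (Cons v vs)
  have "frechet_derivative (iter_deriv vs (\<lambda>x. l (f x))) (at x)
      = frechet_derivative (\<lambda>x. l (iter_deriv vs f x)) (at x)"
    by (rule frechet_derivative_eq_on_open[OF assms(1) Cons.prems Cons.IH])
  then show ?case
    using frechet_derivative_bounded_linear[OF assms(2), of "iter_deriv vs f" x v] assms(3) Cons.prems
    by (simp add: smooth_on_def)
qed simp

text \<open>The mean value theorem is applied twice, first to the increment in direction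
  \<open>u\<close>, then to the first derivative in direction \<open>v\<close>. It is tied to real
  values, so complex functions are split into real and imaginary part afterwards. In
  \<open>iter_deriv [v, u]\<close> the derivative along \<open>u\<close> is taken first.\<close>

lemma second_difference_mean_value:
  fixes f :: "'a::real_normed_vector \<Rightarrow> real"
  assumes f: "smooth_on S f" and h: "h > 0" "h * (norm u + norm v) < e" and e: "ball x e \<subseteq> S"
  shows "\<exists>y\<in>ball x e. f (x + h *\<^sub>R u + h *\<^sub>R v) - f (x + h *\<^sub>R u) - f (x + h *\<^sub>R v) + f x
    = h * h * iter_deriv [v, u] f y"
proof -
  \<comment> \<open>The whole parallelogram spanned by \<open>h *\<^sub>R u\<close> and
    \<open>h *\<^sub>R v\<close> lies in the ball, hence so do the intermediate points of both
    applications.\<close>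
  have near: "x + s *\<^sub>R u + t *\<^sub>R v \<in> ball x e" if "0 \<le> s" "s \<le> h" "0 \<le> t" "t \<le> h" for s t
  proof -
    have "norm (s *\<^sub>R u + t *\<^sub>R v) \<le> s * norm u + t * norm v"
      using norm_triangle_ineq[of "s *\<^sub>R u" "t *\<^sub>R v"] that by simp
    also have "\<dots> \<le> h * norm u + h * norm v"
      using that by (intro add_mono mult_right_mono) auto
    also have "\<dots> < e" using h by (simp add: algebra_simps)
    finally show ?thesis by (simp add: dist_norm norm_minus_commute add.assoc add.commute)
  qed
  have line: "DERIV (\<lambda>s. g (p + s *\<^sub>R w)) s :> frechet_derivative g (at (p + s *\<^sub>R w)) w"
    if "smooth_on S g" "p + s *\<^sub>R w \<in> S" for g :: "'a \<Rightarrow> real" and p s w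
    using smooth_on_line_derivative[OF that]
    by (simp add: has_real_derivative_iff_has_vector_derivative)
  define F where "F s = f ((x + h *\<^sub>R v) + s *\<^sub>R u) - f (x + s *\<^sub>R u)" for s
  have "\<exists>s. 0 < s \<and> s < h \<and> F h - F 0 = (h - 0) *
      (frechet_derivative f (at ((x + h *\<^sub>R v) + s *\<^sub>R u)) u - frechet_derivative f (at (x + s *\<^sub>R u)) u)"
    unfolding F_def
    using near[of _ h] near[of _ 0] e h(1)
    by (intro MVT2 DERIV_diff line f) (auto simp: add_ac)
  then obtain s where s: "0 < s" "s < h" "F h - F 0 = h *
      (frechet_derivative f (at ((x + h *\<^sub>R v) + s *\<^sub>R u)) u - frechet_derivative f (at (x + s *\<^sub>R u)) u)"
    by auto
  define G where "G t = frechet_derivative f (at ((x + s *\<^sub>R u) + t *\<^sub>R v)) u" for t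
  have "\<exists>t. 0 < t \<and> t < h \<and> G h - G 0 = (h - 0) * iter_deriv [v, u] f ((x + s *\<^sub>R u) + t *\<^sub>R v)"
    unfolding G_def iter_deriv.simps
    using near[of s] e h(1) s
    by (intro MVT2 line smooth_on_deriv f) auto
  then obtain t where t: "0 < t" "t < h" "G h - G 0 = h * iter_deriv [v, u] f (x + s *\<^sub>R u + t *\<^sub>R v)"
    by auto
  have "F h - F 0 = h * (G h - G 0)"
    using s(3) by (simp add: G_def add_ac)
  then have "F h - F 0 = h * h * iter_deriv [v, u] f (x + s *\<^sub>R u + t *\<^sub>R v)"
    using t(3) by simp
  then show ?thesis
    using near[of s t] s t by (intro bexI[of _ "x + s *\<^sub>R u + t *\<^sub>R v"]) (auto simp: F_def add_ac)
qed

text \<open>The second difference is symmetric in \<open>u\<close> and \<open>v\<close>, so the two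
  mixed derivatives take a common value at points arbitrarily close to \<open>x\<close>; continuity
  carries this to \<open>x\<close>.\<close>

lemma iter_deriv_commute_real:
  fixes f :: "'a::real_normed_vector \<Rightarrow> real"
  assumes S: "open S" and f: "smooth_on S f" and x: "x \<in> S"
  shows "iter_deriv [u, v] f x = iter_deriv [v, u] f x"
proof (rule ccontr)
  let ?D = "\<lambda>y. dist (iter_deriv [u, v] f y) (iter_deriv [u, v] f x)"
  let ?E = "\<lambda>y. dist (iter_deriv [v, u] f y) (iter_deriv [v, u] f x)"
  assume neq: "iter_deriv [u, v] f x \<noteq> iter_deriv [v, u] f x"
  define \<epsilon> where "\<epsilon> = dist (iter_deriv [u, v] f x) (iter_deriv [v, u] f x) / 2"
  have \<epsilon>: "\<epsilon> > 0" using neq by (simp add: \<epsilon>_def)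
  have near: "\<exists>d>0. \<forall>y. dist y x < d \<longrightarrow> dist (iter_deriv vs f y) (iter_deriv vs f x) < \<epsilon>" for vs
    using differentiable_imp_continuous_within[of "iter_deriv vs f" x UNIV] f x \<epsilon>
    by (simp add: smooth_on_def continuous_at_eps_delta del: iter_deriv.simps)
  obtain d1 where d1: "d1 > 0" "\<And>y. dist y x < d1 \<Longrightarrow> ?D y < \<epsilon>"
    using near[of "[u, v]"] by blast
  obtain d2 where d2: "d2 > 0" "\<And>y. dist y x < d2 \<Longrightarrow> ?E y < \<epsilon>"
    using near[of "[v, u]"] by blast
  note d = d1 d2
  obtain d3 where d3: "d3 > 0" "ball x d3 \<subseteq> S"
    using S x openE by blast
  define e where "e = min d1 (min d2 d3)"
  have e: "e > 0" "ball x e \<subseteq> S" using d d3 by (auto simp: e_def)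
  \<comment> \<open>The summand 1 keeps the denominator of \<open>h\<close> positive when both
    vectors vanish, and the factor 2 in \<open>h\<close> makes the bound by \<open>e\<close>
    strict.\<close>
  define P where "P = norm u + norm v + 1"
  define h where "h = e / (2 * P)"
  have pos: "P > 0" by (simp add: P_def add_nonneg_pos)
  have h: "h > 0" using e pos by (simp add: h_def)
  have "h * (norm u + norm v) \<le> h * P"
    using h by (simp add: P_def)
  also have "\<dots> = e / 2" using pos by (simp add: h_def)
  finally have h': "h * (norm u + norm v) < e" "h * (norm v + norm u) < e"
    using e by (auto simp: add.commute)
  obtain y where y: "y \<in> ball x e" "f (x + h *\<^sub>R u + h *\<^sub>R v) - f (x + h *\<^sub>R u) - f (x + h *\<^sub>R v) + f x
    = h * h * iter_deriv [v, u] f y"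
    using second_difference_mean_value[OF f h h'(1) e(2)] by blast
  obtain z where z: "z \<in> ball x e" "f (x + h *\<^sub>R v + h *\<^sub>R u) - f (x + h *\<^sub>R v) - f (x + h *\<^sub>R u) + f x
    = h * h * iter_deriv [u, v] f z"
    using second_difference_mean_value[OF f h h'(2) e(2)] by blast
  have "f (x + h *\<^sub>R u + h *\<^sub>R v) - f (x + h *\<^sub>R u) - f (x + h *\<^sub>R v) + f x
      = f (x + h *\<^sub>R v + h *\<^sub>R u) - f (x + h *\<^sub>R v) - f (x + h *\<^sub>R u) + f x"
    by (simp add: algebra_simps)
  then have "h * h * iter_deriv [v, u] f y = h * h * iter_deriv [u, v] f z"
    unfolding y(2) z(2) .
  then have yz: "iter_deriv [v, u] f y = iter_deriv [u, v] f z"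
    using h by simp
  have "dist y x < d2" "dist z x < d1"
    using y(1) z(1) by (auto simp: e_def dist_commute)
  then have "?E y < \<epsilon>" "?D z < \<epsilon>" using d by blast+
  then have "dist (iter_deriv [u, v] f x) (iter_deriv [v, u] f x) < 2 * \<epsilon>"
    unfolding yz dist_real_def by linarith
  then show False by (simp add: \<epsilon>_def)
qed

lemma iter_deriv_commute:
  fixes f :: "'a::real_normed_vector \<Rightarrow> complex"
  assumes S: "open S" and f: "smooth_on S f" and x: "x \<in> S"
  shows "iter_deriv [u, v] f x = iter_deriv [v, u] f x"
proof (rule complex_eqI)
  show "Re (iter_deriv [u, v] f x) = Re (iter_deriv [v, u] f x)"
    using iter_deriv_commute_real[OF S smooth_on_bounded_linear_compose[OF S bounded_linear_Re f] x]
    by (simp only: iter_deriv_bounded_linear[OF S bounded_linear_Re f x])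
  show "Im (iter_deriv [u, v] f x) = Im (iter_deriv [v, u] f x)"
    using iter_deriv_commute_real[OF S smooth_on_bounded_linear_compose[OF S bounded_linear_Im f] x]
    by (simp only: iter_deriv_bounded_linear[OF S bounded_linear_Im f x])
qed

section \<open>Matrix-valued functions and openness of the general linear group\<close>

lemma bounded_linear_entry: "bounded_linear (\<lambda>g::real^'n^'m. g $ i $ j)"
  by (rule bounded_linear_compose[OF bounded_linear_vec_nth bounded_linear_vec_nth])

lemma smooth_on_entry: "open S \<Longrightarrow> smooth_on S (\<lambda>g::real^'n^'m. g $ i $ j)"
  by (rule smooth_on_bounded_linear[OF _ bounded_linear_entry])

lemma smooth_on_det:
  fixes A :: "'a::real_normed_vector \<Rightarrow> real^'n^'n"
  assumes "open S" "\<And>i j. smooth_on S (\<lambda>x. A x $ i $ j)"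
  shows "smooth_on S (\<lambda>x. det (A x))"
  unfolding det_def
  by (intro smooth_on_sum smooth_on_mult smooth_on_prod smooth_on_const assms)

lemma matrix_entry_expansion:
  "(A :: real^'n^'m) = (\<Sum>i\<in>UNIV. \<Sum>j\<in>UNIV. A $ i $ j *\<^sub>R axis i (axis j 1))"
proof -
  have "(\<Sum>x\<in>UNIV. \<Sum>y\<in>UNIV. A $ x $ y * axis x (axis y 1) $ i $ j)
      = (\<Sum>x\<in>UNIV. if i = x then \<Sum>y\<in>UNIV. if j = y then A $ x $ y else 0 else 0)" for i j
    by (intro sum.cong) (auto simp: axis_def if_distrib[of "\<lambda>x. _ * x"] cong: if_cong)
  then show ?thesis by (simp add: vec_eq_iff)
qed

lemma smooth_on_matrix:
  fixes A :: "'a::real_normed_vector \<Rightarrow> real^'n^'m"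
  assumes "open S" "\<And>i j. smooth_on S (\<lambda>x. A x $ i $ j)"
  shows "smooth_on S A"
  by (rule smooth_on_cong[OF assms(1) matrix_entry_expansion[symmetric]])
    (intro smooth_on_sum smooth_on_scaleR smooth_on_const assms)

lemma GL_det: "g \<in> GL \<longleftrightarrow> det g \<noteq> 0"
  by (simp add: GL_def invertible_det_nz)

lemma smooth_on_continuous_on: "smooth_on S f \<Longrightarrow> continuous_on S f"
  by (meson continuous_at_imp_continuous_on differentiable_imp_continuous_within smooth_on_differentiable)

lemma open_GL: "open (GL :: (real^'n^'n) set)"
proof -
  have "continuous_on UNIV (det :: real^'n^'n \<Rightarrow> real)"
    by (intro smooth_on_continuous_on smooth_on_det smooth_on_entry) simp_all
  then have "open {g :: real^'n^'n. det g \<noteq> 0}"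
    by (intro open_Collect_neq) auto
  then show ?thesis by (simp add: GL_det[abs_def] GL_def invertible_det_nz)
qed

section \<open>Cutoff functions\<close>

text \<open>For t > 0 the n-th derivative of exp(-1/t) is P(1/t) exp(-1/t) with P =
  \<open>flat_poly n\<close>. The recursion is the product rule, with w = 1/t and dw/dt =
  -w^2.\<close>

fun flat_poly :: "nat \<Rightarrow> real poly" where
  "flat_poly 0 = 1"
| "flat_poly (Suc n) = (flat_poly n - pderiv (flat_poly n)) * [:0, 0, 1:]"

definition flat_deriv :: "nat \<Rightarrow> real \<Rightarrow> real" where
  "flat_deriv n t = (if t > 0 then poly (flat_poly n) (inverse t) * exp (- inverse t) else 0)"

lemma tendsto_poly_div_exp: "((\<lambda>w. poly p w * exp (- w)) \<longlongrightarrow> (0::real)) at_top"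
proof -
  have "((\<lambda>w. \<Sum>i\<le>degree p. coeff p i * (w ^ i / exp w)) \<longlongrightarrow> 0) at_top"
    by (intro tendsto_null_sum tendsto_mult_right_zero tendsto_power_div_exp_0)
  moreover have "(\<Sum>i\<le>degree p. coeff p i * (w ^ i / exp w)) = poly p w * exp (- w)" for w
    by (simp add: poly_altdef sum_distrib_right exp_minus divide_inverse mult.assoc)
  ultimately show ?thesis by simp
qed

lemma flat_deriv_has_derivative: "(flat_deriv n has_real_derivative flat_deriv (Suc n) t) (at t)"
proof -
  consider "t > 0" | "t < 0" | "t = 0" by linarith
  then show ?thesis
  proof cases
    case 1
    have "((\<lambda>t. poly (flat_poly n) (inverse t) * exp (- inverse t)) has_real_derivative
        poly (flat_poly (Suc n)) (inverse t) * exp (- inverse t)) (at t)"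
      using 1 by (auto intro!: derivative_eq_intros DERIV_chain2[OF poly_DERIV]
          simp: algebra_simps power2_eq_square)
    then have "(flat_deriv n has_real_derivative
        poly (flat_poly (Suc n)) (inverse t) * exp (- inverse t)) (at t)"
      by (rule has_field_derivative_transform_within_open[where S = "{0<..}"])
        (use 1 in \<open>auto simp: flat_deriv_def\<close>)
    moreover have "flat_deriv (Suc n) t = poly (flat_poly (Suc n)) (inverse t) * exp (- inverse t)"
      using 1 by (simp only: flat_deriv_def if_True)
    ultimately show ?thesis by simp
  next
    case 2
    have "(flat_deriv n has_real_derivative 0) (at t)"
      by (rule has_field_derivative_transform_within_open[OF DERIV_const, where S = "{..<0}"])
        (use 2 in \<open>auto simp: flat_deriv_def\<close>)
    then show ?thesis using 2 by (simp add: flat_deriv_def)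
  next
    case 3
    have "((\<lambda>h. (flat_deriv n (0 + h) - flat_deriv n 0) / h) \<longlongrightarrow> 0) (at 0)"
    proof (rule filterlim_split_at)
      show "((\<lambda>h. (flat_deriv n (0 + h) - flat_deriv n 0) / h) \<longlongrightarrow> 0) (at_left 0)"
        by (rule tendsto_eventually) (auto simp: eventually_at_left_field flat_deriv_def intro!: exI[of _ "-1"])
      \<comment> \<open>The quotient by h turns P(w) into w P(w), that is \<open>pCons 0\<close>,
        where w = 1/h; the exponential beats it as w tends to infinity.\<close>
      have "((\<lambda>h. poly (pCons 0 (flat_poly n)) (inverse h) * exp (- inverse h)) \<longlongrightarrow> 0) (at_right (0::real))"
        by (rule filterlim_compose[OF tendsto_poly_div_exp filterlim_inverse_at_top_right])
      moreover have "\<forall>\<^sub>F h::real in at_right 0. poly (pCons 0 (flat_poly n)) (inverse h) * exp (- inverse h)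
          = (flat_deriv n (0 + h) - flat_deriv n 0) / h"
        unfolding eventually_at_right_field
        by (intro exI[of _ 1]) (auto simp: flat_deriv_def field_simps)
      ultimately show "((\<lambda>h. (flat_deriv n (0 + h) - flat_deriv n 0) / h) \<longlongrightarrow> 0) (at_right 0)"
        by (rule Lim_transform_eventually)
    qed
    then show ?thesis
      using 3 by (simp add: DERIV_def flat_deriv_def)
  qed
qed

lemma smooth_on_flat: "smooth_on UNIV (flat_deriv 0)"
  using flat_deriv_has_derivative
  by (intro smooth_on_real_sequence) (auto simp: has_real_derivative_iff_has_vector_derivative)

text \<open>A smooth step from 1 on r \<le> 1/4 to 0 on r \<ge> 1/2. The two flat functions are
  positive on overlapping half-lines, which keeps the denominator positive.\<close>

definition cutoff :: "real \<Rightarrow> real" where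
  "cutoff r = flat_deriv 0 (1/2 - r) / (flat_deriv 0 (1/2 - r) + flat_deriv 0 (r - 1/4))"

lemma flat_nonneg: "flat_deriv 0 t \<ge> 0"
  by (simp add: flat_deriv_def)

lemma flat_pos: "flat_deriv 0 t > 0 \<longleftrightarrow> t > 0"
  by (simp add: flat_deriv_def)

lemma cutoff_denominator: "flat_deriv 0 (1/2 - r) + flat_deriv 0 (r - 1/4) \<noteq> 0"
proof -
  have "flat_deriv 0 (1/2 - r) > 0 \<or> flat_deriv 0 (r - 1/4) > 0"
    unfolding flat_pos by linarith
  then show ?thesis
    using flat_nonneg[of "1/2 - r"] flat_nonneg[of "r - 1/4"] by linarith
qed

lemma cutoff_eq_1: "r \<le> 1/4 \<Longrightarrow> cutoff r = 1"
  using cutoff_denominator[of r] by (simp add: cutoff_def flat_deriv_def)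

lemma cutoff_eq_0: "r \<ge> 1/2 \<Longrightarrow> cutoff r = 0"
  by (simp add: cutoff_def flat_deriv_def)

lemma smooth_on_cutoff: "smooth_on UNIV cutoff"
proof -
  have a: "smooth_on UNIV (\<lambda>r. flat_deriv 0 (1/2 - r))"
    by (rule smooth_on_compose[OF _ smooth_on_flat])
      (intro smooth_on_diff smooth_on_const smooth_on_bounded_linear bounded_linear_ident open_UNIV subset_UNIV)+
  have b: "smooth_on UNIV (\<lambda>r. flat_deriv 0 (r - 1/4))"
    by (rule smooth_on_compose[OF _ smooth_on_flat])
      (intro smooth_on_diff smooth_on_const smooth_on_bounded_linear bounded_linear_ident open_UNIV subset_UNIV)+
  show ?thesis
    unfolding cutoff_def[abs_def]
    by (intro smooth_on_divide smooth_on_add a b cutoff_denominator) auto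
qed

section \<open>Invariant vector fields\<close>

text \<open>The left invariant vector field of \<open>X\<close>. The value 0 off \<open>GL\<close>
  keeps \<open>smooth_fns\<close> stable, so that these operators can be iterated and their results
  compared as functions.\<close>

definition rderiv :: "real^'n^'n \<Rightarrow> (real^'n^'n \<Rightarrow> complex) \<Rightarrow> real^'n^'n \<Rightarrow> complex" where
  "rderiv X f = (\<lambda>g. if g \<in> GL then frechet_derivative f (at g) (g ** X) else 0)"

definition smooth_fns :: "(real^'n^'n \<Rightarrow> complex) set" where
  "smooth_fns = {f. smooth_on GL f \<and> (\<forall>g. g \<notin> GL \<longrightarrow> f g = 0)}"

lemma smooth_fns_smooth: "f \<in> smooth_fns \<Longrightarrow> smooth_on GL f"
  by (simp add: smooth_fns_def)

lemma smooth_fns_off_GL: "f \<in> smooth_fns \<Longrightarrow> g \<notin> GL \<Longrightarrow> f g = 0"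
  by (simp add: smooth_fns_def)

lemma smooth_fns_differentiable: "f \<in> smooth_fns \<Longrightarrow> g \<in> GL \<Longrightarrow> f differentiable (at g)"
  using smooth_fns_smooth smooth_on_differentiable by blast

lemma matrix_mul_scaleR_right: "A ** (c *\<^sub>R B) = c *\<^sub>R (A ** B)" for A :: "real^'n^'m"
  by (simp add: vec_eq_iff matrix_matrix_mult_def scaleR_right.sum sum_distrib_left mult_ac)

lemma matrix_mul_scaleR_left: "(c *\<^sub>R A) ** B = c *\<^sub>R (A ** B)" for A :: "real^'n^'m"
  by (simp add: vec_eq_iff matrix_matrix_mult_def sum_distrib_left mult_ac)

lemma matrix_mul_zero_right: "A ** 0 = 0" for A :: "real^'n^'m"
  by (simp add: vec_eq_iff matrix_matrix_mult_def)

lemma matrix_add_rdistrib': "(A + B) ** C = A ** C + B ** C" for A :: "real^'n^'m"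
  by (simp add: vec_eq_iff matrix_matrix_mult_def sum.distrib algebra_simps)

lemma matrix_sub_rdistrib': "(A - B) ** C = A ** C - B ** C" for A :: "real^'n^'m"
  by (simp add: vec_eq_iff matrix_matrix_mult_def sum_subtractf algebra_simps)

lemma matrix_diff_ldistrib: "A ** (B - C) = A ** B - A ** C" for A :: "real^'n^'m"
  by (simp add: vec_eq_iff matrix_matrix_mult_def sum_subtractf algebra_simps)

lemma linear_matrix_mul_right: "linear (\<lambda>g. g ** X)" for X :: "real^'n^'m"
  by (rule linearI) (simp_all add: matrix_add_rdistrib' matrix_mul_scaleR_left)

lemma linear_matrix_mul_left: "linear (\<lambda>g. h ** g)" for h :: "real^'n^'m"
  by (rule linearI) (simp_all add: matrix_add_ldistrib matrix_mul_scaleR_right)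

lemma GL_mult: "g \<in> GL \<Longrightarrow> h \<in> GL \<Longrightarrow> g ** h \<in> GL"
  by (simp add: GL_det det_mul)

lemma one_in_GL: "mat 1 \<in> GL"
  by (simp add: GL_det)

lemma rderiv_smooth_fns:
  assumes "f \<in> smooth_fns"
  shows "rderiv X f \<in> smooth_fns"
proof -
  have "smooth_on GL (\<lambda>g. frechet_derivative f (at g) (g ** X))"
    by (intro smooth_on_frechet_derivative open_GL smooth_fns_smooth assms smooth_on_linear
        linear_matrix_mul_right)
  then have "smooth_on GL (rderiv X f)"
    by (rule smooth_on_cong[OF open_GL, rotated]) (simp add: rderiv_def)
  then show ?thesis
    by (simp add: smooth_fns_def rderiv_def)
qed

lemma smooth_fns_sum:
  "(\<And>i. i \<in> I \<Longrightarrow> F i \<in> smooth_fns) \<Longrightarrow> (\<lambda>g. \<Sum>i\<in>I. c i * F i g) \<in> smooth_fns"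
  unfolding smooth_fns_def
  by (auto intro!: smooth_on_sum smooth_on_mult smooth_on_const open_GL)

lemma smooth_fns_cmult: "f \<in> smooth_fns \<Longrightarrow> (\<lambda>g. c * f g) \<in> smooth_fns"
  unfolding smooth_fns_def by (auto intro!: smooth_on_mult smooth_on_const open_GL)

lemma smooth_fns_add: "f \<in> smooth_fns \<Longrightarrow> h \<in> smooth_fns \<Longrightarrow> (\<lambda>g. f g + h g) \<in> smooth_fns"
  unfolding smooth_fns_def by (auto intro!: smooth_on_add open_GL)

lemma rderiv_add:
  assumes "f \<in> smooth_fns" "h \<in> smooth_fns"
  shows "rderiv X (\<lambda>g. f g + h g) = (\<lambda>g. rderiv X f g + rderiv X h g)"
  using frechet_derivative_add[of f _ h] smooth_fns_differentiable[OF assms(1)]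
    smooth_fns_differentiable[OF assms(2)]
  by (auto simp: rderiv_def fun_eq_iff)

lemma rderiv_cmult:
  assumes "f \<in> smooth_fns"
  shows "rderiv X (\<lambda>g. c * f g) = (\<lambda>g. c * rderiv X f g)"
  using frechet_derivative_bounded_linear[OF bounded_linear_mult_right, of f _ c]
    smooth_fns_differentiable[OF assms]
  by (auto simp: rderiv_def fun_eq_iff)

lemma rderiv_sum:
  assumes "\<And>i. i \<in> I \<Longrightarrow> F i \<in> smooth_fns"
  shows "rderiv X (\<lambda>g. \<Sum>i\<in>I. c i * F i g) = (\<lambda>g. \<Sum>i\<in>I. c i * rderiv X (F i) g)"
  using assms
proof (induction I rule: infinite_finite_induct)
  case (insert i I)
  have "rderiv X (\<lambda>g. \<Sum>i\<in>insert i I. c i * F i g)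
      = rderiv X (\<lambda>g. c i * F i g + (\<Sum>i\<in>I. c i * F i g))"
    using insert by simp
  also have "\<dots> = (\<lambda>g. c i * rderiv X (F i) g + rderiv X (\<lambda>g. \<Sum>i\<in>I. c i * F i g) g)"
    using insert.prems
    by (subst rderiv_add) (auto intro!: smooth_fns_cmult smooth_fns_sum simp: rderiv_cmult)
  finally show ?case
    using insert by simp
qed (simp_all add: rderiv_def fun_eq_iff)

lemma rderiv_matrix_add:
  assumes "f \<in> smooth_fns"
  shows "rderiv (X + Y) f g = rderiv X f g + rderiv Y f g"
  using linear_add[OF linear_frechet_derivative[OF smooth_fns_differentiable[OF assms]]]
  by (simp add: rderiv_def matrix_add_ldistrib)

lemma rderiv_matrix_scaleR:
  assumes "f \<in> smooth_fns"
  shows "rderiv (c *\<^sub>R X) f g = of_real c * rderiv X f g"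
  using linear_scale[OF linear_frechet_derivative[OF smooth_fns_differentiable[OF assms]]]
  by (simp add: rderiv_def matrix_mul_scaleR_right scaleR_conv_of_real[where 'a = complex])

lemma rderiv_matrix_sum:
  assumes "f \<in> smooth_fns"
  shows "rderiv (\<Sum>i\<in>I. X i) f g = (\<Sum>i\<in>I. rderiv (X i) f g)"
  by (simp add: rderiv_def linear_sum[OF linear_matrix_mul_left]
      linear_sum[OF linear_frechet_derivative[OF smooth_fns_differentiable[OF assms]]])

text \<open>Product rule for a derivative along a varying direction; in
  \<open>iter_deriv [v, w x]\<close> the direction is frozen at its value in
  \<open>x\<close>.\<close>

lemma frechet_derivative_apply:
  fixes f :: "'a::euclidean_space \<Rightarrow> 'b::real_normed_vector"
  assumes S: "open S" "x \<in> S" and f: "smooth_on S f" and w: "w differentiable (at x)"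
  shows "frechet_derivative (\<lambda>y. frechet_derivative f (at y) (w y)) (at x) v
    = iter_deriv [v, w x] f x + frechet_derivative f (at x) (frechet_derivative w (at x) v)"
proof -
  note d = smooth_on_differentiable[OF f]
  note d2 = smooth_on_differentiable[OF smooth_on_deriv[OF f] S(2)]
  define D where "D w y = (\<Sum>b\<in>Basis. (w y \<bullet> b) *\<^sub>R frechet_derivative f (at y) b)" for w :: "'a \<Rightarrow> 'a" and y
  have D: "(D w has_derivative (\<lambda>v. \<Sum>b\<in>Basis. (w x \<bullet> b) *\<^sub>R iter_deriv [v, b] f x
      + (w' v \<bullet> b) *\<^sub>R frechet_derivative f (at x) b)) (at x)"
    if "(w has_derivative w') (at x)" for w w'
    unfolding D_def iter_deriv.simps
    by (rule has_derivative_sum, rule has_derivative_scaleR, rule has_derivative_inner_left, rule that,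
        rule d2[unfolded frechet_derivative_works])
  have *: "frechet_derivative (\<lambda>y. frechet_derivative f (at y) (w y)) (at x) v
      = (\<Sum>b\<in>Basis. (w x \<bullet> b) *\<^sub>R iter_deriv [v, b] f x + (w' v \<bullet> b) *\<^sub>R frechet_derivative f (at x) b)"
    if "(w has_derivative w') (at x)" for w w'
  proof -
    have "frechet_derivative (\<lambda>y. frechet_derivative f (at y) (w y)) (at x) = frechet_derivative (D w) (at x)"
      using frechet_derivative_basis[OF d]
      by (intro frechet_derivative_eq_on_open[OF S]) (simp add: D_def)
    then show ?thesis
      using fun_cong[OF frechet_derivative_at[OF D[OF that]], of v] by (simp only:)
  qed
  \<comment> \<open>The same formula for the constant direction \<open>w x\<close> identifies the
    second order part of the sum.\<close>
  from *[OF has_derivative_const[of "w x"]]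
  have "iter_deriv [v, w x] f x = (\<Sum>b\<in>Basis. (w x \<bullet> b) *\<^sub>R iter_deriv [v, b] f x)"
    by simp
  then show ?thesis
    using *[OF w[unfolded frechet_derivative_works]] frechet_derivative_basis[OF d[OF S(2)],
        of "frechet_derivative w (at x) v"]
    by (simp add: sum.distrib)
qed

lemma rderiv_rderiv:
  assumes f: "f \<in> smooth_fns" and g: "g \<in> GL"
  shows "rderiv X (rderiv Y f) g
    = iter_deriv [g ** X, g ** Y] f g + frechet_derivative f (at g) (g ** X ** Y)"
proof -
  have lin: "bounded_linear (\<lambda>g. g ** Y)"
    using linear_matrix_mul_right linear_conv_bounded_linear by blast
  have "frechet_derivative (\<lambda>g. g ** Y) (at g) = (\<lambda>g. g ** Y)"
    by (rule frechet_derivative_at[OF bounded_linear_imp_has_derivative[OF lin], symmetric])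
  moreover have "frechet_derivative (rderiv Y f) (at g)
      = frechet_derivative (\<lambda>x. frechet_derivative f (at x) (x ** Y)) (at g)"
    by (rule frechet_derivative_eq_on_open[OF open_GL g]) (simp add: rderiv_def)
  ultimately show ?thesis
    using frechet_derivative_apply[OF open_GL g smooth_fns_smooth[OF f]
        bounded_linear_imp_differentiable[OF lin], of "g ** X"] g
    by (simp add: rderiv_def[of X])
qed

text \<open>The second order terms cancel by symmetry of second derivatives; the first order terms
  leave the matrix commutator.\<close>

lemma rderiv_commutator:
  assumes f: "f \<in> smooth_fns"
  shows "rderiv X (rderiv Y f) g = rderiv Y (rderiv X f) g + rderiv (X ** Y - Y ** X) f g"
proof (cases "g \<in> GL")
  case True
  show ?thesis
    using rderiv_rderiv[OF f True, of X Y] rderiv_rderiv[OF f True, of Y X]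
      iter_deriv_commute[OF open_GL smooth_fns_smooth[OF f] True, of "g ** X" "g ** Y"]
      linear_diff[OF linear_frechet_derivative[OF smooth_fns_differentiable[OF f True]],
        of "g ** X ** Y" "g ** Y ** X"] True
    by (simp add: rderiv_def[of "X ** Y - Y ** X"] matrix_diff_ldistrib matrix_mul_assoc
        del: iter_deriv.simps)
qed (simp add: rderiv_def)

lemma funpow_rderiv_smooth_fns: "f \<in> smooth_fns \<Longrightarrow> (rderiv A ^^ a) f \<in> smooth_fns"
  by (induction a) (auto intro: rderiv_smooth_fns)

text \<open>The relation $X A^a = A^a X + a A^{a-1} Z + s \binom a2 A^{a-1}$ in the enveloping algebra when
  $[X,A] = Z$ and $[Z,A] = sA$, first for $s$-eigenvectors (where $Z$ is proportional to $A$).\<close>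

lemma rderiv_funpow_eigen:
  assumes f: "f \<in> smooth_fns" and Z: "Z ** A - A ** Z = s *\<^sub>R A"
  shows "rderiv Z ((rderiv A ^^ a) f)
    = (\<lambda>g. (rderiv A ^^ a) (rderiv Z f) g + of_real s * of_nat a * (rderiv A ^^ a) f g)"
proof (induction a)
  case (Suc a)
  have "rderiv Z ((rderiv A ^^ Suc a) f) g
      = rderiv A (rderiv Z ((rderiv A ^^ a) f)) g + of_real s * rderiv A ((rderiv A ^^ a) f) g" for g
    using rderiv_commutator[OF funpow_rderiv_smooth_fns[OF f], of Z A a A g]
    by (simp add: Z rderiv_matrix_scaleR funpow_rderiv_smooth_fns f)
  then show ?case
    unfolding Suc
    by (simp add: rderiv_add rderiv_cmult funpow_rderiv_smooth_fns rderiv_smooth_fns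
        smooth_fns_cmult f fun_eq_iff algebra_simps)
qed simp

lemma rderiv_funpow:
  assumes f: "f \<in> smooth_fns" and X: "X ** A - A ** X = Z" and Z: "Z ** A - A ** Z = s *\<^sub>R A"
  shows "rderiv X ((rderiv A ^^ a) f)
    = (\<lambda>g. (rderiv A ^^ a) (rderiv X f) g + of_nat a * (rderiv A ^^ (a - 1)) (rderiv Z f) g
        + of_real s * (of_nat a * (of_nat a - 1) / 2) * (rderiv A ^^ (a - 1)) f g)"
proof (induction a)
  case (Suc a)
  note smooth = rderiv_add rderiv_cmult funpow_rderiv_smooth_fns rderiv_smooth_fns
        smooth_fns_cmult smooth_fns_add f
  have "rderiv X ((rderiv A ^^ Suc a) f) g
      = rderiv A (rderiv X ((rderiv A ^^ a) f)) g + rderiv Z ((rderiv A ^^ a) f) g" for g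
    using rderiv_commutator[OF funpow_rderiv_smooth_fns[OF f], of X A a A g]
    by (simp add: X)
  moreover have "rderiv A (rderiv X ((rderiv A ^^ a) f)) = (\<lambda>g. (rderiv A ^^ Suc a) (rderiv X f) g
      + of_nat a * (rderiv A ^^ a) (rderiv Z f) g
      + of_real s * (of_nat a * (of_nat a - 1) / 2) * (rderiv A ^^ a) f g)"
  proof -
    have lin: "rderiv A (\<lambda>g. F g + c * G g + d * H g)
        = (\<lambda>g. rderiv A F g + c * rderiv A G g + d * rderiv A H g)"
      if "F \<in> smooth_fns" "G \<in> smooth_fns" "H \<in> smooth_fns" for F G H c d
      by (simp add: smooth that)
    show ?thesis
      unfolding Suc by (subst lin; cases a) (auto intro!: funpow_rderiv_smooth_fns rderiv_smooth_fns f)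
  qed
  ultimately show ?case
    by (simp add: rderiv_funpow_eigen[OF f Z] fun_eq_iff field_simps)
qed (simp)

lemma rderiv_left_translate:
  assumes f: "f \<in> smooth_fns" and h: "h \<in> GL"
  shows "rderiv X (\<lambda>g. f (h ** g)) = (\<lambda>g. rderiv X f (h ** g))"
proof
  fix g
  show "rderiv X (\<lambda>g. f (h ** g)) g = rderiv X f (h ** g)"
  proof (cases "g \<in> GL")
    case True
    have lin: "bounded_linear (\<lambda>g. h ** g)"
      using linear_matrix_mul_left linear_conv_bounded_linear by blast
    show ?thesis
      using frechet_derivative_comp[OF bounded_linear_imp_differentiable[OF lin]
          smooth_fns_differentiable[OF f GL_mult[OF h True]], of "g ** X"]
        frechet_derivative_at[OF bounded_linear_imp_has_derivative[OF lin], of g, symmetric]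
        True h by (simp add: rderiv_def GL_mult matrix_mul_assoc)
  next
    case False
    then show ?thesis using h by (simp add: rderiv_def GL_det det_mul)
  qed
qed

lemma smooth_fns_left_translate:
  assumes f: "f \<in> smooth_fns" and h: "h \<in> GL"
  shows "(\<lambda>g. f (h ** g)) \<in> smooth_fns"
proof -
  have "smooth_on GL (\<lambda>g. f (h ** g))"
    by (rule smooth_on_compose[OF open_GL smooth_fns_smooth[OF f]
          smooth_on_linear[OF open_GL linear_matrix_mul_left]])
      (use h GL_mult in auto)
  then show ?thesis
    using f h by (simp add: smooth_fns_def GL_det det_mul)
qed

lemma funpow_rderiv_left_translate:
  assumes "f \<in> smooth_fns" "h \<in> GL"
  shows "(rderiv X ^^ a) (\<lambda>g. f (h ** g)) = (\<lambda>g. (rderiv X ^^ a) f (h ** g))"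
  by (induction a) (simp_all add: rderiv_left_translate assms funpow_rderiv_smooth_fns)

text \<open>The line g(1 + sX) is tangent to g exp(sX) at s = 0, so it serves in place of the
  one-parameter group.\<close>

lemma rderiv_at:
  assumes f: "f \<in> smooth_fns" and g: "g \<in> GL"
  shows "((\<lambda>s. f (g ** (mat 1 + s *\<^sub>R X))) has_vector_derivative rderiv X f g) (at 0)"
proof -
  have "g ** (mat 1 + s *\<^sub>R X) = g + s *\<^sub>R (g ** X)" for s
    by (simp add: matrix_add_ldistrib matrix_mul_scaleR_right)
  then show ?thesis
    using smooth_on_line_derivative[OF smooth_fns_smooth[OF f], of g 0 "g ** X"] g
    by (simp add: rderiv_def)
qed

lemma nilpotent_in_GL:
  fixes X :: "real^'n^'n"
  assumes "X ** X = 0"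
  shows "mat 1 + s *\<^sub>R X \<in> GL"
proof -
  have "(mat 1 + s *\<^sub>R X) ** (mat 1 + (- s) *\<^sub>R X) = mat 1"
    by (simp only: matrix_add_ldistrib matrix_add_rdistrib' matrix_mul_scaleR_right
        matrix_mul_scaleR_left matrix_mul_lid matrix_mul_rid assms) simp
  then have "det (mat 1 + s *\<^sub>R X) * det (mat 1 + (- s) *\<^sub>R X) = 1"
    by (metis det_I det_mul)
  then show ?thesis by (auto simp: GL_det)
qed

text \<open>As X^2 = 0, the matrices 1 + sX form the one-parameter group of X, and (1 + sX) X = X
  turns the derivative of the curve at any s into the invariant field at the moved point. This
  integrates annihilation by a root vector to invariance under its unipotent group.\<close>

lemma rderiv_zero_invariant:
  assumes f: "f \<in> smooth_fns" and g: "g \<in> GL" and X: "X ** X = 0"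
    and z: "\<And>g. g \<in> GL \<Longrightarrow> rderiv X f g = 0"
  shows "f (g ** (mat 1 + s *\<^sub>R X)) = f g"
proof -
  have eq: "g ** (mat 1 + s *\<^sub>R X) = g + s *\<^sub>R (g ** X)" for s
    by (simp add: matrix_add_ldistrib matrix_mul_scaleR_right)
  have "((\<lambda>s. f (g ** (mat 1 + s *\<^sub>R X))) has_vector_derivative 0) (at s)" for s
  proof -
    have GL: "g ** (mat 1 + s *\<^sub>R X) \<in> GL"
      by (rule GL_mult[OF g nilpotent_in_GL[OF X]])
    have "(g + s *\<^sub>R (g ** X)) ** X = g ** X"
      by (simp add: matrix_add_rdistrib' matrix_mul_scaleR_left matrix_mul_assoc[symmetric] X
          matrix_mul_zero_right)
    then show ?thesis
      using smooth_on_line_derivative[OF smooth_fns_smooth[OF f] GL[unfolded eq]] z[OF GL] GL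
      by (simp add: eq rderiv_def)
  qed
  then obtain c where c: "\<And>s. s \<in> UNIV \<Longrightarrow> f (g ** (mat 1 + s *\<^sub>R X)) = c"
    using has_vector_derivative_zero_constant[OF convex_UNIV, of "\<lambda>s. f (g ** (mat 1 + s *\<^sub>R X))"]
    by auto
  show ?thesis using c[of s] c[of 0] by simp
qed

text \<open>The assumption on \<open>X\<close> says that Ad(h) multiplies X by s. It is applied to
  diagonal \<open>h\<close>, for which the matrix units are eigenvectors.\<close>

lemma rderiv_right_equivariant:
  assumes f: "f \<in> smooth_fns" and h: "h \<in> GL" and X: "h ** X = s *\<^sub>R (X ** h)"
    and c: "\<And>g. g \<in> GL \<Longrightarrow> f (g ** h) = c * f g" and g: "g \<in> GL"
  shows "rderiv X f (g ** h) = of_real s * c * rderiv X f g"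
proof -
  have lin: "bounded_linear (\<lambda>g. g ** h)"
    using linear_matrix_mul_right linear_conv_bounded_linear by blast
  note D = linear_frechet_derivative[OF smooth_fns_differentiable[OF f GL_mult[OF g h]]]
  have "frechet_derivative f (at (g ** h)) (g ** X ** h)
      = frechet_derivative (\<lambda>g. f (g ** h)) (at g) (g ** X)"
    using frechet_derivative_comp[OF bounded_linear_imp_differentiable[OF lin]
        smooth_fns_differentiable[OF f GL_mult[OF g h]], of "g ** X"]
      frechet_derivative_at[OF bounded_linear_imp_has_derivative[OF lin], of g, symmetric] by simp
  also have "\<dots> = frechet_derivative (\<lambda>g. c * f g) (at g) (g ** X)"
    using frechet_derivative_eq_on_open[OF open_GL g c] by simp
  also have "\<dots> = c * frechet_derivative f (at g) (g ** X)"
    by (rule frechet_derivative_bounded_linear[OF bounded_linear_mult_right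
          smooth_fns_differentiable[OF f g]])
  finally have "frechet_derivative f (at (g ** h)) (g ** X ** h)
      = c * frechet_derivative f (at g) (g ** X)" .
  moreover have "(g ** h) ** X = s *\<^sub>R (g ** X ** h)"
    using X by (simp add: matrix_mul_assoc[symmetric] matrix_mul_scaleR_right)
  ultimately show ?thesis
    using g h linear_scale[OF D, of s "g ** X ** h"]
    by (simp add: rderiv_def GL_mult scaleR_conv_of_real)
qed

lemma three_distinct: "(1::3) \<noteq> 2" "(1::3) \<noteq> 3" "(2::3) \<noteq> 3" "(2::3) \<noteq> 1" "(3::3) \<noteq> 1" "(3::3) \<noteq> 2"
  by simp_all

section \<open>Principal series\<close>

definition elem :: "'n \<Rightarrow> 'n \<Rightarrow> real^'n^'n" where
  "elem i j = (\<chi> k l. if k = i \<and> l = j then 1 else 0)"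

lemma elem_mult: "elem i j ** elem k l = (if j = k then elem i l else 0)"
proof -
  have "(\<Sum>m\<in>UNIV. (if a = i \<and> m = j then 1 else 0) * (if m = k \<and> b = l then 1 else 0))
      = (\<Sum>m\<in>UNIV. if m = j then if a = i \<and> j = k \<and> b = l then 1 else 0 else (0::real))" for a b
    by (intro sum.cong) auto
  then show ?thesis
    by (simp add: vec_eq_iff matrix_matrix_mult_def elem_def)
qed

lemma elem_expansion: "X = (\<Sum>i\<in>UNIV. \<Sum>j\<in>UNIV. X $ i $ j *\<^sub>R elem i j)"
proof -
  have "elem i j = axis i (axis j 1)" for i j :: 'a
    by (simp add: vec_eq_iff elem_def axis_def)
  then show ?thesis using matrix_entry_expansion[of X] by simp
qed

text \<open>The character through which the diagonal subgroup \<open>MA\<close> acts.\<close>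

definition diag_char :: "bit^'n \<Rightarrow> complex^'n \<Rightarrow> real^'n \<Rightarrow> complex" where
  "diag_char \<xi> lam t = sign_char \<xi> (\<chi> j. sgn (t $ j)) * power_char lam (\<chi> j. \<bar>t $ j\<bar>)"

lemma diag_mat_mult: "diag_mat s ** diag_mat t = diag_mat (\<chi> j. s $ j * t $ j)"
proof -
  have "(\<Sum>k\<in>UNIV. (if i = k then s $ i else 0) * (if k = j then t $ k else 0))
     = (\<Sum>k\<in>UNIV. if k = i then (if i = j then s $ i * t $ i else 0) else 0)" for i j
    by (intro sum.cong) auto
  then show ?thesis
    by (simp add: vec_eq_iff matrix_matrix_mult_def diag_mat_def)
qed

lemma diag_mat_one: "diag_mat (\<chi> j. 1) = mat 1"
  by (simp add: diag_mat_def mat_def cong: if_cong)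

lemma diag_mat_in_GL: "(\<And>j. t $ j \<noteq> 0) \<Longrightarrow> diag_mat t \<in> GL"
  unfolding GL_det using det_diagonal[of "diag_mat t"] by (simp add: diag_mat_def)

lemma diag_mat_elem:
  "t $ j \<noteq> 0 \<Longrightarrow> diag_mat t ** elem i j = (t $ i / t $ j) *\<^sub>R (elem i j ** diag_mat t)"
proof -
  assume t: "t $ j \<noteq> 0"
  have "(\<Sum>m\<in>UNIV. (if a = m then t $ a else 0) * (if m = i \<and> b = j then 1 else 0))
      = (\<Sum>m\<in>UNIV. if m = a then (if a = i \<and> b = j then t $ i else 0) else 0)" for a b
    by (intro sum.cong) auto
  moreover have "(\<Sum>m\<in>UNIV. (if a = i \<and> m = j then 1 else 0) * (if m = b then t $ m else 0))
      = (\<Sum>m\<in>UNIV. if m = j then (if a = i \<and> b = j then t $ j else 0) else 0)" for a b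
    by (intro sum.cong) auto
  ultimately show ?thesis
    using t by (simp add: vec_eq_iff matrix_matrix_mult_def elem_def diag_mat_def)
qed

lemma principal_series_smooth_fns: "f \<in> principal_series N \<xi> lam \<Longrightarrow> f \<in> smooth_fns"
  by (auto simp: principal_series_def smooth_fns_def)

lemma sign_char_one: "sign_char \<xi> (\<chi> j. 1) = 1"
  by (simp add: sign_char_def cong: if_cong)

lemma power_char_one: "power_char lam (\<chi> j. 1) = 1"
  by (simp add: power_char_def)

text \<open>The products ma are exactly the diagonal matrices with nonzero entries, m being the
  signs and a the absolute values; a single \<open>t\<close> replaces the pair.\<close>

lemma principal_series_iff:
  assumes N: "mat 1 \<in> N"
  shows "f \<in> principal_series N \<xi> lam \<longleftrightarrow> f \<in> smooth_fns \<and>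
    (\<forall>g\<in>GL. \<forall>n\<in>N. f (g ** n) = f g) \<and>
    (\<forall>g\<in>GL. \<forall>t. (\<forall>j. t $ j \<noteq> 0) \<longrightarrow> f (g ** diag_mat t) = diag_char \<xi> lam t * f g)"
    (is "?L \<longleftrightarrow> ?R")
proof
  assume f: ?L
  have eq: "f (g ** diag_mat m ** diag_mat a ** n) = sign_char \<xi> m * power_char lam a * f g"
    if "g \<in> GL" "n \<in> N" "\<And>j. m $ j = 1 \<or> m $ j = - 1" "\<And>j. 0 < a $ j" for g m a n
    using f that by (simp add: principal_series_def)
  have "f (g ** n) = f g" if "g \<in> GL" "n \<in> N" for g n
    using eq[OF that, of "\<chi> j. 1" "\<chi> j. 1"]
    by (simp add: diag_mat_one sign_char_one power_char_one)
  moreover have "f (g ** diag_mat t) = diag_char \<xi> lam t * f g"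
    if "g \<in> GL" "\<forall>j. t $ j \<noteq> 0" for g t
  proof -
    have "diag_mat (\<chi> j. sgn (t $ j)) ** diag_mat (\<chi> j. \<bar>t $ j\<bar>) = diag_mat t"
      by (simp add: diag_mat_mult sgn_mult_abs)
    then show ?thesis
      using eq[OF that(1) N, of "\<chi> j. sgn (t $ j)" "\<chi> j. \<bar>t $ j\<bar>"] that(2)
      by (simp add: diag_char_def matrix_mul_assoc[symmetric] sgn_if)
  qed
  ultimately show ?R
    using principal_series_smooth_fns[OF f] by blast
next
  assume f: ?R
  have "f (g ** diag_mat m ** diag_mat a ** n) = sign_char \<xi> m * power_char lam a * f g"
    if g: "g \<in> GL" "n \<in> N" and m: "\<And>j. m $ j = 1 \<or> m $ j = - 1" and a: "\<And>j. 0 < a $ j" for g m a n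
  proof -
    define t where "t = (\<chi> j. m $ j * a $ j)"
    have "m $ j \<noteq> 0" "sgn (m $ j) = m $ j" "\<bar>m $ j\<bar> = 1" for j using m[of j] by auto
    then have t: "\<And>j. t $ j \<noteq> 0" "(\<chi> j. sgn (t $ j)) = m" "(\<chi> j. \<bar>t $ j\<bar>) = a"
      using a by (simp_all add: t_def vec_eq_iff sgn_mult abs_mult less_imp_neq[symmetric] less_imp_le)
    have "g ** diag_mat t \<in> GL"
      by (rule GL_mult[OF g(1) diag_mat_in_GL[OF t(1)]])
    then show ?thesis
      using f g t by (simp add: matrix_mul_assoc[symmetric] diag_mat_mult t_def[symmetric])
        (simp add: matrix_mul_assoc diag_char_def)
  qed
  then show ?L
    using f by (simp add: principal_series_def smooth_fns_def)
qed

lemma principal_series_left_translate: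
  assumes N: "mat 1 \<in> N" and f: "f \<in> principal_series N \<xi> lam" and h: "h \<in> GL"
  shows "(\<lambda>g. f (h ** g)) \<in> principal_series N \<xi> lam"
  using f smooth_fns_left_translate[OF _ h] GL_mult[OF h]
  by (simp add: principal_series_iff[OF N] matrix_mul_assoc)

lemma principal_series_unipotent:
  assumes N: "mat 1 \<in> N" and f: "f \<in> principal_series N \<xi> lam"
    and X: "\<And>s. mat 1 + s *\<^sub>R X \<in> N"
  shows "rderiv X f = (\<lambda>g. 0)"
proof
  fix g
  show "rderiv X f g = 0"
  proof (cases "g \<in> GL")
    case True
    have "(\<lambda>s. f (g ** (mat 1 + s *\<^sub>R X))) = (\<lambda>s. f g)"
      using f X True by (simp add: principal_series_iff[OF N])
    then have "((\<lambda>s::real. f g) has_vector_derivative rderiv X f g) (at 0)"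
      using rderiv_at[OF principal_series_smooth_fns[OF f] True, of X] by simp
    then show ?thesis
      by (rule vector_derivative_unique_at[OF _ has_vector_derivative_const])
  qed (simp add: rderiv_def)
qed

lemma has_vector_derivative_one_plus_powr:
  "((\<lambda>s. of_real (1 + s) powr w :: complex) has_vector_derivative w) (at 0)"
proof -
  have "((\<lambda>z::complex. (1 + z) powr w) has_field_derivative w * (1 + of_real 0) powr (w - 1) * 1) (at (of_real 0))"
    by (rule DERIV_chain2[where g = "\<lambda>z. 1 + z" and f = "\<lambda>z. z powr w"])
      (auto intro!: derivative_eq_intros has_field_derivative_powr)
  from has_vector_derivative_real_field[OF this] show ?thesis by simp
qed

lemma principal_series_diagonal:
  assumes N: "mat 1 \<in> N" and f: "f \<in> principal_series N \<xi> lam"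
  shows "rderiv (elem j j) f = (\<lambda>g. - lam $ j * f g)"
proof
  fix g
  show "rderiv (elem j j) f g = - lam $ j * f g"
  proof (cases "g \<in> GL")
    case True
    \<comment> \<open>For s > -1 the entry 1 + s is positive, so the sign character stays trivial
      and only the power remains.\<close>
    have "f (g ** (mat 1 + s *\<^sub>R elem j j)) = of_real (1 + s) powr (- lam $ j) * f g"
      if s: "s \<in> {-1<..}" for s
    proof -
      define t :: "real^'a" where "t = (\<chi> k. if k = j then 1 + s else 1)"
      have t: "\<forall>k. t $ k \<noteq> 0" "(\<chi> k. sgn (t $ k)) = (\<chi> k. 1)" "(\<chi> k. \<bar>t $ k\<bar>) = t"
        using s by (auto simp: t_def vec_eq_iff)
      have "mat 1 + s *\<^sub>R elem j j = diag_mat t"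
        by (auto simp: vec_eq_iff mat_def elem_def diag_mat_def t_def)
      moreover have "power_char lam t = (\<Prod>k\<in>UNIV. if k = j then of_real (1 + s) powr (- lam $ j) else 1)"
        unfolding power_char_def by (intro prod.cong) (auto simp: t_def)
      ultimately show ?thesis
        using f True t by (simp add: principal_series_iff[OF N] diag_char_def sign_char_one)
    qed
    note eq = this
    have "((\<lambda>s. of_real (1 + s) powr (- lam $ j) * f g) has_vector_derivative - lam $ j * f g) (at 0)"
      by (rule has_vector_derivative_mult_left[OF has_vector_derivative_one_plus_powr])
    then have "((\<lambda>s. f (g ** (mat 1 + s *\<^sub>R elem j j))) has_vector_derivative - lam $ j * f g) (at 0)"
      by (rule has_vector_derivative_transform_within_open[where S = "{-1<..}"]) (simp_all add: eq)
    then show ?thesis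
      by (rule vector_derivative_unique_at[OF rderiv_at[OF principal_series_smooth_fns[OF f] True]])
  next
    case False
    then show ?thesis
      using smooth_fns_off_GL[OF principal_series_smooth_fns[OF f]] by (simp add: rderiv_def)
  qed
qed

lemma one_in_unipotent: "mat 1 \<in> unipotent3" "mat 1 \<in> unipotent2"
  by (simp_all add: unipotent3_def unipotent2_def mat_def)

section \<open>Highest weight vectors\<close>

text \<open>The infinitesimal part of membership in I(\<xi>,\<lambda>), on which all relations of
  the Verma module rest. E13 is covered as the commutator of the two simple root vectors.\<close>

definition highest_weight :: "complex^3 \<Rightarrow> (real^3^3 \<Rightarrow> complex) set" where
  "highest_weight lam = {f \<in> smooth_fns. (\<forall>j. rderiv (elem j j) f = (\<lambda>g. - lam $ j * f g)) \<and>
    rderiv (elem 1 2) f = (\<lambda>g. 0) \<and> rderiv (elem 2 3) f = (\<lambda>g. 0)}"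

lemma highest_weight_smooth_fns: "f \<in> highest_weight lam \<Longrightarrow> f \<in> smooth_fns"
  by (simp add: highest_weight_def)

lemma I_series_highest_weight:
  assumes "f \<in> I_series \<xi> lam"
  shows "f \<in> highest_weight lam"
proof -
  note f = assms[unfolded I_series_def]
  have "mat 1 + s *\<^sub>R elem 1 2 \<in> unipotent3" "mat 1 + s *\<^sub>R elem 2 3 \<in> unipotent3" for s
    by (simp_all add: unipotent3_def mat_def elem_def)
  then show ?thesis
    using principal_series_smooth_fns[OF f] principal_series_diagonal[OF one_in_unipotent(1) f]
      principal_series_unipotent[OF one_in_unipotent(1) f] by (simp add: highest_weight_def)
qed

text \<open>Poincare-Birkhoff-Witt monomials E21^a E31^b E32^c of the strictly lower triangular
  matrices; the factor E32 acts on \<open>f\<close> first.\<close>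

fun mon :: "nat \<times> nat \<times> nat \<Rightarrow> (real^3^3 \<Rightarrow> complex) \<Rightarrow> real^3^3 \<Rightarrow> complex" where
  "mon (a, b, c) f
    = (rderiv (elem 2 1) ^^ a) ((rderiv (elem 3 1) ^^ b) ((rderiv (elem 3 2) ^^ c) f))"

lemma mon_smooth_fns: "f \<in> smooth_fns \<Longrightarrow> mon x f \<in> smooth_fns"
  by (cases x) (auto intro: funpow_rderiv_smooth_fns)

lemma funpow_rderiv_cmult:
  "f \<in> smooth_fns \<Longrightarrow> (rderiv A ^^ a) (\<lambda>g. w * f g) = (\<lambda>g. w * (rderiv A ^^ a) f g)"
  by (induction a) (simp_all add: rderiv_cmult funpow_rderiv_smooth_fns)

lemma rderiv_weight:
  assumes f: "f \<in> smooth_fns" and Z: "Z ** A - A ** Z = s *\<^sub>R A" and w: "rderiv Z f = (\<lambda>g. w * f g)"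
  shows "rderiv Z ((rderiv A ^^ a) f) = (\<lambda>g. (w + of_real s * of_nat a) * (rderiv A ^^ a) f g)"
  using rderiv_funpow_eigen[OF f Z, of a] by (simp add: w funpow_rderiv_cmult[OF f] algebra_simps)

lemma rderiv_commuting:
  assumes f: "f \<in> smooth_fns" and Z: "Z ** A = A ** Z"
  shows "rderiv Z ((rderiv A ^^ a) f) = (rderiv A ^^ a) (rderiv Z f)"
  using rderiv_funpow_eigen[OF f, of Z A 0 a] Z by simp

lemma rderiv_matrix_diff:
  "f \<in> smooth_fns \<Longrightarrow> rderiv (X - Y) f g = rderiv X f g - rderiv Y f g"
  using rderiv_matrix_add[of f X "- Y" g] rderiv_matrix_scaleR[of f "-1" Y g] by simp

lemmas elem_simps = elem_mult three_distinct

context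
  fixes lam :: "complex^3" and f
  assumes hw: "f \<in> highest_weight lam"
begin

lemma hw_smooth: "f \<in> smooth_fns" "(rderiv (elem 3 2) ^^ c) f \<in> smooth_fns"
  "(rderiv (elem 3 1) ^^ b) ((rderiv (elem 3 2) ^^ c) f) \<in> smooth_fns"
  using hw by (auto intro!: funpow_rderiv_smooth_fns simp: highest_weight_def)

lemma rderiv_21_mon: "rderiv (elem 2 1) (mon (a, b, c) f) = mon (a + 1, b, c) f"
  by simp

lemma rderiv_31_mon: "rderiv (elem 3 1) (mon (a, b, c) f) = mon (a, b + 1, c) f"
  using rderiv_commuting[OF hw_smooth(3), where Z = "elem 3 1" and A = "elem 2 1" and a = a] by (simp add: elem_simps)

text \<open>From [E32, E21] = E31, which commutes with both. For \<open>a = 0\<close> the truncated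
  exponent \<open>a - 1\<close> is harmless because its coefficient is 0; the formulas below use the
  same convention.\<close>

lemma rderiv_32_mon: "rderiv (elem 3 2) (mon (a, b, c) f)
    = (\<lambda>g. mon (a, b, c + 1) f g + of_nat a * mon (a - 1, b + 1, c) f g)"
  using rderiv_funpow[OF hw_smooth(3), where X = "elem 3 2" and A = "elem 2 1" and Z = "elem 3 1" and s = 0 and a = a]
    rderiv_commuting[OF hw_smooth(2), where Z = "elem 3 2" and A = "elem 3 1" and a = b]
  by (simp add: elem_simps)

text \<open>\<open>\<delta> i k\<close> is the eigenvalue of ad(E_jj) on E_ik; each lowering factor
  adds its eigenvalue to the weight of \<open>f\<close>.\<close>

lemma rderiv_diag_mon_aux:
  fixes j :: 3
  defines "\<delta> i k \<equiv> (if j = i then 1 else 0) - (if j = k then 1 else (0::real))"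
  shows "rderiv (elem j j) ((rderiv (elem 3 1) ^^ b) ((rderiv (elem 3 2) ^^ c) f))
      = (\<lambda>g. (- lam $ j + of_real (\<delta> 3 2) * of_nat c + of_real (\<delta> 3 1) * of_nat b) *
        (rderiv (elem 3 1) ^^ b) ((rderiv (elem 3 2) ^^ c) f) g)"
    and "rderiv (elem j j) (mon (a, b, c) f)
      = (\<lambda>g. (- lam $ j + of_real (\<delta> 3 2) * of_nat c + of_real (\<delta> 3 1) * of_nat b
        + of_real (\<delta> 2 1) * of_nat a) * mon (a, b, c) f g)"
proof -
  have \<delta>: "elem j j ** elem i k - elem i k ** elem j j = \<delta> i k *\<^sub>R elem i k" for i k
    by (auto simp: elem_mult \<delta>_def)
  have "rderiv (elem j j) f = (\<lambda>g. - lam $ j * f g)"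
    using hw by (simp add: highest_weight_def)
  note * = rderiv_weight[OF hw_smooth(1) \<delta> this]
  show 2: "rderiv (elem j j) ((rderiv (elem 3 1) ^^ b) ((rderiv (elem 3 2) ^^ c) f))
      = (\<lambda>g. (- lam $ j + of_real (\<delta> 3 2) * of_nat c + of_real (\<delta> 3 1) * of_nat b) *
        (rderiv (elem 3 1) ^^ b) ((rderiv (elem 3 2) ^^ c) f) g)" for b c
    by (rule rderiv_weight[OF hw_smooth(2) \<delta> *])
  show "rderiv (elem j j) (mon (a, b, c) f)
      = (\<lambda>g. (- lam $ j + of_real (\<delta> 3 2) * of_nat c + of_real (\<delta> 3 1) * of_nat b
        + of_real (\<delta> 2 1) * of_nat a) * mon (a, b, c) f g)"
    unfolding mon.simps by (rule rderiv_weight[OF hw_smooth(3) \<delta> 2])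
qed

lemma rderiv_diag_mon:
  "rderiv (elem 1 1) (mon (a, b, c) f) = (\<lambda>g. (- lam $ 1 - of_nat a - of_nat b) * mon (a, b, c) f g)"
  "rderiv (elem 2 2) (mon (a, b, c) f) = (\<lambda>g. (- lam $ 2 + of_nat a - of_nat c) * mon (a, b, c) f g)"
  "rderiv (elem 3 3) (mon (a, b, c) f) = (\<lambda>g. (- lam $ 3 + of_nat b + of_nat c) * mon (a, b, c) f g)"
  by (simp_all add: rderiv_diag_mon_aux three_distinct fun_eq_iff algebra_simps del: mon.simps)

text \<open>The relations [E12, E21] = H with H = E11 - E22 and [H, E21] = -2 E21 produce the
  quadratic coefficient familiar from sl2. The last term comes from [E12, E31] = -E32, while E12
  commutes with E32 and kills \<open>f\<close>.\<close>

lemma rderiv_12_mon: "rderiv (elem 1 2) (mon (a, b, c) f)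
    = (\<lambda>g. of_nat a * (lam $ 2 - lam $ 1 - of_nat b + of_nat c - of_nat a + 1) * mon (a - 1, b, c) f g
        - of_nat b * mon (a, b - 1, c + 1) f g)"
proof -
  let ?F = "(rderiv (elem 3 2) ^^ c) f" and ?G = "(rderiv (elem 3 1) ^^ b) ((rderiv (elem 3 2) ^^ c) f)"
  have "rderiv (elem 1 2) ?F = (\<lambda>g. 0)"
    using rderiv_weight[OF hw_smooth(1), of "elem 1 2" "elem 3 2" 0 0 c] hw
    by (simp add: highest_weight_def elem_simps)
  moreover have "rderiv (- elem 3 2) ?F = (\<lambda>g. - 1 * rderiv (elem 3 2) ?F g)"
    using rderiv_matrix_scaleR[OF hw_smooth(2), where c = "-1" and X = "elem 3 2"] by auto
  moreover have "(rderiv (elem 3 1 :: real^3^3) ^^ b) (\<lambda>g. 0) = (\<lambda>g. 0)"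
    using funpow_rderiv_cmult[OF hw_smooth(1), of b "elem 3 1" 0] by simp
  moreover have "(rderiv (elem 3 1) ^^ (b - 1)) (\<lambda>g. - 1 * rderiv (elem 3 2) ?F g)
      = (\<lambda>g. - 1 * (rderiv (elem 3 1) ^^ (b - 1)) (rderiv (elem 3 2) ?F) g)"
    by (intro funpow_rderiv_cmult rderiv_smooth_fns hw_smooth)
  ultimately have G: "rderiv (elem 1 2) ?G
      = (\<lambda>g. - of_nat b * (rderiv (elem 3 1) ^^ (b - 1)) ((rderiv (elem 3 2) ^^ (c + 1)) f) g)"
    using rderiv_funpow[OF hw_smooth(2), where X = "elem 1 2" and A = "elem 3 1" and Z = "- elem 3 2" and s = 0 and a = b]
    by (simp add: elem_simps matrix_mul_scaleR_left[of "-1", simplified] matrix_mul_scaleR_right[of _ "-1", simplified])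
  have Z: "rderiv (elem 1 1 - elem 2 2) ?G = (\<lambda>g. (lam $ 2 - lam $ 1 - of_nat b + of_nat c) * ?G g)"
    by (rule ext, simp only: rderiv_matrix_diff[OF hw_smooth(3)] rderiv_diag_mon_aux(1))
      (simp add: three_distinct algebra_simps)
  have "(elem 1 1 - elem 2 2) ** elem 2 1 - elem 2 1 ** (elem 1 1 - elem 2 2) = (-2) *\<^sub>R (elem 2 1 :: real^3^3)"
    by (simp add: matrix_diff_ldistrib matrix_sub_rdistrib' elem_simps scaleR_2)
  then have "rderiv (elem 1 2) (mon (a, b, c) f)
    = (\<lambda>g. (rderiv (elem 2 1) ^^ a) (rderiv (elem 1 2) ?G) g
        + of_nat a * (rderiv (elem 2 1) ^^ (a - 1)) (rderiv (elem 1 1 - elem 2 2) ?G) g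
        + of_real (- 2) * (of_nat a * (of_nat a - 1) / 2) * (rderiv (elem 2 1) ^^ (a - 1)) ?G g)"
    unfolding mon.simps by (intro rderiv_funpow hw_smooth) (simp_all add: elem_simps)
  moreover have "(rderiv (elem 2 1) ^^ (a - 1)) (\<lambda>g. (lam $ 2 - lam $ 1 - of_nat b + of_nat c) * ?G g)
      = (\<lambda>g. (lam $ 2 - lam $ 1 - of_nat b + of_nat c) * (rderiv (elem 2 1) ^^ (a - 1)) ?G g)"
    by (rule funpow_rderiv_cmult[OF hw_smooth(3)])
  moreover have "(rderiv (elem 2 1) ^^ a)
        (\<lambda>g. - of_nat b * (rderiv (elem 3 1) ^^ (b - 1)) ((rderiv (elem 3 2) ^^ (c + 1)) f) g)
      = (\<lambda>g. - of_nat b * (rderiv (elem 2 1) ^^ a)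
        ((rderiv (elem 3 1) ^^ (b - 1)) ((rderiv (elem 3 2) ^^ (c + 1)) f)) g)"
    by (rule funpow_rderiv_cmult[OF hw_smooth(3)])
  ultimately show ?thesis
    unfolding G Z mon.simps by (simp only: fun_eq_iff) (simp add: field_simps)
qed

text \<open>E23 commutes with E21. The first term comes from [E23, E31] = E21, which commutes with
  E31; the second is the sl2 relation for E32 and E22 - E33.\<close>

lemma rderiv_23_mon: "rderiv (elem 2 3) (mon (a, b, c) f)
    = (\<lambda>g. of_nat b * mon (a + 1, b - 1, c) f g
        + of_nat c * (lam $ 3 - lam $ 2 - of_nat c + 1) * mon (a, b, c - 1) f g)"
proof -
  let ?F = "(rderiv (elem 3 2) ^^ c) f" and ?G = "(rderiv (elem 3 1) ^^ b) ((rderiv (elem 3 2) ^^ c) f)"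
  have Z: "rderiv (elem 2 2 - elem 3 3) f = (\<lambda>g. (lam $ 3 - lam $ 2) * f g)"
    using hw by (auto simp: rderiv_matrix_diff highest_weight_def fun_eq_iff algebra_simps)
  have E: "rderiv (elem 2 3) f = (\<lambda>g. 0)"
    using hw by (simp add: highest_weight_def)
  have zero: "(rderiv (elem 3 2 :: real^3^3) ^^ c) (\<lambda>g. 0) = (\<lambda>g. 0)"
    using funpow_rderiv_cmult[OF hw_smooth(1), of c "elem 3 2" 0] by simp
  have "(elem 2 2 - elem 3 3) ** elem 3 2 - elem 3 2 ** (elem 2 2 - elem 3 3) = (-2) *\<^sub>R (elem 3 2 :: real^3^3)"
    by (simp add: matrix_diff_ldistrib matrix_sub_rdistrib' elem_simps scaleR_2)
  then have "rderiv (elem 2 3) ?F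
    = (\<lambda>g. (rderiv (elem 3 2) ^^ c) (rderiv (elem 2 3) f) g
        + of_nat c * (rderiv (elem 3 2) ^^ (c - 1)) (rderiv (elem 2 2 - elem 3 3) f) g
        + of_real (- 2) * (of_nat c * (of_nat c - 1) / 2) * (rderiv (elem 3 2) ^^ (c - 1)) f g)"
    by (intro rderiv_funpow hw_smooth) (simp_all add: elem_simps)
  also have "\<dots> = (\<lambda>g. of_nat c * (lam $ 3 - lam $ 2 - of_nat c + 1) * (rderiv (elem 3 2) ^^ (c - 1)) f g)"
    unfolding Z E funpow_rderiv_cmult[OF hw_smooth(1)] zero by (simp add: fun_eq_iff field_simps)
  finally have F: "rderiv (elem 2 3) ?F
    = (\<lambda>g. of_nat c * (lam $ 3 - lam $ 2 - of_nat c + 1) * (rderiv (elem 3 2) ^^ (c - 1)) f g)" .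
  have "rderiv (elem 2 3) ?G = (\<lambda>g. (rderiv (elem 3 1) ^^ b) (rderiv (elem 2 3) ?F) g
      + of_nat b * (rderiv (elem 3 1) ^^ (b - 1)) (rderiv (elem 2 1) ?F) g)"
    using rderiv_funpow[OF hw_smooth(2), where X = "elem 2 3" and A = "elem 3 1" and Z = "elem 2 1" and s = 0 and a = b]
    by (simp add: elem_simps)
  also have "(rderiv (elem 3 1) ^^ (b - 1)) (rderiv (elem 2 1) ?F)
      = rderiv (elem 2 1) ((rderiv (elem 3 1) ^^ (b - 1)) ?F)"
    by (rule rderiv_commuting[OF hw_smooth(2), symmetric]) (simp add: elem_simps)
  finally have G: "rderiv (elem 2 3) ?G
      = (\<lambda>g. of_nat c * (lam $ 3 - lam $ 2 - of_nat c + 1) *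
          (rderiv (elem 3 1) ^^ b) ((rderiv (elem 3 2) ^^ (c - 1)) f) g
        + of_nat b * rderiv (elem 2 1) ((rderiv (elem 3 1) ^^ (b - 1)) ?F) g)"
    unfolding F by (simp add: funpow_rderiv_cmult hw_smooth)
  have lin: "(rderiv A ^^ a) (\<lambda>g. p * F g + q * H g) = (\<lambda>g. p * (rderiv A ^^ a) F g + q * (rderiv A ^^ a) H g)"
    if "F \<in> smooth_fns" "H \<in> smooth_fns" for A a p q and F H :: "real^3^3 \<Rightarrow> complex"
    by (induction a) (simp_all add: rderiv_add rderiv_cmult smooth_fns_cmult that funpow_rderiv_smooth_fns)
  have "rderiv (elem 2 3) (mon (a, b, c) f) = (rderiv (elem 2 1) ^^ a) (rderiv (elem 2 3) ?G)"
    unfolding mon.simps by (intro rderiv_commuting hw_smooth) (simp add: elem_simps)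
  then show ?thesis
    unfolding G by (subst (asm) lin)
      (auto intro!: hw_smooth rderiv_smooth_fns simp: funpow_swap1 algebra_simps)
qed

end

section \<open>Differential operators and normal ordering\<close>

text \<open>The module generated by the operators \<open>D i\<close> over the smooth functions, used
  with \<open>iter_deriv\<close> for coordinate derivatives and with \<open>mon\<close> for normal
  ordered invariant fields. Sums as a constructor keep index sets out of the inductions;
  \<open>comb_sum_form\<close> recovers a finite sum.\<close>

inductive comb ::
  "'a::real_normed_vector set \<Rightarrow> ('i \<Rightarrow> 'f \<Rightarrow> 'a \<Rightarrow> complex) \<Rightarrow> ('f \<Rightarrow> 'a \<Rightarrow> complex) \<Rightarrow> bool"
  for S D where
  base: "smooth_on S c \<Longrightarrow> comb S D (\<lambda>f g. c g * D i f g)"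
| add: "comb S D P \<Longrightarrow> comb S D Q \<Longrightarrow> comb S D (\<lambda>f g. P f g + Q f g)"

lemma comb_const: "open S \<Longrightarrow> comb S D (\<lambda>f g. c * D i f g)"
  by (rule comb.base[OF smooth_on_const])

lemma comb_generator: "open S \<Longrightarrow> comb S D (D i)"
  using comb_const[of S D 1 i] by simp

lemma comb_zero: "open S \<Longrightarrow> comb S D (\<lambda>f g. 0)"
  using comb_const[of S D 0] by simp

lemma comb_sum:
  "open S \<Longrightarrow> (\<And>k. k \<in> K \<Longrightarrow> comb S D (P k)) \<Longrightarrow> comb S D (\<lambda>f g. \<Sum>k\<in>K. P k f g)"
  by (induction K rule: infinite_finite_induct) (auto intro: comb_zero comb.add)

lemma comb_smooth_mult:
  assumes "open S" "comb S D P" "smooth_on S k"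
  shows "comb S D (\<lambda>f g. k g * P f g)"
  using assms(2)
proof induction
  case (base c i)
  then show ?case
    using comb.base[OF smooth_on_mult[OF assms(1,3) base], of D i] by (simp add: mult.assoc)
next
  case (add P Q)
  then show ?case
    using comb.add by (simp add: distrib_left)
qed

lemma comb_smooth_on:
  assumes "open S" "comb S D P" "\<And>i. smooth_on S (D i f)"
  shows "smooth_on S (P f)"
  using assms(2)
  by induction (auto intro!: smooth_on_mult smooth_on_add assms)

lemma comb_sum_form:
  assumes "open S" "comb S D P"
  shows "\<exists>F c. finite F \<and> (\<forall>i. smooth_on S (c i)) \<and> (\<forall>f g. P f g = (\<Sum>i\<in>F. c i g * D i f g))"
proof -
  \<comment> \<open>Strengthened by vanishing outside \<open>F\<close>, so that two representations
    extend to the union of their index sets.\<close>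
  have "\<exists>F c. finite F \<and> (\<forall>i. smooth_on S (c i)) \<and> (\<forall>i. i \<notin> F \<longrightarrow> c i = (\<lambda>g. 0)) \<and>
      (\<forall>f g. P f g = (\<Sum>i\<in>F. c i g * D i f g))"
    using assms(2)
  proof induction
    case (base c i)
    then show ?case
      by (intro exI[of _ "{i}"] exI[of _ "\<lambda>j. if j = i then c else (\<lambda>g. 0)"])
        (auto intro: smooth_on_const[OF assms(1)])
  next
    case (add P Q)
    from add.IH(1) obtain F c where F:
      "finite F" "\<forall>i. smooth_on S (c i)" "\<forall>i. i \<notin> F \<longrightarrow> c i = (\<lambda>g. 0)"
      "\<forall>f g. P f g = (\<Sum>i\<in>F. c i g * D i f g)" by (elim exE conjE)
    from add.IH(2) obtain G d where G:
      "finite G" "\<forall>i. smooth_on S (d i)" "\<forall>i. i \<notin> G \<longrightarrow> d i = (\<lambda>g. 0)"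
      "\<forall>f g. Q f g = (\<Sum>i\<in>G. d i g * D i f g)" by (elim exE conjE)
    note * = F G
    have "(\<Sum>i\<in>F. c i g * D i f g) = (\<Sum>i\<in>F \<union> G. c i g * D i f g)" for f g
      using * by (intro sum.mono_neutral_left) auto
    moreover have "(\<Sum>i\<in>G. d i g * D i f g) = (\<Sum>i\<in>F \<union> G. d i g * D i f g)" for f g
      using * by (intro sum.mono_neutral_left) auto
    ultimately have "\<forall>f g. P f g + Q f g = (\<Sum>i\<in>F \<union> G. (c i g + d i g) * D i f g)"
      using *(4,8) by (simp add: distrib_right sum.distrib)
    moreover have "\<forall>i. smooth_on S (\<lambda>g. c i g + d i g)"
      using * by (auto intro!: smooth_on_add assms)
    ultimately show ?case
      using * by (intro exI[of _ "F \<union> G"] exI[of _ "\<lambda>i g. c i g + d i g"]) auto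
  qed
  then show ?thesis by blast
qed

text \<open>The product of the inverse of g with v, written by Cramer's rule so that its entries are
  visibly smooth in g.\<close>

definition left_quotient :: "real^'n^'n \<Rightarrow> real^'n^'n \<Rightarrow> real^'n^'n" where
  "left_quotient v g = (\<chi> k j. det (\<chi> i l. if l = k then v $ i $ j else g $ i $ l) / det g)"

lemma mult_left_quotient: "g \<in> GL \<Longrightarrow> g ** left_quotient v g = v"
proof -
  assume "g \<in> GL"
  then have g: "det g \<noteq> 0" by (simp add: GL_det)
  have "(g ** left_quotient v g) $ i $ j = v $ i $ j" for i j
  proof -
    define x where "x = (\<chi> k. det (\<chi> i l. if l = k then (\<chi> i. v $ i $ j) $ i else g $ i $ l) / det g)"
    have "g *v x = (\<chi> i. v $ i $ j)"
      using cramer[OF g] x_def by blast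
    then have "(g *v x) $ i = v $ i $ j" by simp
    then show ?thesis
      by (simp add: matrix_matrix_mult_def matrix_vector_mult_def left_quotient_def x_def cong: if_cong)
  qed
  then show ?thesis by (simp add: vec_eq_iff)
qed

lemma smooth_on_left_quotient: "smooth_on GL (\<lambda>g. left_quotient v g $ k $ j)"
proof -
  have "smooth_on GL (\<lambda>g. (\<chi> i l. if l = k then v $ i $ j else g $ i $ l) $ i $ l)" for i l
    by (cases "l = k") (auto intro!: smooth_on_const smooth_on_entry open_GL)
  then show ?thesis
    unfolding left_quotient_def vec_lambda_beta
    by (intro smooth_on_divide smooth_on_det smooth_on_entry open_GL) (auto simp: GL_det)
qed

text \<open>The fields of the matrix units form a frame: the coordinate direction \<open>v\<close>
  at \<open>g\<close> is \<open>g ** X\<close> with \<open>X = left_quotient v g\<close>.\<close>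

lemma frechet_derivative_eq_rderiv:
  assumes f: "f \<in> smooth_fns" and g: "g \<in> GL"
  shows "frechet_derivative f (at g) v
    = (\<Sum>i\<in>UNIV. \<Sum>j\<in>UNIV. of_real (left_quotient v g $ i $ j) * rderiv (elem i j) f g)"
proof -
  have "frechet_derivative f (at g) v = rderiv (left_quotient v g) f g"
    using g by (simp add: rderiv_def mult_left_quotient)
  also have "\<dots> = rderiv (\<Sum>i\<in>UNIV. \<Sum>j\<in>UNIV. left_quotient v g $ i $ j *\<^sub>R elem i j) f g"
    by (simp add: elem_expansion[symmetric])
  finally show ?thesis
    by (simp add: rderiv_matrix_sum[OF f] rderiv_matrix_scaleR[OF f])
qed

lemma rderiv_lincomb:
  "f \<in> smooth_fns \<Longrightarrow> h \<in> smooth_fns \<Longrightarrow>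
    rderiv X (\<lambda>g. p * f g + q * h g) = (\<lambda>g. p * rderiv X f g + q * rderiv X h g)"
  by (simp add: rderiv_add rderiv_cmult smooth_fns_cmult)

lemma comb_linear:
  "open S \<Longrightarrow> comb S D P \<Longrightarrow> comb S D Q \<Longrightarrow> comb S D (\<lambda>f g. p * P f g + q * Q f g)"
  using comb_smooth_mult[OF _ _ smooth_on_const] by (intro comb.add) blast+

text \<open>One step of normal ordering. It matters that a single \<open>P\<close> serves all
  \<open>f\<close> of the given highest weight.\<close>

definition maps_to_comb where
  "maps_to_comb lam X x \<longleftrightarrow>
    (\<exists>P. comb GL mon P \<and> (\<forall>f\<in>highest_weight lam. rderiv X (mon x f) = P f))"

lemma maps_to_combI:
  "comb GL mon P \<Longrightarrow> (\<And>f. f \<in> highest_weight lam \<Longrightarrow> rderiv X (mon x f) = P f) \<Longrightarrow> maps_to_comb lam X x"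
  unfolding maps_to_comb_def by blast

lemma maps_to_comb_12: "maps_to_comb lam (elem 1 2) (a, b, c)"
proof -
  have "comb GL mon (\<lambda>f g. of_nat a * (lam $ 2 - lam $ 1 - of_nat b + of_nat c - of_nat a + 1) * mon (a - 1, b, c) f g
        + (- of_nat b) * mon (a, b - 1, c + 1) f g)"
    by (intro comb.add comb_const open_GL)
  then show ?thesis
    by (rule maps_to_combI) (simp add: rderiv_12_mon del: mon.simps)
qed

lemma maps_to_comb_23: "maps_to_comb lam (elem 2 3) (a, b, c)"
proof -
  have "comb GL mon (\<lambda>f g. of_nat b * mon (a + 1, b - 1, c) f g
        + of_nat c * (lam $ 3 - lam $ 2 - of_nat c + 1) * mon (a, b, c - 1) f g)"
    by (intro comb.add comb_const open_GL)
  then show ?thesis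
    by (rule maps_to_combI) (simp add: rderiv_23_mon del: mon.simps)
qed

text \<open>E13 = [E12, E23] reduces to the two simple root vectors, each applied to the normal form
  produced by the other.\<close>

lemma maps_to_comb_13: "maps_to_comb lam (elem 1 3) (a, b, c)"
proof -
  note C12 = maps_to_comb_12[of lam, unfolded maps_to_comb_def]
  note C23 = maps_to_comb_23[of lam, unfolded maps_to_comb_def]
  obtain P1 where P1: "comb GL mon P1" "\<forall>f\<in>highest_weight lam. rderiv (elem 1 2) (mon (a + 1, b - 1, c) f) = P1 f"
    using C12 by blast
  obtain P2 where P2: "comb GL mon P2" "\<forall>f\<in>highest_weight lam. rderiv (elem 1 2) (mon (a, b, c - 1) f) = P2 f"
    using C12 by blast
  obtain Q1 where Q1: "comb GL mon Q1" "\<forall>f\<in>highest_weight lam. rderiv (elem 2 3) (mon (a - 1, b, c) f) = Q1 f"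
    using C23 by blast
  obtain Q2 where Q2: "comb GL mon Q2" "\<forall>f\<in>highest_weight lam. rderiv (elem 2 3) (mon (a, b - 1, c + 1) f) = Q2 f"
    using C23 by blast
  let ?p1 = "of_nat b" and ?p2 = "of_nat c * (lam $ 3 - lam $ 2 - of_nat c + 1)"
    and ?q1 = "of_nat a * (lam $ 2 - lam $ 1 - of_nat b + of_nat c - of_nat a + 1)" and ?q2 = "- of_nat b"
  have "comb GL mon (\<lambda>f g. 1 * (?p1 * P1 f g + ?p2 * P2 f g) + (-1) * (?q1 * Q1 f g + ?q2 * Q2 f g))"
    by (intro comb_linear open_GL P1 P2 Q1 Q2)
  then show ?thesis
  proof (rule maps_to_combI)
    fix f assume f: "f \<in> highest_weight lam"
    have mon: "mon x f \<in> smooth_fns" for x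
      by (rule mon_smooth_fns[OF highest_weight_smooth_fns[OF f]])
    have 23: "rderiv (elem 2 3) (mon (a, b, c) f) = (\<lambda>g. ?p1 * mon (a + 1, b - 1, c) f g + ?p2 * mon (a, b, c - 1) f g)"
      by (rule rderiv_23_mon[OF f])
    have 12: "rderiv (elem 1 2) (mon (a, b, c) f) = (\<lambda>g. ?q1 * mon (a - 1, b, c) f g + ?q2 * mon (a, b - 1, c + 1) f g)"
      by (simp add: rderiv_12_mon[OF f] del: mon.simps)
    have "rderiv (elem 1 2) (rderiv (elem 2 3) (mon (a, b, c) f)) = (\<lambda>g. ?p1 * P1 f g + ?p2 * P2 f g)"
      unfolding 23 rderiv_lincomb[OF mon mon] using P1(2) P2(2) f by simp
    moreover have "rderiv (elem 2 3) (rderiv (elem 1 2) (mon (a, b, c) f)) = (\<lambda>g. ?q1 * Q1 f g + ?q2 * Q2 f g)"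
      unfolding 12 rderiv_lincomb[OF mon mon] using Q1(2) Q2(2) f by simp
    ultimately show "rderiv (elem 1 3) (mon (a, b, c) f)
        = (\<lambda>g. 1 * (?p1 * P1 f g + ?p2 * P2 f g) + (-1) * (?q1 * Q1 f g + ?q2 * Q2 f g))"
      using rderiv_commutator[OF mon, of "elem 1 2" "elem 2 3" "(a, b, c)"]
      by (simp add: elem_simps fun_eq_iff algebra_simps del: mon.simps)
  qed
qed

lemma maps_to_comb_elem: "maps_to_comb lam (elem i j) (a, b, c)"
proof -
  have "maps_to_comb lam (elem 2 1) (a, b, c)"
    by (rule maps_to_combI[OF comb_generator[OF open_GL]]) (rule rderiv_21_mon)
  moreover have "maps_to_comb lam (elem 3 1) (a, b, c)"
    by (rule maps_to_combI[OF comb_generator[OF open_GL]]) (rule rderiv_31_mon)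
  moreover have "maps_to_comb lam (elem 3 2) (a, b, c)"
    by (rule maps_to_combI[OF comb.add[OF comb_generator[OF open_GL] comb_const[OF open_GL]]])
      (rule rderiv_32_mon)
  moreover have "maps_to_comb lam (elem 1 1) (a, b, c)"
    by (rule maps_to_combI[OF comb_const[OF open_GL]]) (rule rderiv_diag_mon(1))
  moreover have "maps_to_comb lam (elem 2 2) (a, b, c)"
    by (rule maps_to_combI[OF comb_const[OF open_GL]]) (rule rderiv_diag_mon(2))
  moreover have "maps_to_comb lam (elem 3 3) (a, b, c)"
    by (rule maps_to_combI[OF comb_const[OF open_GL]]) (rule rderiv_diag_mon(3))
  moreover have "\<forall>i j. maps_to_comb lam (elem i j) (a, b, c)"
    unfolding forall_3 using calculation maps_to_comb_12 maps_to_comb_23 maps_to_comb_13 by blast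
  ultimately show ?thesis by blast
qed

text \<open>Coefficients are differentiated by the product rule; monomials are differentiated in the
  invariant frame, where \<open>maps_to_comb_elem\<close> restores the normal order.\<close>

lemma frechet_derivative_comb:
  assumes "comb GL mon P"
  shows "\<exists>Q. comb GL mon Q \<and>
    (\<forall>f\<in>highest_weight lam. \<forall>g\<in>GL. frechet_derivative (P f) (at g) v = Q f g)"
  using assms
proof induction
  case (base c x)
  have "\<forall>i j. \<exists>P. comb GL mon P \<and> (\<forall>f\<in>highest_weight lam. rderiv (elem i j) (mon x f) = P f)"
    using maps_to_comb_elem[of lam] unfolding maps_to_comb_def by (cases x) blast
  then obtain P where P: "\<And>i j. comb GL mon (P i j)"
      "\<And>i j f. f \<in> highest_weight lam \<Longrightarrow> rderiv (elem i j) (mon x f) = P i j f"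
    by metis
  let ?Q = "\<lambda>f g. (\<Sum>i\<in>UNIV. \<Sum>j\<in>UNIV. (c g * of_real (left_quotient v g $ i $ j)) * P i j f g)
      + frechet_derivative c (at g) v * mon x f g"
  have "comb GL mon ?Q"
    by (intro comb.add comb_sum comb_smooth_mult P comb.base smooth_on_deriv base smooth_on_mult
        smooth_on_bounded_linear_compose[OF _ bounded_linear_of_real] smooth_on_left_quotient open_GL)
  moreover have "frechet_derivative (\<lambda>g. c g * mon x f g) (at g) v = ?Q f g"
    if f: "f \<in> highest_weight lam" and g: "g \<in> GL" for f g
  proof -
    have m: "mon x f \<in> smooth_fns"
      by (rule mon_smooth_fns[OF highest_weight_smooth_fns[OF f]])
    show ?thesis
      unfolding frechet_derivative_bilinear[OF bounded_bilinear_mult smooth_on_differentiable[OF base g]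
        smooth_fns_differentiable[OF m g]] frechet_derivative_eq_rderiv[OF m g] P(2)[OF f]
      by (simp add: sum_distrib_left mult.assoc)
  qed
  ultimately show ?case by blast
next
  case (add P Q)
  from add.IH(1) obtain P' where P: "comb GL mon P'"
    "\<forall>f\<in>highest_weight lam. \<forall>g\<in>GL. frechet_derivative (P f) (at g) v = P' f g" by (elim exE conjE)
  from add.IH(2) obtain Q' where Q: "comb GL mon Q'"
    "\<forall>f\<in>highest_weight lam. \<forall>g\<in>GL. frechet_derivative (Q f) (at g) v = Q' f g" by (elim exE conjE)
  note * = P(1) Q(1) P(2) Q(2)
  have "frechet_derivative (\<lambda>g. P f g + Q f g) (at g) v = P' f g + Q' f g"
    if f: "f \<in> highest_weight lam" and g: "g \<in> GL" for f g
  proof -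
    have "smooth_on GL (mon x f)" for x
      by (intro smooth_fns_smooth mon_smooth_fns highest_weight_smooth_fns[OF f])
    then have "P f differentiable (at g)" "Q f differentiable (at g)"
      using smooth_on_differentiable[OF comb_smooth_on[OF open_GL add.hyps(1)] g]
        smooth_on_differentiable[OF comb_smooth_on[OF open_GL add.hyps(2)] g] by simp_all
    then show ?thesis
      using *(3,4) f g by (simp add: frechet_derivative_add)
  qed
  then show ?case
    using comb.add[OF *(1,2)] by blast
qed

lemma iter_deriv_comb_mon:
  "\<exists>Q. comb GL mon Q \<and> (\<forall>f\<in>highest_weight lam. \<forall>g\<in>GL. iter_deriv vs f g = Q f g)"
proof (induction vs)
  case Nil
  show ?case
    by (rule exI[of _ "mon (0, 0, 0)"]) (simp add: comb_generator[OF open_GL] del: mon.simps, simp)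
next
  case (Cons v vs)
  then obtain P where P: "comb GL mon P" "\<forall>f\<in>highest_weight lam. \<forall>g\<in>GL. iter_deriv vs f g = P f g"
    by blast
  obtain Q where Q: "comb GL mon Q"
    "\<forall>f\<in>highest_weight lam. \<forall>g\<in>GL. frechet_derivative (P f) (at g) v = Q f g"
    using frechet_derivative_comb[OF P(1)] by blast
  have "iter_deriv (v # vs) f g = Q f g" if "f \<in> highest_weight lam" "g \<in> GL" for f g
    using frechet_derivative_eq_on_open[OF open_GL that(2), of "iter_deriv vs f" "P f"] P(2) Q(2) that
    by simp
  then show ?case using Q(1) by blast
qed

text \<open>The opposite passage, from invariant fields back to coordinate derivatives. It shows
  that operators built from monomials are differential operators in the sense of
  \<open>diff_op_along\<close>.\<close>

lemma rderiv_comb: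
  assumes "comb GL iter_deriv P"
  shows "\<exists>Q. comb GL iter_deriv Q \<and>
    (\<forall>f\<in>smooth_fns. \<forall>g\<in>GL. frechet_derivative (P f) (at g) (g ** X) = Q f g)"
  using assms
proof induction
  case (base c vs)
  let ?Q = "\<lambda>f g. (\<Sum>b\<in>Basis. (c g * of_real ((g ** X) \<bullet> b)) * iter_deriv (b # vs) f g)
      + frechet_derivative c (at g) (g ** X) * iter_deriv vs f g"
  have lin: "smooth_on GL (\<lambda>g. g ** X)"
    by (rule smooth_on_linear[OF open_GL linear_matrix_mul_right])
  have "smooth_on GL (\<lambda>g. frechet_derivative c (at g) (g ** X))"
    by (rule smooth_on_frechet_derivative[OF open_GL base lin])
  moreover have "smooth_on GL (\<lambda>g. c g * of_real ((g ** X) \<bullet> b))" for b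
    by (intro smooth_on_mult base smooth_on_bounded_linear_compose[OF _ bounded_linear_of_real]
        smooth_on_bounded_linear_compose[OF _ bounded_linear_inner_left] lin open_GL)
  ultimately have "comb GL iter_deriv ?Q"
    by (intro comb.add comb_sum comb.base open_GL)
  moreover have "frechet_derivative (\<lambda>g. c g * iter_deriv vs f g) (at g) (g ** X) = ?Q f g"
    if f: "f \<in> smooth_fns" and g: "g \<in> GL" for f g
  proof -
    have d: "iter_deriv vs f differentiable (at g)"
      using smooth_fns_smooth[OF f] g by (simp add: smooth_on_def)
    show ?thesis
      unfolding frechet_derivative_bilinear[OF bounded_bilinear_mult smooth_on_differentiable[OF base g] d]
      by (subst frechet_derivative_basis[OF d])
        (simp add: sum_distrib_left mult.assoc scaleR_conv_of_real)
  qed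
  ultimately show ?case by blast
next
  case (add P Q)
  from add.IH(1) obtain P' where P: "comb GL iter_deriv P'"
    "\<forall>f\<in>smooth_fns. \<forall>g\<in>GL. frechet_derivative (P f) (at g) (g ** X) = P' f g" by (elim exE conjE)
  from add.IH(2) obtain Q' where Q: "comb GL iter_deriv Q'"
    "\<forall>f\<in>smooth_fns. \<forall>g\<in>GL. frechet_derivative (Q f) (at g) (g ** X) = Q' f g" by (elim exE conjE)
  note * = P(1) Q(1) P(2) Q(2)
  have "frechet_derivative (\<lambda>g. P f g + Q f g) (at g) (g ** X) = P' f g + Q' f g"
    if f: "f \<in> smooth_fns" and g: "g \<in> GL" for f g
  proof -
    have "smooth_on GL (iter_deriv vs f)" for vs
      by (rule smooth_on_iter_deriv[OF smooth_fns_smooth[OF f]])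
    then have "P f differentiable (at g)" "Q f differentiable (at g)"
      using smooth_on_differentiable[OF comb_smooth_on[OF open_GL add.hyps(1)] g]
        smooth_on_differentiable[OF comb_smooth_on[OF open_GL add.hyps(2)] g] by simp_all
    then show ?thesis
      using *(3,4) f g by (simp add: frechet_derivative_add)
  qed
  then show ?case
    using comb.add[OF *(1,2)] by blast
qed

definition is_diff_op :: "((real^'n^'n \<Rightarrow> complex) \<Rightarrow> real^'n^'n \<Rightarrow> complex) \<Rightarrow> bool" where
  "is_diff_op T \<longleftrightarrow> (\<exists>P. comb GL iter_deriv P \<and> (\<forall>f\<in>smooth_fns. \<forall>g\<in>GL. T f g = P f g))"

lemma is_diff_op_rderiv:
  assumes "is_diff_op T"
  shows "is_diff_op (\<lambda>f. rderiv X (T f))"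
proof -
  obtain P where P: "comb GL iter_deriv P" "\<forall>f\<in>smooth_fns. \<forall>g\<in>GL. T f g = P f g"
    using assms is_diff_op_def by blast
  obtain Q where Q: "comb GL iter_deriv Q"
    "\<forall>f\<in>smooth_fns. \<forall>g\<in>GL. frechet_derivative (P f) (at g) (g ** X) = Q f g"
    using rderiv_comb[OF P(1)] by blast
  have "rderiv X (T f) g = Q f g" if "f \<in> smooth_fns" "g \<in> GL" for f g
    using frechet_derivative_eq_on_open[OF open_GL that(2), of "T f" "P f"] P(2) Q(2) that
    by (simp add: rderiv_def)
  then show ?thesis using Q(1) is_diff_op_def by blast
qed

lemma is_diff_op_funpow: "is_diff_op T \<Longrightarrow> is_diff_op (\<lambda>f. (rderiv X ^^ a) (T f))"
  by (induction a) (simp_all add: is_diff_op_rderiv)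

lemma is_diff_op_mon: "is_diff_op (mon x)"
proof -
  have "is_diff_op (\<lambda>f :: real^3^3 \<Rightarrow> complex. f)"
    unfolding is_diff_op_def
    using comb_generator[OF open_GL, of iter_deriv "[]"] by (intro exI[of _ "iter_deriv []"]) simp
  then have "is_diff_op (\<lambda>f. mon (a, b, c) f)" for a b c
    unfolding mon.simps by (intro is_diff_op_funpow)
  then show ?thesis by (cases x) (simp del: mon.simps)
qed

lemma is_diff_op_sum:
  assumes "\<And>i. i \<in> I \<Longrightarrow> is_diff_op (T i)"
  shows "is_diff_op (\<lambda>f g. \<Sum>i\<in>I. c i * T i f g)"
proof -
  obtain P where P: "\<And>i. i \<in> I \<Longrightarrow> comb GL iter_deriv (P i)"
    "\<And>i f g. i \<in> I \<Longrightarrow> f \<in> smooth_fns \<Longrightarrow> g \<in> GL \<Longrightarrow> T i f g = P i f g"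
    using assms unfolding is_diff_op_def by metis
  have "comb GL iter_deriv (\<lambda>f g. \<Sum>i\<in>I. c i * P i f g)"
    by (intro comb_sum comb_smooth_mult P smooth_on_const open_GL)
  then show ?thesis
    unfolding is_diff_op_def using P(2) by (auto intro!: exI)
qed

section \<open>Test functions\<close>

text \<open>The character sgn(x)^b |x|^(-w) of the nonzero reals; the characters of MA are products
  of these.\<close>

definition real_char :: "bit \<Rightarrow> complex \<Rightarrow> real \<Rightarrow> complex" where
  "real_char b w x = (if b = 0 then 1 else of_real (sgn x)) * of_real \<bar>x\<bar> powr (- w)"

lemma real_char_one: "real_char b w 1 = 1"
  by (simp add: real_char_def)

lemma real_char_mult: "real_char b w (x * y) = real_char b w x * real_char b w y"
proof -
  have "(complex_of_real \<bar>x\<bar> * of_real \<bar>y\<bar>) powr (- w) = of_real \<bar>x\<bar> powr (- w) * of_real \<bar>y\<bar> powr (- w)"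
    by (rule powr_times_real) simp_all
  then show ?thesis
    by (simp add: real_char_def abs_mult sgn_mult)
qed

lemma diag_char_eq: "diag_char \<xi> lam t = (\<Prod>j\<in>UNIV. real_char (\<xi> $ j) (lam $ j) (t $ j))"
proof -
  have "inverse (complex_of_real (sgn x)) = of_real (sgn x)" for x
    by (simp add: sgn_if)
  then show ?thesis
    unfolding diag_char_def sign_char_def power_char_def prod.distrib[symmetric]
    by (intro prod.cong) (auto simp: real_char_def)
qed

lemma smooth_on_real_char:
  fixes f :: "'a::euclidean_space \<Rightarrow> real"
  assumes S: "open S" and f: "smooth_on S f" and nz: "\<And>x. x \<in> S \<Longrightarrow> f x \<noteq> 0"
  shows "smooth_on S (\<lambda>x. real_char b w (f x))"
proof (rule smooth_on_compose[OF S _ f, of "{0<..} \<union> {..<0}"])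
  have "smooth_on {0<..} (real_char b w)"
    by (rule smooth_on_cong[OF _ _ smooth_on_of_real_powr[of "- w"]]) (auto simp: real_char_def)
  moreover have "smooth_on {..<0} (real_char b w)"
  proof -
    have "smooth_on {..<0} (\<lambda>x::real. of_real (- x) powr (- w) :: complex)"
      by (rule smooth_on_compose[OF _ smooth_on_of_real_powr])
        (auto intro!: smooth_on_bounded_linear bounded_linear_minus bounded_linear_ident)
    then have "smooth_on {..<0} (\<lambda>x::real. (if b = 0 then 1 else -1) * (of_real (- x) powr (- w) :: complex))"
      by (intro smooth_on_mult smooth_on_const) auto
    then show ?thesis
      by (rule smooth_on_cong[rotated 2]) (auto simp: real_char_def)
  qed
  ultimately show "smooth_on ({0<..} \<union> {..<0}) (real_char b w)"
    by (rule smooth_on_Un)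
  show "f ` S \<subseteq> {0<..} \<union> {..<0}"
    using nz by (auto simp: linorder_neq_iff)
qed

text \<open>Pluecker coordinates of the plane spanned by the first two columns; right multiplication
  by an upper triangular matrix only rescales them.\<close>

definition minor :: "3 \<Rightarrow> 3 \<Rightarrow> real^3^3 \<Rightarrow> real" where
  "minor i j g = g $ i $ 1 * g $ j $ 2 - g $ i $ 2 * g $ j $ 1"

text \<open>Squared norms of the first column and, in \<open>flag_norm2\<close>, of the exterior
  product of the first two columns. Dividing squared coordinates by them gives functions on the flag
  variety, to which the cutoffs are applied.\<close>

definition flag_norm1 :: "real^3^3 \<Rightarrow> real" where
  "flag_norm1 g = (g $ 1 $ 1)\<^sup>2 + (g $ 2 $ 1)\<^sup>2 + (g $ 3 $ 1)\<^sup>2"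

definition flag_norm2 :: "real^3^3 \<Rightarrow> real" where
  "flag_norm2 g = (minor 1 2 g)\<^sup>2 + (minor 1 3 g)\<^sup>2 + (minor 2 3 g)\<^sup>2"

lemma det_minors: "det g = g $ 1 $ 3 * minor 2 3 g - g $ 2 $ 3 * minor 1 3 g + g $ 3 $ 3 * minor 1 2 g"
  by (simp add: det_3 minor_def algebra_simps)

lemma flag_norm1_pos: "g \<in> GL \<Longrightarrow> flag_norm1 g > 0"
proof (rule ccontr)
  assume g: "g \<in> GL" "\<not> flag_norm1 g > 0"
  then have "flag_norm1 g = 0"
    by (simp add: flag_norm1_def not_less add_nonneg_nonneg antisym)
  then have "g $ 1 $ 1 = 0" "g $ 2 $ 1 = 0" "g $ 3 $ 1 = 0"
    unfolding flag_norm1_def by (simp_all add: add_nonneg_eq_0_iff)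
  then show False using g by (simp add: GL_det det_3)
qed

lemma flag_norm2_pos: "g \<in> GL \<Longrightarrow> flag_norm2 g > 0"
proof (rule ccontr)
  assume g: "g \<in> GL" "\<not> flag_norm2 g > 0"
  then have "flag_norm2 g = 0"
    by (simp add: flag_norm2_def not_less add_nonneg_nonneg antisym)
  then have "minor 1 2 g = 0" "minor 1 3 g = 0" "minor 2 3 g = 0"
    unfolding flag_norm2_def by (simp_all add: add_nonneg_eq_0_iff)
  then show False using g by (simp add: GL_det det_minors)
qed

text \<open>On the big cell, \<open>g 2 1 / g 1 1\<close>, \<open>g 3 1 / g 1 1\<close> and \<open>minor 1 3 g / minor 1 2 g\<close> are the coordinates of the
  lower unipotent factor of \<open>g\<close>. The cutoffs vanish near the complement of
  the big cell, so extension by zero is smooth.\<close>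

definition test_fn :: "bit^3 \<Rightarrow> complex^3 \<Rightarrow> nat \<Rightarrow> nat \<Rightarrow> nat \<Rightarrow> real^3^3 \<Rightarrow> complex" where
  "test_fn \<xi> lam a b c g = (if g $ 1 $ 1 \<noteq> 0 \<and> minor 1 2 g \<noteq> 0 \<and> g \<in> GL then
     of_real (cutoff (1 - (g $ 1 $ 1)\<^sup>2 / flag_norm1 g) * cutoff (1 - (minor 1 2 g)\<^sup>2 / flag_norm2 g) *
       (g $ 2 $ 1 / g $ 1 $ 1) ^ a * (g $ 3 $ 1 / g $ 1 $ 1) ^ b * (minor 1 3 g / minor 1 2 g) ^ c) *
     (real_char (\<xi> $ 1) (lam $ 1) (g $ 1 $ 1) *
      real_char (\<xi> $ 2) (lam $ 2) (minor 1 2 g / g $ 1 $ 1) *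
      real_char (\<xi> $ 3) (lam $ 3) (det g / minor 1 2 g)) else 0)"

lemma smooth_on_minor: "open S \<Longrightarrow> smooth_on S (minor i j)"
  unfolding minor_def[abs_def] by (intro smooth_on_diff smooth_on_mult smooth_on_entry)

lemma smooth_on_flag_norm: "open S \<Longrightarrow> smooth_on S flag_norm1" "open S \<Longrightarrow> smooth_on S flag_norm2"
  unfolding flag_norm1_def[abs_def] flag_norm2_def[abs_def]
  by (intro smooth_on_add smooth_on_power smooth_on_entry smooth_on_minor; assumption)+

lemma test_fn_smooth_fns: "test_fn \<xi> lam a b c \<in> smooth_fns"
proof -
  define U where "U = GL \<inter> {g :: real^3^3. g $ 1 $ 1 \<noteq> 0} \<inter> {g. minor 1 2 g \<noteq> 0}"
  \<comment> \<open>Where an entry or minor defining the big cell vanishes, its ratio to the norm is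
    0, hence below 1/2, where the cutoff is zero. So \<open>V1\<close> and \<open>V2\<close> cover
    the complement of \<open>U\<close> in \<open>GL\<close>.\<close>
  define V1 where "V1 = GL \<inter> {g :: real^3^3. (g $ 1 $ 1)\<^sup>2 < flag_norm1 g / 2}"
  define V2 where "V2 = GL \<inter> {g :: real^3^3. (minor 1 2 g)\<^sup>2 < flag_norm2 g / 2}"
  have cont: "continuous_on UNIV (\<lambda>g :: real^3^3. g $ 1 $ 1)" "continuous_on UNIV (minor 1 2)"
    "continuous_on UNIV flag_norm1" "continuous_on UNIV flag_norm2"
    by (intro smooth_on_continuous_on smooth_on_entry smooth_on_minor smooth_on_flag_norm open_UNIV)+
  have U: "open U"
    unfolding U_def
    by (intro open_Int open_GL open_Collect_neq continuous_on_const cont)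
  have V: "open V1" "open V2"
    unfolding V1_def V2_def
    by (intro open_Int open_GL open_Collect_less continuous_on_divide continuous_on_power
        continuous_on_const cont; simp)+
  have "smooth_on U (test_fn \<xi> lam a b c)"
  proof (rule smooth_on_cong[OF U])
    have cut: "smooth_on U (\<lambda>g. cutoff (1 - h g))" if "smooth_on U h" for h
      by (rule smooth_on_compose[OF U smooth_on_cutoff]) (auto intro!: smooth_on_diff smooth_on_const U that)
    show "smooth_on U (\<lambda>g. of_real (cutoff (1 - (g $ 1 $ 1)\<^sup>2 / flag_norm1 g) * cutoff (1 - (minor 1 2 g)\<^sup>2 / flag_norm2 g) *
       (g $ 2 $ 1 / g $ 1 $ 1) ^ a * (g $ 3 $ 1 / g $ 1 $ 1) ^ b * (minor 1 3 g / minor 1 2 g) ^ c) *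
     (real_char (\<xi> $ 1) (lam $ 1) (g $ 1 $ 1) *
      real_char (\<xi> $ 2) (lam $ 2) (minor 1 2 g / g $ 1 $ 1) *
      real_char (\<xi> $ 3) (lam $ 3) (det g / minor 1 2 g)))"
      by (intro smooth_on_mult[OF U] smooth_on_bounded_linear_compose[OF U bounded_linear_of_real]
          cut smooth_on_power[OF U] smooth_on_divide[OF U] smooth_on_real_char[OF U] smooth_on_entry[OF U]
          smooth_on_minor[OF U] smooth_on_flag_norm[OF U] smooth_on_det[OF U])
        (auto simp: U_def GL_det[symmetric] dest: flag_norm1_pos flag_norm2_pos)
  qed (simp add: test_fn_def U_def)
  moreover have "smooth_on V1 (test_fn \<xi> lam a b c)"
  proof (rule smooth_on_cong[OF V(1) _ smooth_on_const[OF V(1), of 0]])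
    fix g assume "g \<in> V1"
    then have "1 - (g $ 1 $ 1)\<^sup>2 / flag_norm1 g \<ge> 1/2"
      using flag_norm1_pos[of g] by (simp add: V1_def field_simps)
    then show "0 = test_fn \<xi> lam a b c g"
      by (simp add: test_fn_def cutoff_eq_0)
  qed
  moreover have "smooth_on V2 (test_fn \<xi> lam a b c)"
  proof (rule smooth_on_cong[OF V(2) _ smooth_on_const[OF V(2), of 0]])
    fix g assume "g \<in> V2"
    then have "1 - (minor 1 2 g)\<^sup>2 / flag_norm2 g \<ge> 1/2"
      using flag_norm2_pos[of g] by (simp add: V2_def field_simps)
    then show "0 = test_fn \<xi> lam a b c g"
      by (simp add: test_fn_def cutoff_eq_0)
  qed
  ultimately have "smooth_on (U \<union> V1 \<union> V2) (test_fn \<xi> lam a b c)"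
    by (intro smooth_on_Un)
  moreover have "GL \<subseteq> U \<union> V1 \<union> V2"
    by (auto simp: U_def V1_def V2_def dest: flag_norm1_pos flag_norm2_pos)
  ultimately show ?thesis
    using smooth_on_subset by (auto simp: smooth_fns_def test_fn_def)
qed

text \<open>The first column and the minors scale by products of diagonal entries of
  \<open>p\<close>, so cutoffs and coordinates are unchanged and only the characters react.\<close>

lemma test_fn_upper_triangular:
  assumes p: "p $ 2 $ 1 = 0" "p $ 3 $ 1 = 0" "p $ 3 $ 2 = 0"
    and nz: "p $ 1 $ 1 \<noteq> 0" "p $ 2 $ 2 \<noteq> 0" "p $ 3 $ 3 \<noteq> 0"
  shows "test_fn \<xi> lam a b c (g ** p) = real_char (\<xi> $ 1) (lam $ 1) (p $ 1 $ 1) *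
    real_char (\<xi> $ 2) (lam $ 2) (p $ 2 $ 2) * real_char (\<xi> $ 3) (lam $ 3) (p $ 3 $ 3) *
    test_fn \<xi> lam a b c g"
proof -
  have col1: "(g ** p) $ i $ 1 = p $ 1 $ 1 * g $ i $ 1" for i
    using p by (simp add: matrix_matrix_mult_def sum_3)
  have col2: "(g ** p) $ i $ 2 = p $ 1 $ 2 * g $ i $ 1 + p $ 2 $ 2 * g $ i $ 2" for i
    using p by (simp add: matrix_matrix_mult_def sum_3)
  have minor: "minor i j (g ** p) = (p $ 1 $ 1 * p $ 2 $ 2) * minor i j g" for i j
    by (simp add: minor_def col1 col2 algebra_simps)
  have det: "det (g ** p) = (p $ 1 $ 1 * p $ 2 $ 2 * p $ 3 $ 3) * det g"
    using p by (simp add: det_mul det_3[of p])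
  have norm1: "flag_norm1 (g ** p) = (p $ 1 $ 1)\<^sup>2 * flag_norm1 g"
    by (simp add: flag_norm1_def col1 power_mult_distrib algebra_simps)
  have norm2: "flag_norm2 (g ** p) = (p $ 1 $ 1 * p $ 2 $ 2)\<^sup>2 * flag_norm2 g"
    by (simp add: flag_norm2_def minor power_mult_distrib algebra_simps)
  have ratios: "(p $ 1 $ 1 * g $ 1 $ 1)\<^sup>2 / ((p $ 1 $ 1)\<^sup>2 * flag_norm1 g) = (g $ 1 $ 1)\<^sup>2 / flag_norm1 g"
    "(p $ 1 $ 1 * p $ 2 $ 2 * minor 1 2 g)\<^sup>2 / ((p $ 1 $ 1 * p $ 2 $ 2)\<^sup>2 * flag_norm2 g)
      = (minor 1 2 g)\<^sup>2 / flag_norm2 g"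
    "(p $ 1 $ 1 * g $ i $ 1) / (p $ 1 $ 1 * g $ 1 $ 1) = g $ i $ 1 / g $ 1 $ 1"
    "(p $ 1 $ 1 * p $ 2 $ 2 * minor 1 3 g) / (p $ 1 $ 1 * p $ 2 $ 2 * minor 1 2 g) = minor 1 3 g / minor 1 2 g"
    "p $ 1 $ 1 * p $ 2 $ 2 * minor 1 2 g / (p $ 1 $ 1 * g $ 1 $ 1) = p $ 2 $ 2 * (minor 1 2 g / g $ 1 $ 1)"
    "p $ 1 $ 1 * p $ 2 $ 2 * p $ 3 $ 3 * det g / (p $ 1 $ 1 * p $ 2 $ 2 * minor 1 2 g)
      = p $ 3 $ 3 * (det g / minor 1 2 g)" for i
    using nz by (simp_all add: power_mult_distrib)
  have GL: "g ** p \<in> GL \<longleftrightarrow> g \<in> GL"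
    using nz by (simp add: GL_det det)
  have nonzero: "p $ 1 $ 1 * g $ 1 $ 1 \<noteq> 0 \<longleftrightarrow> g $ 1 $ 1 \<noteq> 0"
    "p $ 1 $ 1 * p $ 2 $ 2 * minor 1 2 g \<noteq> 0 \<longleftrightarrow> minor 1 2 g \<noteq> 0"
    using nz by simp_all
  show ?thesis
    unfolding test_fn_def col1 minor det norm1 norm2 ratios GL nonzero
      real_char_mult[of _ _ "p $ 1 $ 1"] real_char_mult[of _ _ "p $ 2 $ 2"] real_char_mult[of _ _ "p $ 3 $ 3"]
    by (simp only: if_distrib[of "\<lambda>x. _ * x"] mult_zero_right mult_zero_left mult_ac)
qed

lemma test_fn_I_series: "test_fn \<xi> lam a b c \<in> I_series \<xi> lam"
  unfolding I_series_def principal_series_iff[OF one_in_unipotent(1)]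
proof (intro conjI ballI allI impI)
  fix g :: "real^3^3" and n :: "real^3^3" assume "n \<in> unipotent3"
  then show "test_fn \<xi> lam a b c (g ** n) = test_fn \<xi> lam a b c g"
    by (subst test_fn_upper_triangular) (simp_all add: unipotent3_def real_char_one)
next
  fix g :: "real^3^3" and t :: "real^3" assume t: "\<forall>j. t $ j \<noteq> 0"
  have entry: "diag_mat t $ i $ j = (if i = j then t $ i else 0)" for i j
    by (simp add: diag_mat_def)
  have "diag_char \<xi> lam t = real_char (\<xi> $ 1) (lam $ 1) (t $ 1) *
    real_char (\<xi> $ 2) (lam $ 2) (t $ 2) * real_char (\<xi> $ 3) (lam $ 3) (t $ 3)"
    unfolding diag_char_eq UNIV_3 by (simp add: three_distinct mult.assoc)
  with t show "test_fn \<xi> lam a b c (g ** diag_mat t) = diag_char \<xi> lam t * test_fn \<xi> lam a b c g"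
    by (subst test_fn_upper_triangular) (simp_all only: entry three_distinct if_False if_True refl, simp_all)
qed (rule test_fn_smooth_fns)

definition lower_unip :: "real \<Rightarrow> real \<Rightarrow> real \<Rightarrow> real^3^3" where
  "lower_unip s t u = mat 1 + s *\<^sub>R elem 2 1 + t *\<^sub>R elem 3 1 + u *\<^sub>R elem 3 2"

lemma lower_unip_entries:
  "lower_unip s t u $ 1 $ 1 = 1" "lower_unip s t u $ 1 $ 2 = 0" "lower_unip s t u $ 1 $ 3 = 0"
  "lower_unip s t u $ 2 $ 1 = s" "lower_unip s t u $ 2 $ 2 = 1" "lower_unip s t u $ 2 $ 3 = 0"
  "lower_unip s t u $ 3 $ 1 = t" "lower_unip s t u $ 3 $ 2 = u" "lower_unip s t u $ 3 $ 3 = 1"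
  by (simp_all add: lower_unip_def mat_def elem_def)

lemma lower_unip_det: "det (lower_unip s t u) = 1"
  by (simp add: det_3 lower_unip_entries)

lemma lower_unip_GL: "lower_unip s t u \<in> GL"
  by (simp add: GL_det lower_unip_det)

text \<open>Each right factor moves one coordinate. Since E32 E21 = E31, the coordinate of E32 has
  to be 0 before moving along E21.\<close>

lemma lower_unip_mult:
  "lower_unip s t u ** (mat 1 + h *\<^sub>R elem 3 2) = lower_unip s t (u + h)"
  "lower_unip s t 0 ** (mat 1 + h *\<^sub>R elem 3 1) = lower_unip s (t + h) 0"
  "lower_unip s 0 0 ** (mat 1 + h *\<^sub>R elem 2 1) = lower_unip (s + h) 0 0"
  by (simp_all add: lower_unip_def matrix_add_ldistrib matrix_add_rdistrib' matrix_mul_scaleR_left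
      matrix_mul_scaleR_right elem_simps scaleR_left_distrib)

lemma test_fn_lower_unip:
  assumes "\<bar>s\<bar> < 1/4" "\<bar>t\<bar> < 1/4" "\<bar>u\<bar> < 1/4"
  shows "test_fn \<xi> lam a b c (lower_unip s t u) = of_real (s ^ a * t ^ b * u ^ c)"
proof -
  have sq: "x\<^sup>2 \<le> e\<^sup>2" if "\<bar>x\<bar> \<le> e" for x e :: real
    using power_mono[OF that, of 2] by simp
  have s: "s\<^sup>2 \<le> (1/4)\<^sup>2" and t: "t\<^sup>2 \<le> (1/4)\<^sup>2" and u: "u\<^sup>2 \<le> (1/4)\<^sup>2"
    using assms by (intro sq; simp)+
  \<comment> \<open>The minor of rows 2 and 3 is su - t, bounded by 1/16 + 1/4 = 5/16. Both squared
    norms then lie between 1 and 4/3, where 1 - 1/x \<le> 1/4 and the cutoffs equal 1.\<close>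
  have "\<bar>s * u\<bar> \<le> 1/4 * (1/4)"
    unfolding abs_mult using assms by (intro mult_mono) auto
  then have "\<bar>s * u - t\<bar> \<le> 5/16"
    using assms by linarith
  then have v: "(s * u - t)\<^sup>2 \<le> (5/16)\<^sup>2" by (rule sq)
  have "1 - 1 / x \<le> 1/4" if "x \<ge> 1" "x \<le> 4/3" for x :: real
    using that by (simp add: field_simps)
  then have cut: "cutoff (1 - 1 / x) = 1" if "x \<ge> 1" "x \<le> 4/3" for x
    using that by (simp add: cutoff_eq_1)
  have "cutoff (1 - 1 / flag_norm1 (lower_unip s t u)) = 1"
    using s t by (intro cut) (simp_all add: flag_norm1_def lower_unip_entries power2_eq_square)
  moreover have "cutoff (1 - 1 / flag_norm2 (lower_unip s t u)) = 1"
    using u v by (intro cut) (simp_all add: flag_norm2_def minor_def lower_unip_entries power2_eq_square)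
  moreover have "minor 1 2 (lower_unip s t u) = 1" "minor 1 3 (lower_unip s t u) = u"
    by (simp_all add: minor_def lower_unip_entries)
  ultimately show ?thesis
    by (simp add: test_fn_def lower_unip_entries lower_unip_det lower_unip_GL real_char_one)
qed

lemma rderiv_poly:
  assumes F: "F \<in> smooth_fns" and g: "g \<in> GL" and u: "\<bar>u\<bar> < e"
    and eq: "\<And>h. \<bar>u + h\<bar> < e \<Longrightarrow> F (g ** (mat 1 + h *\<^sub>R X)) = of_real (k * poly r (u + h))"
  shows "rderiv X F g = of_real (k * poly (pderiv r) u)"
proof -
  have "((\<lambda>h. k * poly r (u + h)) has_real_derivative k * (poly (pderiv r) (u + 0) * (0 + 1))) (at 0)"
    by (intro DERIV_cmult DERIV_chain2[OF poly_DERIV] DERIV_add DERIV_const DERIV_ident)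
  then have "((\<lambda>h. k * poly r (u + h)) has_real_derivative k * poly (pderiv r) u) (at 0)"
    by simp
  from has_vector_derivative_of_real[OF this]
  have D: "((\<lambda>h. of_real (k * poly r (u + h)) :: complex) has_vector_derivative of_real (k * poly (pderiv r) u)) (at 0)" .
  have "open ((\<lambda>h. \<bar>u + h\<bar>) -` {..<e})"
    by (intro open_vimage open_lessThan continuous_intros)
  then have "((\<lambda>h. F (g ** (mat 1 + h *\<^sub>R X))) has_vector_derivative of_real (k * poly (pderiv r) u)) (at 0)"
    by (rule has_vector_derivative_transform_within_open[OF D]) (use u eq in auto)
  then show ?thesis
    by (rule vector_derivative_unique_at[OF rderiv_at[OF F g]])
qed

text \<open>Derivatives are taken in the order in which \<open>mon\<close> applies them: in u with s
  and t free, then in t at u = 0, then in s at t = u = 0. In this order each one is an ordinary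
  derivative of a polynomial.\<close>

lemma mon_at_one:
  assumes f: "f \<in> smooth_fns" and e: "e > 0"
    and eq: "\<And>s t u. \<bar>s\<bar> < e \<Longrightarrow> \<bar>t\<bar> < e \<Longrightarrow> \<bar>u\<bar> < e \<Longrightarrow>
      f (lower_unip s t u) = of_real (poly p s * poly q t * poly r u)"
  shows "mon (a, b, c) f (mat 1) =
    of_real (poly ((pderiv ^^ a) p) 0 * poly ((pderiv ^^ b) q) 0 * poly ((pderiv ^^ c) r) 0)"
proof -
  let ?F = "(rderiv (elem 3 2) ^^ c) f" and ?G = "(rderiv (elem 3 1) ^^ b) ((rderiv (elem 3 2) ^^ c) f)"
  have C: "(rderiv (elem 3 2) ^^ c) f (lower_unip s t u)
      = of_real (poly p s * poly q t * poly ((pderiv ^^ c) r) u)"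
    if "\<bar>s\<bar> < e" "\<bar>t\<bar> < e" "\<bar>u\<bar> < e" for s t u c
    using that
  proof (induction c arbitrary: u)
    case (Suc c)
    show ?case
      using rderiv_poly[OF funpow_rderiv_smooth_fns[OF f] lower_unip_GL Suc.prems(3),
          where X = "elem 3 2" and k = "poly p s * poly q t"] Suc.IH[OF Suc.prems(1,2)]
      by (simp add: lower_unip_mult)
  qed (simp add: eq)
  have B: "(rderiv (elem 3 1) ^^ b) ?F (lower_unip s t 0)
      = of_real (poly p s * poly ((pderiv ^^ c) r) 0 * poly ((pderiv ^^ b) q) t)"
    if "\<bar>s\<bar> < e" "\<bar>t\<bar> < e" for s t b
    using that
  proof (induction b arbitrary: t)
    case (Suc b)
    show ?case
      using rderiv_poly[OF funpow_rderiv_smooth_fns[OF funpow_rderiv_smooth_fns[OF f]] lower_unip_GL Suc.prems(2),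
          where X = "elem 3 1" and k = "poly p s * poly ((pderiv ^^ c) r) 0"] Suc.IH[OF Suc.prems(1)]
      by (simp add: lower_unip_mult)
  qed (use e in \<open>simp add: C\<close>)
  have A: "(rderiv (elem 2 1) ^^ a) ?G (lower_unip s 0 0)
      = of_real (poly ((pderiv ^^ b) q) 0 * poly ((pderiv ^^ c) r) 0 * poly ((pderiv ^^ a) p) s)"
    if "\<bar>s\<bar> < e" for s a
    using that
  proof (induction a arbitrary: s)
    case (Suc a)
    show ?case
      using rderiv_poly[OF funpow_rderiv_smooth_fns[OF funpow_rderiv_smooth_fns[OF funpow_rderiv_smooth_fns[OF f]]]
          lower_unip_GL Suc.prems, where X = "elem 2 1" and k = "poly ((pderiv ^^ b) q) 0 * poly ((pderiv ^^ c) r) 0"]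
        Suc.IH
      by (simp add: lower_unip_mult)
  qed (use e in \<open>simp add: B\<close>)
  have "lower_unip 0 0 0 = mat 1"
    by (simp add: lower_unip_def)
  then show ?thesis
    using A[of 0 a] e by (simp add: mult_ac)
qed

lemma higher_pderiv_monom_0:
  "poly ((pderiv ^^ m) (monom 1 n)) 0 = (if m = n then fact n else (0::real))"
  by (simp add: poly_0_coeff_0 coeff_higher_pderiv pochhammer_fact)

text \<open>Up to factorials, the test functions are a dual basis of the monomials evaluated at the
  identity.\<close>

lemma mon_test_fn:
  "mon (a', b', c') (test_fn \<xi> lam a b c) (mat 1)
    = (if (a', b', c') = (a, b, c) then fact a * fact b * fact c else 0)"
  using mon_at_one[OF test_fn_smooth_fns[of \<xi> lam a b c], where e = "1/4" and a = a' and b = b' and c = c'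
      and p = "monom 1 a" and q = "monom 1 b" and r = "monom 1 c"]
  by (simp add: test_fn_lower_unip poly_monom higher_pderiv_monom_0 del: mon.simps)

section \<open>Symmetry breaking operators\<close>

lemma iota_mult: "iota i (g ** h) = iota i g ** iota i h"
  by (cases "i = 1") (simp_all add: iota_def vec_eq_iff matrix_matrix_mult_def forall_3 sum_3 sum_2 vector_3)

lemma iota_one: "iota i (mat 1) = mat 1"
  by (cases "i = 1") (simp_all add: iota_def vec_eq_iff mat_def forall_3 vector_3)

lemma iota_det: "det (iota i g) = det g"
  by (cases "i = 1") (simp_all add: iota_def det_3 det_2 vector_3)

lemma iota_GL: "iota i g \<in> GL \<longleftrightarrow> g \<in> GL"
  by (simp add: GL_det iota_det)

lemma smooth_on_iota:
  assumes "open S"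
  shows "smooth_on S (iota i)"
proof (rule smooth_on_matrix[OF assms])
  have "\<forall>k l. smooth_on S (\<lambda>g. iota i g $ k $ l)"
    unfolding forall_3 using assms
    by (cases "i = 1") (simp_all add: iota_def vector_3 smooth_on_const smooth_on_entry)
  then show "smooth_on S (\<lambda>g. iota i g $ k $ l)" for k l by blast
qed

lemma matrix_inv_eq:
  fixes A B :: "real^'n^'n"
  assumes "A ** B = mat 1"
  shows "matrix_inv A = B"
proof -
  have BA: "B ** A = mat 1" using assms matrix_left_right_inverse by blast
  have "A ** matrix_inv A = mat 1 \<and> matrix_inv A ** A = mat 1"
    unfolding matrix_inv_def by (rule someI[of _ B]) (simp add: assms BA)
  then have "matrix_inv A = matrix_inv A ** (A ** B)" "matrix_inv A ** A = mat 1"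
    by (simp_all add: assms)
  then show ?thesis by (simp add: matrix_mul_assoc)
qed

lemma GL_inverse:
  assumes "g \<in> GL"
  obtains h where "g ** h = mat 1" "h ** g = mat 1" "matrix_inv g = h" "matrix_inv h = g" "h \<in> GL"
proof -
  obtain h where h: "g ** h = mat 1" "h ** g = mat 1"
    using assms by (auto simp: GL_def invertible_def)
  then have "h \<in> GL" by (auto simp: GL_def invertible_def)
  then show ?thesis using that h matrix_inv_eq by blast
qed

lemma matrix_inv_GL: "g \<in> GL \<Longrightarrow> matrix_inv g \<in> GL"
  using GL_inverse by metis

lemma matrix_inv_iota: "g \<in> GL \<Longrightarrow> matrix_inv (iota i g) = iota i (matrix_inv g)"
  by (rule matrix_inv_eq) (metis GL_inverse iota_mult iota_one)

definition emb_diag :: "nat \<Rightarrow> real^2 \<Rightarrow> real^3" where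
  "emb_diag i t = (if i = 1 then vector [t $ 1, t $ 2, 1] else vector [1, t $ 1, t $ 2])"

definition pos :: "nat \<Rightarrow> 2 \<Rightarrow> 3" where
  "pos i j = (if i = 1 then if j = 1 then 1 else 2 else if j = 1 then 2 else 3)"

lemma pos_simps: "pos 1 1 = 1" "pos 1 2 = 2" "i \<noteq> 1 \<Longrightarrow> pos i 1 = 2" "i \<noteq> 1 \<Longrightarrow> pos i 2 = 3"
  by (simp_all add: pos_def)

text \<open>The image of E12 under the differential of \<open>iota i\<close>, that is, the simple
  root vector of the embedded G'.\<close>

definition root_elem :: "nat \<Rightarrow> real^3^3" where
  "root_elem i = elem (pos i 1) (pos i 2)"

text \<open>The exponent of \<open>t $ j\<close> by which \<open>diag_mat t\<close> in \<open>G'\<close> scales the monomial \<open>mon (a, b, c)\<close>.\<close>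

fun wt :: "nat \<Rightarrow> 2 \<Rightarrow> nat \<times> nat \<times> nat \<Rightarrow> int" where
  "wt i j (a, b, c) = (if i = 1 then if j = 1 then - int (a + b) else int a - int c
    else if j = 1 then int a - int c else int (b + c))"

lemma iota_elem: "iota i (mat 1 + s *\<^sub>R elem k l) = mat 1 + s *\<^sub>R elem (pos i k) (pos i l)"
proof -
  have "\<forall>k l. iota i (mat 1 + s *\<^sub>R elem k l) = mat 1 + s *\<^sub>R elem (pos i k) (pos i l)"
    by (cases "i = 1")
      (simp_all add: iota_def vec_eq_iff mat_def elem_def forall_3 forall_2 vector_3 pos_def)
  then show ?thesis by blast
qed

lemma iota_diag: "iota i (diag_mat t) = diag_mat (emb_diag i t)"
  by (cases "i = 1") (simp_all add: iota_def vec_eq_iff diag_mat_def emb_diag_def forall_3 vector_3)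

lemma emb_diag_nonzero: "\<forall>j. t $ j \<noteq> 0 \<Longrightarrow> emb_diag i t $ j \<noteq> 0"
proof -
  assume "\<forall>j. t $ j \<noteq> 0"
  then have "\<forall>j. emb_diag i t $ j \<noteq> 0"
    by (cases "i = 1") (simp_all add: emb_diag_def forall_3 vector_3)
  then show ?thesis by blast
qed

lemma mon_left_translate:
  assumes "f \<in> smooth_fns" "h \<in> GL"
  shows "mon x (\<lambda>g. f (h ** g)) = (\<lambda>g. mon x f (h ** g))"
  by (cases x) (simp add: funpow_rderiv_left_translate funpow_rderiv_smooth_fns assms)

lemma funpow_rderiv_add:
  "f \<in> smooth_fns \<Longrightarrow> h \<in> smooth_fns \<Longrightarrow>
    (rderiv X ^^ a) (\<lambda>g. f g + h g) = (\<lambda>g. (rderiv X ^^ a) f g + (rderiv X ^^ a) h g)"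
  by (induction a) (simp_all add: rderiv_add funpow_rderiv_smooth_fns)

lemma mon_add: "f \<in> smooth_fns \<Longrightarrow> h \<in> smooth_fns \<Longrightarrow>
    mon x (\<lambda>g. f g + h g) = (\<lambda>g. mon x f g + mon x h g)"
  by (cases x) (simp add: funpow_rderiv_add funpow_rderiv_smooth_fns)

lemma mon_cmult: "f \<in> smooth_fns \<Longrightarrow> mon x (\<lambda>g. w * f g) = (\<lambda>g. w * mon x f g)"
  by (cases x) (simp add: funpow_rderiv_cmult funpow_rderiv_smooth_fns)

lemma funpow_rderiv_right_equivariant:
  assumes f: "f \<in> smooth_fns" and h: "h \<in> GL" and X: "h ** X = s *\<^sub>R (X ** h)"
    and c: "\<And>g. g \<in> GL \<Longrightarrow> f (g ** h) = c * f g" and g: "g \<in> GL"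
  shows "(rderiv X ^^ a) f (g ** h) = (of_real s ^ a * c) * (rderiv X ^^ a) f g"
  using g
proof (induction a arbitrary: g)
  case (Suc a)
  show ?case
    using rderiv_right_equivariant[OF funpow_rderiv_smooth_fns[OF f] h X Suc.IH Suc.prems]
    by (simp add: mult.assoc)
qed (simp add: c)

text \<open>As x^m = sgn(x)^m |x|^m, the power shifts the exponent by m and the parity by m mod 2.
  This is the source of the congruences in \<open>Supp\<close>.\<close>

lemma real_char_shift:
  assumes x: "x \<noteq> 0" and b: "b + b' = of_int m"
  shows "of_real (x powi m) * real_char b w x = real_char b' (w - of_int m) x"
proof -
  have "complex_of_real \<bar>x\<bar> powr (- (w - of_int m)) = of_real \<bar>x\<bar> powr (- w) * of_real \<bar>x\<bar> powr (of_int m)"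
    by (simp add: powr_add[symmetric])
  also have "complex_of_real \<bar>x\<bar> powr (of_int m) = of_real (\<bar>x\<bar> powi m)"
    using x by (simp add: complex_powr_of_int)
  finally have powr: "complex_of_real \<bar>x\<bar> powr (- (w - of_int m)) = of_real \<bar>x\<bar> powr (- w) * of_real (\<bar>x\<bar> powi m)" .
  have of_int: "(of_int m :: bit) = (if even m then 0 else 1)"
    by (cases "even m") (auto elim!: evenE oddE)
  have "x powi m = (if even m then 1 else sgn x) * \<bar>x\<bar> powi m"
    using x by (cases "x > 0") (auto simp: power_int_minus_left abs_if)
  moreover have "b' = (if even m then b else b + 1)"
    using b of_int by (cases b; cases b') (auto split: if_splits)
  ultimately show ?thesis
    using x unfolding real_char_def powr by (cases b) (auto simp: sgn_if)
qed

lemma I_series_diag: "f \<in> I_series \<xi> lam \<Longrightarrow> g \<in> GL \<Longrightarrow> \<forall>j. t $ j \<noteq> 0 \<Longrightarrow>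
    f (g ** diag_mat t) = diag_char \<xi> lam t * f g"
  by (simp add: I_series_def principal_series_iff[OF one_in_unipotent(1)])

lemma I_series_smooth_fns: "f \<in> I_series \<xi> lam \<Longrightarrow> f \<in> smooth_fns"
  unfolding I_series_def by (rule principal_series_smooth_fns)

lemma mon_diag:
  assumes f: "f \<in> I_series \<xi> lam" and g: "g \<in> GL" and t: "\<forall>j. t $ j \<noteq> 0"
  shows "mon (a, b, c) f (g ** diag_mat t) =
    of_real ((t $ 2 / t $ 1) ^ a * (t $ 3 / t $ 1) ^ b * (t $ 3 / t $ 2) ^ c) *
    diag_char \<xi> lam t * mon (a, b, c) f g"
proof -
  note s = I_series_smooth_fns[OF f]
  have h: "diag_mat t \<in> GL" using t by (intro diag_mat_in_GL) blast
  have X: "diag_mat t ** elem i j = (t $ i / t $ j) *\<^sub>R (elem i j ** diag_mat t)" for i j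
    using t diag_mat_elem by blast
  note C = funpow_rderiv_right_equivariant[OF s h X[of 3 2] I_series_diag[OF f _ t], of _ c]
  note B = funpow_rderiv_right_equivariant[OF funpow_rderiv_smooth_fns[OF s] h X[of 3 1] C, of _ b]
  note A = funpow_rderiv_right_equivariant[OF funpow_rderiv_smooth_fns[OF funpow_rderiv_smooth_fns[OF s]]
      h X[of 2 1] B g, of a]
  show ?thesis by (simp add: A mult_ac)
qed

lemma mon_emb_diag:
  assumes f: "f \<in> I_series \<xi> lam" and g: "g \<in> GL" and t: "\<forall>j. t $ j \<noteq> 0"
  shows "mon x f (g ** diag_mat (emb_diag i t)) =
    (of_real (t $ 1 powi wt i 1 x) * real_char (\<xi> $ pos i 1) (lam $ pos i 1) (t $ 1)) *
    (of_real (t $ 2 powi wt i 2 x) * real_char (\<xi> $ pos i 2) (lam $ pos i 2) (t $ 2)) * mon x f g"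
proof (cases x)
  case (fields a b c)
  have nz: "t $ 1 \<noteq> 0" "t $ 2 \<noteq> 0" using t by auto
  let ?t = "emb_diag i t"
  have "(?t $ 2 / ?t $ 1) ^ a * (?t $ 3 / ?t $ 1) ^ b * (?t $ 3 / ?t $ 2) ^ c
      = t $ 1 powi wt i 1 x * t $ 2 powi wt i 2 x"
    using nz by (cases "i = 1") (simp_all add: fields emb_diag_def vector_3 power_int_diff power_int_minus
        power_int_add power_add power_divide field_simps)
  moreover have "diag_char \<xi> lam ?t = real_char (\<xi> $ pos i 1) (lam $ pos i 1) (t $ 1) *
      real_char (\<xi> $ pos i 2) (lam $ pos i 2) (t $ 2)"
    unfolding diag_char_eq UNIV_3
    by (cases "i = 1") (simp_all add: three_distinct emb_diag_def vector_3 pos_def real_char_one)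
  ultimately show ?thesis
    using mon_diag[OF f g, of ?t a b c] emb_diag_nonzero[OF t, of i]
    by (simp add: fields mult_ac del: mon.simps wt.simps)
qed

definition support :: "(nat \<times> nat \<times> nat \<Rightarrow> complex) \<Rightarrow> (nat \<times> nat \<times> nat) set" where
  "support \<phi> = {x. \<phi> x \<noteq> 0}"

definition dop :: "(nat \<times> nat \<times> nat \<Rightarrow> complex) \<Rightarrow> (real^3^3 \<Rightarrow> complex) \<Rightarrow> real^3^3 \<Rightarrow> complex" where
  "dop \<phi> f g = (\<Sum>x\<in>support \<phi>. \<phi> x * mon x f g)"

lemma dop_smooth_fns: "f \<in> smooth_fns \<Longrightarrow> dop \<phi> f \<in> smooth_fns"
  unfolding dop_def[abs_def] by (intro smooth_fns_sum mon_smooth_fns)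

lemma rderiv_dop:
  "f \<in> smooth_fns \<Longrightarrow> rderiv X (dop \<phi> f) g = (\<Sum>x\<in>support \<phi>. \<phi> x * rderiv X (mon x f) g)"
  unfolding dop_def[abs_def] by (subst rderiv_sum) (auto intro: mon_smooth_fns)

text \<open>Pairing with the dual test function isolates one coefficient. Such functions exist for
  every \<xi> and \<lambda>, so special parameters do not create relations among the
  monomials.\<close>

lemma mon_independent:
  assumes "finite G" and "\<And>f. f \<in> I_series \<xi> lam \<Longrightarrow> (\<Sum>x\<in>G. \<psi> x * mon x f (mat 1)) = 0"
    and "x \<in> G"
  shows "\<psi> x = 0"
proof (cases x)
  case (fields a b c)
  have "(\<Sum>y\<in>G. \<psi> y * mon y (test_fn \<xi> lam a b c) (mat 1))
      = (\<Sum>y\<in>G. if y = x then \<psi> x * (fact a * fact b * fact c) else 0)"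
  proof (rule sum.cong)
    fix y
    show "\<psi> y * mon y (test_fn \<xi> lam a b c) (mat 1) = (if y = x then \<psi> x * (fact a * fact b * fact c) else 0)"
      by (cases y) (auto simp: mon_test_fn fields simp del: mon.simps)
  qed simp
  then show ?thesis
    using assms(2)[OF test_fn_I_series[of \<xi> lam a b c]] assms(1,3) by simp
qed

text \<open>The coefficients of \<open>root_elem i * (\<Sum> \<phi> x * mon x)\<close> modulo the left ideal annihilating highest weight
  vectors.\<close>

fun up :: "nat \<Rightarrow> complex^3 \<Rightarrow> (nat \<times> nat \<times> nat \<Rightarrow> complex) \<Rightarrow> nat \<times> nat \<times> nat \<Rightarrow> complex" where
  "up i lam \<phi> (a, b, c) = (if i = 1
    then of_nat (a + 1) * (lam $ 2 - lam $ 1 - of_nat b + of_nat c - of_nat a) * \<phi> (a + 1, b, c)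
      - of_nat (b + 1) * (if c = 0 then 0 else \<phi> (a, b + 1, c - 1))
    else of_nat (b + 1) * (if a = 0 then 0 else \<phi> (a - 1, b + 1, c))
      + of_nat (c + 1) * (lam $ 3 - lam $ 2 - of_nat c) * \<phi> (a, b, c + 1))"

section \<open>The root vector acting on coefficients\<close>

abbreviation cube :: "nat \<Rightarrow> (nat \<times> nat \<times> nat) set" where
  "cube N \<equiv> {..N} \<times> {..N} \<times> {..N}"

lemma sum_cube: "(\<Sum>x\<in>cube N. F x) = (\<Sum>a\<le>N. \<Sum>b\<le>N. \<Sum>c\<le>N. F (a, b, c) :: complex)"
  by (simp add: sum.cartesian_product)

lemma sum_support_cube:
  assumes "\<And>a b c. \<phi> (a, b, c) \<noteq> 0 \<Longrightarrow> a < N \<and> b < N \<and> c < N"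
  shows "(\<Sum>x\<in>support \<phi>. \<phi> x * H x) = (\<Sum>x\<in>cube N. \<phi> x * H x)"
  using assms by (intro sum.mono_neutral_left) (force simp: support_def)+

text \<open>The term a = 0 disappears through its coefficient and the new top term through
  \<open>k (Suc N) = 0\<close>, so both sums run over the same range.\<close>

lemma sum_shift_down:
  assumes "k (Suc N) = (0::complex)"
  shows "(\<Sum>a\<le>N. of_nat a * k a * H (a - 1)) = (\<Sum>a\<le>N. of_nat (a + 1) * k (a + 1) * H a)"
proof -
  have "(\<Sum>a\<le>N. of_nat a * k a * H (a - 1)) = (\<Sum>a\<le>Suc N. of_nat a * k a * H (a - 1))"
    using assms by simp
  also have "\<dots> = (\<Sum>a\<le>N. of_nat (Suc a) * k (Suc a) * H a)"
    by (subst sum.atMost_Suc_shift) simp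
  finally show ?thesis by simp
qed

lemma sum_shift_up:
  fixes k :: "nat \<Rightarrow> complex"
  assumes "k N = 0"
  shows "(\<Sum>c\<le>N. k c * H (c + 1)) = (\<Sum>c\<le>N. (if c = 0 then 0 else k (c - 1)) * H c)"
proof (cases N)
  case (Suc M)
  have "(\<Sum>c\<le>Suc M. (if c = 0 then 0 else k (c - 1)) * H c) = (\<Sum>c\<le>M. k c * H (c + 1))"
    by (subst sum.atMost_Suc_shift) simp
  then show ?thesis using assms Suc by simp
qed (use assms in simp)

text \<open>Brings the variable that is to be shifted into the innermost sum.\<close>

lemma sum_reverse3:
  "(\<Sum>a\<le>N. \<Sum>b\<le>N. \<Sum>c\<le>N. F a b c) = (\<Sum>c\<le>N. \<Sum>b\<le>N. \<Sum>a\<le>N. F a b c :: complex)"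
proof -
  have "(\<Sum>a\<le>N. \<Sum>b\<le>N. \<Sum>c\<le>N. F a b c) = (\<Sum>b\<le>N. \<Sum>a\<le>N. \<Sum>c\<le>N. F a b c)"
    by (rule sum.swap)
  also have "\<dots> = (\<Sum>b\<le>N. \<Sum>c\<le>N. \<Sum>a\<le>N. F a b c)"
    by (intro sum.cong refl sum.swap)
  also have "\<dots> = (\<Sum>c\<le>N. \<Sum>b\<le>N. \<Sum>a\<le>N. F a b c)"
    by (rule sum.swap)
  finally show ?thesis .
qed

lemma sum_shift_down_up:
  fixes k :: "nat \<Rightarrow> nat \<Rightarrow> complex"
  assumes "\<And>c. k (Suc N) c = 0" "\<And>b. k b N = 0"
  shows "(\<Sum>b\<le>N. \<Sum>c\<le>N. of_nat b * k b c * H (b - 1) (c + 1))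
    = (\<Sum>b\<le>N. \<Sum>c\<le>N. of_nat (b + 1) * (if c = 0 then 0 else k (b + 1) (c - 1)) * H b c)"
proof -
  have "(\<Sum>b\<le>N. \<Sum>c\<le>N. of_nat b * k b c * H (b - 1) (c + 1))
      = (\<Sum>c\<le>N. \<Sum>b\<le>N. of_nat b * k b c * H (b - 1) (c + 1))"
    by (rule sum.swap)
  also have "\<dots> = (\<Sum>c\<le>N. \<Sum>b\<le>N. of_nat (b + 1) * k (b + 1) c * H b (c + 1))"
    by (intro sum.cong refl sum_shift_down assms)
  also have "\<dots> = (\<Sum>b\<le>N. \<Sum>c\<le>N. of_nat (b + 1) * k (b + 1) c * H b (c + 1))"
    by (rule sum.swap)
  also have "\<dots> = (\<Sum>b\<le>N. \<Sum>c\<le>N. (if c = 0 then 0 else of_nat (b + 1) * k (b + 1) (c - 1)) * H b c)"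
    by (intro sum.cong refl sum_shift_up) (simp add: assms)
  finally show ?thesis
    by (simp add: if_distrib cong: if_cong)
qed

text \<open>Sorts \<open>rderiv_12_mon\<close> or \<open>rderiv_23_mon\<close> by the monomials on
  the right. The support stays strictly below N in each exponent, so the shifted terms still fit
  into the cube.\<close>

lemma up_root_sum:
  assumes hw: "f \<in> highest_weight lam"
    and N: "\<And>a b c. \<phi> (a, b, c) \<noteq> 0 \<Longrightarrow> a < N \<and> b < N \<and> c < N"
  shows "(\<Sum>x\<in>cube N. \<phi> x * rderiv (root_elem i) (mon x f) g) = (\<Sum>x\<in>cube N. up i lam \<phi> x * mon x f g)"
proof -
  have zero: "\<phi> (a, b, c) = 0" if "a \<ge> N \<or> b \<ge> N \<or> c \<ge> N" for a b c
    using N[of a b c] that by force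
  let ?m = "\<lambda>a b c. mon (a, b, c) f g"
  note [simp del] = mon.simps
  show ?thesis
  proof (cases "i = 1")
    case True
    let ?q = "\<lambda>a b c. lam $ 2 - lam $ 1 - of_nat b + of_nat c - of_nat a + 1"
    have 1: "(\<Sum>a\<le>N. \<Sum>b\<le>N. \<Sum>c\<le>N. of_nat a * (?q a b c * \<phi> (a, b, c)) * ?m (a - 1) b c)
        = (\<Sum>a\<le>N. \<Sum>b\<le>N. \<Sum>c\<le>N. of_nat (a + 1) * (?q (a + 1) b c * \<phi> (a + 1, b, c)) * ?m a b c)"
      by (subst (1 2) sum_reverse3, intro sum.cong refl sum_shift_down) (simp add: zero)
    have 2: "(\<Sum>b\<le>N. \<Sum>c\<le>N. of_nat b * \<phi> (a, b, c) * ?m a (b - 1) (c + 1))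
        = (\<Sum>b\<le>N. \<Sum>c\<le>N. of_nat (b + 1) * (if c = 0 then 0 else \<phi> (a, b + 1, c - 1)) * ?m a b c)" for a
      by (rule sum_shift_down_up) (simp_all add: zero)
    have "(\<Sum>x\<in>cube N. \<phi> x * rderiv (root_elem i) (mon x f) g)
        = (\<Sum>a\<le>N. \<Sum>b\<le>N. \<Sum>c\<le>N. of_nat a * (?q a b c * \<phi> (a, b, c)) * ?m (a - 1) b c)
        - (\<Sum>a\<le>N. \<Sum>b\<le>N. \<Sum>c\<le>N. of_nat b * \<phi> (a, b, c) * ?m a (b - 1) (c + 1))"
      unfolding sum_cube root_elem_def True pos_simps rderiv_12_mon[OF hw] sum_subtractf[symmetric]
      by (intro sum.cong refl) (simp add: algebra_simps)
    also have "\<dots> = (\<Sum>x\<in>cube N. up i lam \<phi> x * mon x f g)"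
      unfolding sum_cube 1 2 sum_subtractf[symmetric] up.simps True
      by (intro sum.cong refl) (simp add: algebra_simps)
    finally show ?thesis .
  next
    case False
    let ?q = "\<lambda>c. lam $ 3 - lam $ 2 - of_nat c + 1"
    have 1: "(\<Sum>c\<le>N. of_nat c * (?q c * \<phi> (a, b, c)) * ?m a b (c - 1))
        = (\<Sum>c\<le>N. of_nat (c + 1) * (?q (c + 1) * \<phi> (a, b, c + 1)) * ?m a b c)" for a b
      by (rule sum_shift_down) (simp add: zero)
    have 2: "(\<Sum>a\<le>N. \<Sum>b\<le>N. \<Sum>c\<le>N. of_nat b * \<phi> (a, b, c) * ?m (a + 1) (b - 1) c)
        = (\<Sum>a\<le>N. \<Sum>b\<le>N. \<Sum>c\<le>N. of_nat (b + 1) * (if a = 0 then 0 else \<phi> (a - 1, b + 1, c)) * ?m a b c)"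
      by (subst (1 2) sum_reverse3, rule sum.cong[OF refl], rule sum_shift_down_up) (simp_all add: zero)
    have "(\<Sum>x\<in>cube N. \<phi> x * rderiv (root_elem i) (mon x f) g)
        = (\<Sum>a\<le>N. \<Sum>b\<le>N. \<Sum>c\<le>N. of_nat b * \<phi> (a, b, c) * ?m (a + 1) (b - 1) c)
        + (\<Sum>a\<le>N. \<Sum>b\<le>N. \<Sum>c\<le>N. of_nat c * (?q c * \<phi> (a, b, c)) * ?m a b (c - 1))"
      unfolding sum_cube root_elem_def pos_simps(3,4)[OF False] rderiv_23_mon[OF hw] sum.distrib[symmetric]
      by (intro sum.cong refl) (simp add: algebra_simps)
    also have "\<dots> = (\<Sum>x\<in>cube N. up i lam \<phi> x * mon x f g)"
      unfolding sum_cube 1 2 sum.distrib[symmetric] up.simps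
      using False by (intro sum.cong refl) (simp add: algebra_simps)
    finally show ?thesis .
  qed
qed

section \<open>Coefficient systems and their operators\<close>

text \<open>On a monomial E_jj acts by \<open>wt\<close> minus \<lambda>, on J(\<eta>,\<nu>) by
  -\<nu>: this is the first equation. The second compares the actions of the signs.\<close>

definition matching ::
  "nat \<Rightarrow> bit^3 \<Rightarrow> complex^3 \<Rightarrow> bit^2 \<Rightarrow> complex^2 \<Rightarrow> nat \<times> nat \<times> nat \<Rightarrow> bool" where
  "matching i \<xi> lam \<eta> \<nu> x \<longleftrightarrow> (\<forall>j. \<nu> $ j = lam $ pos i j - of_int (wt i j x) \<and>
    \<xi> $ pos i j + \<eta> $ j = of_int (wt i j x))"

text \<open>A singular vector for G' of weight (\<eta>,\<nu>) in the Verma module, given by its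
  coefficients.\<close>

definition sol ::
  "nat \<Rightarrow> bit^3 \<Rightarrow> complex^3 \<Rightarrow> bit^2 \<Rightarrow> complex^2 \<Rightarrow> (nat \<times> nat \<times> nat \<Rightarrow> complex) \<Rightarrow> bool" where
  "sol i \<xi> lam \<eta> \<nu> \<phi> \<longleftrightarrow> finite (support \<phi>) \<and> (\<forall>x. \<phi> x \<noteq> 0 \<longrightarrow> matching i \<xi> lam \<eta> \<nu> x) \<and>
    (\<forall>x. up i lam \<phi> x = 0)"

definition sbo ::
  "nat \<Rightarrow> bit^3 \<Rightarrow> complex^3 \<Rightarrow> (nat \<times> nat \<times> nat \<Rightarrow> complex) \<Rightarrow>
    (real^3^3 \<Rightarrow> complex) \<Rightarrow> real^2^2 \<Rightarrow> complex" where
  "sbo i \<xi> lam \<phi> f = (if f \<in> I_series \<xi> lam then (\<lambda>g. dop \<phi> f (iota i g)) else 0)"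

lemma finite_support_bounded:
  assumes "finite (support \<phi>)"
  obtains N where "\<And>a b c. \<phi> (a, b, c) \<noteq> 0 \<Longrightarrow> a < N \<and> b < N \<and> c < N"
proof -
  have "finite ((\<lambda>(a, b, c). a + b + c) ` support \<phi>)" using assms by simp
  then obtain N where N: "\<forall>n\<in>(\<lambda>(a, b, c). a + b + c) ` support \<phi>. n < N"
    using finite_nat_set_iff_bounded by blast
  have "a < N \<and> b < N \<and> c < N" if "\<phi> (a, b, c) \<noteq> 0" for a b c
  proof -
    have "(a, b, c) \<in> support \<phi>" using that by (simp add: support_def)
    then have "a + b + c < N" using N by fastforce
    then show ?thesis by simp
  qed
  then show ?thesis using that by blast
qed

lemma rderiv_root_dop:
  assumes hw: "f \<in> highest_weight lam"
    and N: "\<And>a b c. \<phi> (a, b, c) \<noteq> 0 \<Longrightarrow> a < N \<and> b < N \<and> c < N"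
  shows "rderiv (root_elem i) (dop \<phi> f) g = (\<Sum>x\<in>cube N. up i lam \<phi> x * mon x f g)"
  using rderiv_dop[OF highest_weight_smooth_fns[OF hw]] sum_support_cube[OF N] up_root_sum[OF hw N]
  by simp

lemma root_square: "root_elem i ** root_elem i = 0"
  by (simp add: root_elem_def elem_mult pos_def)

lemma I_series_add: "f \<in> I_series \<xi> lam \<Longrightarrow> h \<in> I_series \<xi> lam \<Longrightarrow> (\<lambda>g. f g + h g) \<in> I_series \<xi> lam"
  unfolding I_series_def principal_series_iff[OF one_in_unipotent(1)]
  by (auto intro: smooth_fns_add simp: algebra_simps)

lemma I_series_cmult: "f \<in> I_series \<xi> lam \<Longrightarrow> (\<lambda>g. w * f g) \<in> I_series \<xi> lam"
  unfolding I_series_def principal_series_iff[OF one_in_unipotent(1)]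
  by (auto intro: smooth_fns_cmult simp: algebra_simps)

lemma I_series_left_translate: "f \<in> I_series \<xi> lam \<Longrightarrow> h \<in> GL \<Longrightarrow> (\<lambda>g. f (h ** g)) \<in> I_series \<xi> lam"
  unfolding I_series_def by (rule principal_series_left_translate[OF one_in_unipotent(1)])

lemma dop_left_translate:
  "f \<in> smooth_fns \<Longrightarrow> h \<in> GL \<Longrightarrow> dop \<phi> (\<lambda>g. f (h ** g)) = (\<lambda>g. dop \<phi> f (h ** g))"
  by (simp add: dop_def[abs_def] mon_left_translate)

lemma dop_iota_J_series:
  assumes sol: "sol i \<xi> lam \<eta> \<nu> \<phi>" and f: "f \<in> I_series \<xi> lam"
  shows "(\<lambda>g. dop \<phi> f (iota i g)) \<in> J_series \<eta> \<nu>"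
  unfolding J_series_def principal_series_iff[OF one_in_unipotent(2)]
proof (intro conjI ballI allI impI)
  note s = I_series_smooth_fns[OF f]
  have "smooth_on GL (\<lambda>g. dop \<phi> f (iota i g))"
    by (rule smooth_on_compose[OF open_GL smooth_fns_smooth[OF dop_smooth_fns[OF s]] smooth_on_iota[OF open_GL]])
      (auto simp: iota_GL)
  then show "(\<lambda>g. dop \<phi> f (iota i g)) \<in> smooth_fns"
    using smooth_fns_off_GL[OF dop_smooth_fns[OF s]] by (simp add: smooth_fns_def iota_GL)
next
  note s = I_series_smooth_fns[OF f]
  fix g n :: "real^2^2" assume g: "g \<in> GL" and n: "n \<in> unipotent2"
  obtain N where N: "\<And>a b c. \<phi> (a, b, c) \<noteq> 0 \<Longrightarrow> a < N \<and> b < N \<and> c < N"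
    using finite_support_bounded sol sol_def by metis
  have "up i lam \<phi> x = 0" for x using sol unfolding sol_def by blast
  then have "rderiv (root_elem i) (dop \<phi> f) g = 0" for g
    using rderiv_root_dop[OF I_series_highest_weight[OF f], of \<phi> N i g] N by (simp del: up.simps)
  moreover have "n = mat 1 + (n $ 1 $ 2) *\<^sub>R elem 1 2"
    using n by (simp add: unipotent2_def vec_eq_iff forall_2 mat_def elem_def)
  then have "iota i n = mat 1 + (n $ 1 $ 2) *\<^sub>R root_elem i"
    using iota_elem[of i _ 1 2] root_elem_def by metis
  ultimately show "dop \<phi> f (iota i (g ** n)) = dop \<phi> f (iota i g)"
    using g rderiv_zero_invariant[OF dop_smooth_fns[OF s] _ root_square] by (simp add: iota_mult iota_GL)
next
  fix g :: "real^2^2" and t :: "real^2" assume g: "g \<in> GL" and t: "\<forall>j. t $ j \<noteq> 0"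
  have "\<phi> x * mon x f (iota i g ** diag_mat (emb_diag i t))
      = diag_char \<eta> \<nu> t * (\<phi> x * mon x f (iota i g))" if "\<phi> x \<noteq> 0" for x
  proof -
    have m: "matching i \<xi> lam \<eta> \<nu> x" using sol that unfolding sol_def by blast
    have shift: "of_real (t $ j powi wt i j x) * real_char (\<xi> $ pos i j) (lam $ pos i j) (t $ j)
        = real_char (\<eta> $ j) (\<nu> $ j) (t $ j)" for j
      using m t real_char_shift[of "t $ j" "\<xi> $ pos i j" "\<eta> $ j" "wt i j x" "lam $ pos i j"]
      by (simp add: matching_def)
    have char: "diag_char \<eta> \<nu> t = real_char (\<eta> $ 1) (\<nu> $ 1) (t $ 1) * real_char (\<eta> $ 2) (\<nu> $ 2) (t $ 2)"
      unfolding diag_char_eq UNIV_2 by simp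
    have "iota i g \<in> GL" using g by (simp add: iota_GL)
    from mon_emb_diag[OF f this t, of x i] show ?thesis
      unfolding shift char by (simp only: mult_ac)
  qed
  then show "dop \<phi> f (iota i (g ** diag_mat t)) = diag_char \<eta> \<nu> t * dop \<phi> f (iota i g)"
    by (simp add: iota_mult iota_diag dop_def sum_distrib_left support_def mult_ac)
qed

lemma sbo_in_Diff:
  assumes sol: "sol i \<xi> lam \<eta> \<nu> \<phi>"
  shows "sbo i \<xi> lam \<phi> \<in> Diff i \<xi> lam \<eta> \<nu>"
proof -
  let ?T = "sbo i \<xi> lam \<phi>"
  note s = I_series_smooth_fns
  have "?T (f1 + f2) = ?T f1 + ?T f2" if f: "f1 \<in> I_series \<xi> lam" "f2 \<in> I_series \<xi> lam" for f1 f2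
    using I_series_add[OF f] f mon_add[OF s[OF f(1)] s[OF f(2)]]
    by (simp add: sbo_def plus_fun_def fun_eq_iff dop_def sum.distrib algebra_simps)
  moreover have "?T (\<lambda>g. c * f g) = (\<lambda>g. c * ?T f g)" if f: "f \<in> I_series \<xi> lam" for f c
    using I_series_cmult[OF f] f mon_cmult[OF s[OF f]]
    by (simp add: sbo_def fun_eq_iff dop_def sum_distrib_left mult_ac)
  moreover have "?T (left_translate (iota i h) f) = left_translate h (?T f)"
    if h: "h \<in> GL" and f: "f \<in> I_series \<xi> lam" for h f
  proof -
    have k: "iota i (matrix_inv h) \<in> GL"
      using matrix_inv_GL[OF h] by (simp add: iota_GL)
    show ?thesis
      using I_series_left_translate[OF f k] f dop_left_translate[OF s[OF f] k]
      by (simp add: left_translate_def matrix_inv_iota[OF h] sbo_def fun_eq_iff iota_mult)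
  qed
  moreover have "diff_op_along (iota i) (I_series \<xi> lam) ?T"
  proof -
    have "is_diff_op (dop \<phi>)"
      using is_diff_op_sum[of "support \<phi>" mon \<phi>] is_diff_op_mon by (simp add: dop_def[abs_def])
    then obtain P where P: "comb GL iter_deriv P" "\<forall>f\<in>smooth_fns. \<forall>g\<in>GL. dop \<phi> f g = P f g"
      unfolding is_diff_op_def by blast
    obtain F c where c: "finite F" "\<forall>vs. smooth_on GL (c vs)"
      "\<forall>f g. P f g = (\<Sum>vs\<in>F. c vs g * iter_deriv vs f g)"
      using comb_sum_form[OF open_GL P(1)] by blast
    have "smooth_on GL (\<lambda>g. c vs (iota i g))" for vs
      by (rule smooth_on_compose[OF open_GL c(2)[rule_format] smooth_on_iota[OF open_GL]])
        (auto simp: iota_GL)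
    moreover have "?T f g = (\<Sum>vs\<in>F. c vs (iota i g) * iter_deriv vs f (iota i g))"
      if "f \<in> I_series \<xi> lam" "g \<in> GL" for f g
      using P(2) c(3) s[OF that(1)] that by (simp add: sbo_def iota_GL)
    ultimately show ?thesis
      unfolding diff_op_along_def using c(1)
      by (intro ballI exI[of _ GL] exI[of _ F] exI[of _ "\<lambda>vs g. c vs (iota i g)"]) (auto simp: open_GL)
  qed
  ultimately show ?thesis
    using dop_iota_J_series[OF sol] by (simp add: Diff_def sbo_def)
qed

section \<open>From an operator to its coefficients\<close>

text \<open>Only the local expression around the identity enters, with its coefficients evaluated
  there; normal ordering its finitely many iterated derivatives leaves a finite combination of
  monomials.\<close>

lemma Diff_functional:
  assumes T: "T \<in> Diff i \<xi> lam \<eta> \<nu>"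
  obtains \<phi> where "finite (support \<phi>)" "\<And>f. f \<in> I_series \<xi> lam \<Longrightarrow> T f (mat 1) = dop \<phi> f (mat 1)"
proof -
  have "diff_op_along (iota i) (I_series \<xi> lam) T" using T by (simp add: Diff_def)
  then obtain U F c where *: "mat 1 \<in> U" "finite F"
    "\<forall>f\<in>I_series \<xi> lam. \<forall>g\<in>U. T f g = (\<Sum>vs\<in>F. c vs g * iter_deriv vs f (iota i g))"
    unfolding diff_op_along_def using one_in_GL by meson
  obtain Q where Q: "\<And>vs. comb GL mon (Q vs)"
    "\<And>vs f g. f \<in> highest_weight lam \<Longrightarrow> g \<in> GL \<Longrightarrow> iter_deriv vs f g = Q vs f g"
    using iter_deriv_comb_mon[of lam] by metis
  have "comb GL mon (\<lambda>f g. \<Sum>vs\<in>F. c vs (mat 1) * Q vs f g)"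
    by (intro comb_sum comb_smooth_mult Q smooth_on_const open_GL)
  then obtain G d where d: "finite G"
    "\<forall>f g. (\<Sum>vs\<in>F. c vs (mat 1) * Q vs f g) = (\<Sum>x\<in>G. d x g * mon x f g)"
    using comb_sum_form[OF open_GL, of mon "\<lambda>f g. \<Sum>vs\<in>F. c vs (mat 1) * Q vs f g"] by auto
  define \<phi> where "\<phi> x = (if x \<in> G then d x (mat 1) else 0)" for x
  have sub: "support \<phi> \<subseteq> G" by (auto simp: support_def \<phi>_def)
  have "T f (mat 1) = dop \<phi> f (mat 1)" if f: "f \<in> I_series \<xi> lam" for f
  proof -
    have "T f (mat 1) = (\<Sum>x\<in>G. d x (mat 1) * mon x f (mat 1))"
      using * f Q(2)[OF I_series_highest_weight[OF f] one_in_GL] d(2) by (simp add: iota_one)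
    also have "\<dots> = (\<Sum>x\<in>G. \<phi> x * mon x f (mat 1))"
      by (simp add: \<phi>_def)
    also have "\<dots> = dop \<phi> f (mat 1)"
      unfolding dop_def using sub d(1) by (intro sum.mono_neutral_right) (auto simp: support_def)
    finally show ?thesis .
  qed
  then show ?thesis using that finite_subset[OF sub d(1)] by blast
qed

lemma Diff_eq_sbo:
  assumes T: "T \<in> Diff i \<xi> lam \<eta> \<nu>"
  obtains \<phi> where "finite (support \<phi>)" "T = sbo i \<xi> lam \<phi>"
proof -
  obtain \<phi> where \<phi>: "finite (support \<phi>)" "\<And>f. f \<in> I_series \<xi> lam \<Longrightarrow> T f (mat 1) = dop \<phi> f (mat 1)"
    using Diff_functional[OF T] by blast
  have "T f g = dop \<phi> f (iota i g)" if f: "f \<in> I_series \<xi> lam" for f g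
  proof (cases "g \<in> GL")
    case True
    \<comment> \<open>Translation by the inverse of \<open>g\<close> moves the evaluation point from
      the identity to \<open>g\<close>.\<close>
    then obtain h where h: "matrix_inv g = h" "matrix_inv h = g" "h \<in> GL" using GL_inverse by metis
    have "T f g = left_translate h (T f) (mat 1)"
      by (simp add: left_translate_def h)
    also have "\<dots> = T (left_translate (iota i h) f) (mat 1)"
      using T f h(3) by (simp add: Diff_def)
    also have "left_translate (iota i h) f = (\<lambda>x. f (iota i g ** x))"
      by (simp add: left_translate_def matrix_inv_iota[OF h(3)] h)
    also have "T (\<lambda>x. f (iota i g ** x)) (mat 1) = dop \<phi> (\<lambda>x. f (iota i g ** x)) (mat 1)"
      using True by (intro \<phi>(2) I_series_left_translate f) (simp add: iota_GL)
    also have "\<dots> = dop \<phi> f (iota i g)"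
      using True by (simp add: dop_left_translate[OF I_series_smooth_fns[OF f]] iota_GL)
    finally show ?thesis .
  next
    case False
    have "T f \<in> J_series \<eta> \<nu>" using T f by (simp add: Diff_def)
    then have "T f g = 0"
      using False unfolding J_series_def by (meson principal_series_smooth_fns smooth_fns_off_GL)
    moreover have "dop \<phi> f (iota i g) = 0"
      using False smooth_fns_off_GL[OF dop_smooth_fns[OF I_series_smooth_fns[OF f]]] by (simp add: iota_GL)
    ultimately show ?thesis by simp
  qed
  then have "T f = sbo i \<xi> lam \<phi> f" for f
    using T by (cases "f \<in> I_series \<xi> lam") (auto simp: sbo_def Diff_def)
  then show ?thesis using that \<phi>(1) by blast
qed

text \<open>Everything is tested at the identity: derivatives along \<open>iota\<close> give
  annihilation and weights, and a diagonal matrix with one entry -1 gives the parities. Independence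
  of the monomials turns each identity into one for coefficients.\<close>

lemma sbo_sol:
  assumes T: "sbo i \<xi> lam \<phi> \<in> Diff i \<xi> lam \<eta> \<nu>" and fin: "finite (support \<phi>)"
  shows "sol i \<xi> lam \<eta> \<nu> \<phi>"
proof -
  obtain N where N: "\<And>a b c. \<phi> (a, b, c) \<noteq> 0 \<Longrightarrow> a < N \<and> b < N \<and> c < N"
    using finite_support_bounded[OF fin] by metis
  have J: "(\<lambda>g. dop \<phi> f (iota i g)) \<in> J_series \<eta> \<nu>" if "f \<in> I_series \<xi> lam" for f
    using T that by (auto simp: Diff_def sbo_def)
  \<comment> \<open>\<open>iota\<close> maps the curve 1 + sE_kl to the corresponding curve in G, so
    a derivative taken in G' is a derivative of \<open>dop \<phi> f\<close> in G.\<close>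
  have deriv: "rderiv (elem (pos i k) (pos i l)) (dop \<phi> f) (mat 1)
      = rderiv (elem k l) (\<lambda>g. dop \<phi> f (iota i g)) (mat 1)" if f: "f \<in> I_series \<xi> lam" for f k l
  proof (rule vector_derivative_unique_at)
    show "((\<lambda>s. dop \<phi> f (mat 1 ** (mat 1 + s *\<^sub>R elem (pos i k) (pos i l)))) has_vector_derivative
        rderiv (elem (pos i k) (pos i l)) (dop \<phi> f) (mat 1)) (at 0)"
      by (rule rderiv_at[OF dop_smooth_fns[OF I_series_smooth_fns[OF f]] one_in_GL])
    have "(\<lambda>g. dop \<phi> f (iota i g)) \<in> smooth_fns"
      using J[OF f] unfolding J_series_def by (rule principal_series_smooth_fns)
    from rderiv_at[OF this one_in_GL, of "elem k l"]
    show "((\<lambda>s. dop \<phi> f (mat 1 ** (mat 1 + s *\<^sub>R elem (pos i k) (pos i l)))) has_vector_derivative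
        rderiv (elem k l) (\<lambda>g. dop \<phi> f (iota i g)) (mat 1)) (at 0)"
      by (simp add: iota_elem)
  qed
  have "up i lam \<phi> x = 0" for x
  proof (cases "x \<in> cube N")
    case True
    have uni: "mat 1 + s *\<^sub>R elem 1 2 \<in> unipotent2" for s
      by (simp add: unipotent2_def mat_def elem_def)
    have "(\<Sum>x\<in>cube N. up i lam \<phi> x * mon x f (mat 1)) = 0" if f: "f \<in> I_series \<xi> lam" for f
      using rderiv_root_dop[OF I_series_highest_weight[OF f] N, where i = i and g = "mat 1"] deriv[OF f, of 1 2]
        principal_series_unipotent[OF one_in_unipotent(2) J[OF f, unfolded J_series_def] uni]
      by (simp add: root_elem_def)
    then show ?thesis
      by (rule mon_independent[where \<xi> = \<xi> and lam = lam, OF _ _ True, rotated])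
        (assumption | intro finite_cartesian_product finite_atMost)+
  next
    case False
    \<comment> \<open>Outside the cube some exponent is at least N + 1. Even after the shift by -1
      in \<open>up\<close> it is at least N, where \<phi> vanishes.\<close>
    have "a \<ge> N \<Longrightarrow> \<phi> (a, b, c) = 0" "b \<ge> N \<Longrightarrow> \<phi> (a, b, c) = 0" "c \<ge> N \<Longrightarrow> \<phi> (a, b, c) = 0" for a b c
      using N[of a b c] by force+
    then show ?thesis using False by (cases x) auto
  qed
  moreover have "matching i \<xi> lam \<eta> \<nu> x" if x: "\<phi> x \<noteq> 0" for x
    unfolding matching_def
  proof
    fix j :: 2
    have x': "x \<in> support \<phi>" using x by (simp add: support_def)
    have diag: "rderiv (elem (pos i j) (pos i j)) (mon y f) g = (- lam $ pos i j + of_int (wt i j y)) * mon y f g"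
      if f: "f \<in> I_series \<xi> lam" for f y g
    proof -
      note d = rderiv_diag_mon[OF I_series_highest_weight[OF f]]
      have "\<forall>j. rderiv (elem (pos i j) (pos i j)) (mon y f) g = (- lam $ pos i j + of_int (wt i j y)) * mon y f g"
        by (cases y, cases "i = 1") (simp_all add: forall_2 pos_def d del: mon.simps)
      then show ?thesis by blast
    qed
    have "(\<Sum>y\<in>support \<phi>. (\<phi> y * (- lam $ pos i j + of_int (wt i j y) + \<nu> $ j)) * mon y f (mat 1)) = 0"
      if f: "f \<in> I_series \<xi> lam" for f
    proof -
      have "(\<Sum>y\<in>support \<phi>. \<phi> y * ((- lam $ pos i j + of_int (wt i j y)) * mon y f (mat 1)))
          = - \<nu> $ j * dop \<phi> f (mat 1)"
        using deriv[OF f, of j j] principal_series_diagonal[OF one_in_unipotent(2) J[OF f, unfolded J_series_def], of j]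
        by (simp add: rderiv_dop[OF I_series_smooth_fns[OF f]] diag[OF f] iota_one)
      then show ?thesis
        by (simp add: dop_def distrib_left distrib_right sum.distrib sum_distrib_left sum_negf
            sum_subtractf algebra_simps)
    qed
    from mon_independent[OF fin this x'] x
    have "- lam $ pos i j + of_int (wt i j x) + \<nu> $ j = 0" by simp
    then have "\<nu> $ j = lam $ pos i j - of_int (wt i j x)"
      by (simp add: algebra_simps add_eq_0_iff)
    moreover have "\<xi> $ pos i j + \<eta> $ j = of_int (wt i j x)"
    proof -
      \<comment> \<open>The diagonal sign matrix with -1 in place \<open>j\<close>; it lies outside
        the identity component, so the Lie algebra does not control its action.\<close>
      define t :: "real^2" where "t = (\<chi> k. if k = j then - 1 else 1)"
      have t: "\<forall>k. t $ k \<noteq> 0" by (simp add: t_def)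
      define \<epsilon> :: "bit \<Rightarrow> complex" where "\<epsilon> b = (if b = 0 then 1 else - 1)" for b
      have \<epsilon>: "real_char b w (-1) = \<epsilon> b" for b w
        by (simp add: real_char_def \<epsilon>_def)
      have char: "diag_char \<eta> \<nu> t = \<epsilon> (\<eta> $ j)"
      proof -
        have "\<forall>j. diag_char \<eta> \<nu> (\<chi> k. if k = j then - 1 else 1) = \<epsilon> (\<eta> $ j)"
          unfolding diag_char_eq UNIV_2 forall_2 by (simp add: \<epsilon> real_char_one)
        then show ?thesis unfolding t_def by blast
      qed
      have mon: "mon y f (mat 1 ** diag_mat (emb_diag i t)) = (-1) powi wt i j y * \<epsilon> (\<xi> $ pos i j) * mon y f (mat 1)"
        if f: "f \<in> I_series \<xi> lam" for y f
      proof -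
        have key: "\<forall>j. (of_real ((\<chi> k. if k = j then - 1 else 1) $ (1::2) powi wt i 1 y) *
              real_char (\<xi> $ pos i 1) (lam $ pos i 1) ((\<chi> k. if k = j then - 1 else 1) $ (1::2))) *
            (of_real ((\<chi> k. if k = j then - 1 else 1) $ (2::2) powi wt i 2 y) *
              real_char (\<xi> $ pos i 2) (lam $ pos i 2) ((\<chi> k. if k = j then - 1 else 1) $ (2::2)))
            = (-1) powi wt i j y * \<epsilon> (\<xi> $ pos i j)"
          unfolding forall_2 by (simp add: \<epsilon> real_char_one del: wt.simps)
        show ?thesis
          unfolding mon_emb_diag[OF f one_in_GL t, of y i] unfolding t_def key[rule_format] ..
      qed
      have "(\<Sum>y\<in>support \<phi>. (\<phi> y * ((-1) powi wt i j y * \<epsilon> (\<xi> $ pos i j) - \<epsilon> (\<eta> $ j))) * mon y f (mat 1)) = 0"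
        if f: "f \<in> I_series \<xi> lam" for f
      proof -
        have "dop \<phi> f (iota i (mat 1 ** diag_mat t)) = diag_char \<eta> \<nu> t * dop \<phi> f (iota i (mat 1))"
          using J[OF f] t one_in_GL unfolding J_series_def principal_series_iff[OF one_in_unipotent(2)] by blast
        then have "dop \<phi> f (mat 1 ** diag_mat (emb_diag i t)) = \<epsilon> (\<eta> $ j) * dop \<phi> f (mat 1)"
          by (simp add: iota_mult iota_one iota_diag char)
        then show ?thesis
          unfolding dop_def mon[OF f]
          by (simp add: sum_distrib_left right_diff_distrib left_diff_distrib sum_subtractf mult_ac)
      qed
      from mon_independent[OF fin this x'] x
      have eq: "(-1) powi wt i j x * \<epsilon> (\<xi> $ pos i j) = \<epsilon> (\<eta> $ j)" by simp
      have of_int: "(of_int (wt i j x) :: bit) = (if even (wt i j x) then 0 else 1)"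
        by (cases "even (wt i j x)") (auto elim!: evenE oddE simp del: wt.simps)
      have "((-1) powi wt i j x :: complex) = (if even (wt i j x) then 1 else - 1)"
        by (simp add: power_int_minus_left del: wt.simps)
      then show ?thesis
        using eq of_int unfolding \<epsilon>_def
        by (cases "\<xi> $ pos i j"; cases "\<eta> $ j") (auto split: if_splits simp del: wt.simps)
    qed
    ultimately show "\<nu> $ j = lam $ pos i j - of_int (wt i j x) \<and> \<xi> $ pos i j + \<eta> $ j = of_int (wt i j x)"
      by blast
  qed
  ultimately show ?thesis
    using fin by (simp add: sol_def)
qed

lemma Diff_iff_sol: "T \<in> Diff i \<xi> lam \<eta> \<nu> \<longleftrightarrow> (\<exists>\<phi>. sol i \<xi> lam \<eta> \<nu> \<phi> \<and> T = sbo i \<xi> lam \<phi>)"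
  using Diff_eq_sbo[of T i \<xi> lam \<eta> \<nu>] sbo_sol sbo_in_Diff by metis

lemma sbo_nonzero:
  assumes "finite (support \<phi>)" "\<phi> x \<noteq> 0"
  shows "sbo i \<xi> lam \<phi> \<noteq> 0"
proof
  assume zero: "sbo i \<xi> lam \<phi> = 0"
  have "(\<Sum>y\<in>support \<phi>. \<phi> y * mon y f (mat 1)) = 0" if f: "f \<in> I_series \<xi> lam" for f
    using fun_cong[OF fun_cong[OF zero, of f], of "mat 1"] f by (simp add: sbo_def iota_one dop_def)
  then show False
    using mon_independent[OF assms(1), of \<xi> lam \<phi> x] assms(2) by (simp add: support_def)
qed

lemma sbo_scale: "sbo i \<xi> lam (\<lambda>x. w * \<phi> x) = op_scale w (sbo i \<xi> lam \<phi>)"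
\<comment> \<open>For w = 0 the support, over which \<open>dop\<close> sums, collapses.\<close>
proof (cases "w = 0")
  case True
  then show ?thesis by (simp add: sbo_def dop_def support_def op_scale_def fun_eq_iff)
next
  case False
  then have "support (\<lambda>x. w * \<phi> x) = support \<phi>" by (simp add: support_def)
  then show ?thesis
    by (simp add: sbo_def dop_def op_scale_def fun_eq_iff sum_distrib_left mult.assoc)
qed

section \<open>The recurrence\<close>

text \<open>The first clause keeps all exponents nonnegative. For l < 0 the second includes the
  equation at j = -l - 1, one place below the admissible range, provided this is less than k. There
  \<open>u j\<close> is 0, and the equation constrains \<open>u (j + 1)\<close>.\<close>

definition recurrence :: "nat \<Rightarrow> int \<Rightarrow> complex \<Rightarrow> (nat \<Rightarrow> complex) \<Rightarrow> bool" where
  "recurrence k l \<alpha> u \<longleftrightarrow> (\<forall>j. u j \<noteq> 0 \<longrightarrow> j \<le> k \<and> 0 \<le> l + int j) \<and>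
    (\<forall>j<k. 0 \<le> l + int j + 1 \<longrightarrow>
      of_nat (k - j) * u j = of_nat (j + 1) * (\<alpha> + of_nat j) * u (j + 1))"

text \<open>For l \<ge> 0 the range starts at j = 0 and there is no boundary equation. Otherwise the
  top index k must be admissible, and a vanishing factor must make the boundary equation consistent
  with a nonzero value at k.\<close>

definition solvable :: "nat \<Rightarrow> int \<Rightarrow> complex \<Rightarrow> bool" where
  "solvable k l \<alpha> \<longleftrightarrow> 0 \<le> l \<or>
    (0 \<le> int k + l \<and> (\<exists>j<k. 0 \<le> l + int j + 1 \<and> \<alpha> + of_nat j = 0))"

lemma rec_support: "recurrence k l \<alpha> u \<Longrightarrow> j > k \<or> l + int j < 0 \<Longrightarrow> u j = 0"
  unfolding recurrence_def by (meson linorder_not_less)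

lemma rec_step: "recurrence k l \<alpha> u \<Longrightarrow> j < k \<Longrightarrow> 0 \<le> l + int j + 1 \<Longrightarrow>
    of_nat (k - j) * u j = of_nat (j + 1) * (\<alpha> + of_nat j) * u (j + 1)"
  unfolding recurrence_def by blast

text \<open>The factor k - j is nonzero for j < k, so the values are determined downwards from
  \<open>u k\<close>.\<close>

lemma rec_top_zero:
  assumes u: "recurrence k l \<alpha> u" and k: "u k = 0"
  shows "u j = 0"
proof (cases "j \<le> k")
  case True
  then show ?thesis
  proof (induction rule: inc_induct)
    case (step j)
    show ?case
    proof (cases "0 \<le> l + int j")
      case True
      then have "of_nat (k - j) * u j = 0"
        using rec_step[OF u, of j] step by simp
      then show ?thesis using step.hyps by simp
    qed (use rec_support[OF u] in auto)
  qed (rule k)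
qed (use rec_support[OF u] in auto)

lemma rec_proportional:
  assumes u: "recurrence k l \<alpha> u" and v: "recurrence k l \<alpha> v" "v k = 1"
  shows "u j = u k * v j"
proof -
  have "recurrence k l \<alpha> (\<lambda>j. u j - u k * v j)"
    unfolding recurrence_def
  proof (intro conjI allI impI)
    fix j assume j: "u j - u k * v j \<noteq> 0"
    then have "\<not> (j > k \<or> l + int j < 0)"
      using rec_support[OF u, of j] rec_support[OF v(1), of j] by auto
    then show "j \<le> k" "0 \<le> l + int j" by auto
  next
    fix j assume j: "j < k" "0 \<le> l + int j + 1"
    have "of_nat (k - j) * (u j - u k * v j) = of_nat (k - j) * u j - u k * (of_nat (k - j) * v j)"
      by (simp add: algebra_simps)
    also have "\<dots> = of_nat (j + 1) * (\<alpha> + of_nat j) * u (j + 1)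
        - u k * (of_nat (j + 1) * (\<alpha> + of_nat j) * v (j + 1))"
      by (simp only: rec_step[OF u j] rec_step[OF v(1) j])
    finally show "of_nat (k - j) * (u j - u k * v j)
        = of_nat (j + 1) * (\<alpha> + of_nat j) * (u (j + 1) - u k * v (j + 1))"
      by (simp only: right_diff_distrib mult_ac)
  qed
  from rec_top_zero[OF this, of j] v(2) show ?thesis by simp
qed

lemma rec_solvable:
  assumes u: "recurrence k l \<alpha> u" and j: "u j \<noteq> 0"
  shows "solvable k l \<alpha>"
proof (rule ccontr)
  assume ns: "\<not> solvable k l \<alpha>"
  then have l: "l < 0" by (simp add: solvable_def)
  have top: "u k \<noteq> 0" using rec_top_zero[OF u] j by blast
  then have kl: "0 \<le> int k + l" using rec_support[OF u, of k] by force
  \<comment> \<open>The last index below the admissible range. There \<open>u\<close> vanishes, and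
    as long as no factor \<alpha> + j vanishes, the recurrence carries this zero upwards to
    k.\<close>
  define m where "m = nat (- l - 1)"
  have m: "int m = - l - 1" "m < k" using l kl by (auto simp: m_def)
  have nz: "\<alpha> + of_nat j \<noteq> 0" if "m \<le> j" "j < k" for j
    using ns kl that m(1) by (auto simp: solvable_def)
  have "u j = 0" if "m \<le> j" "j \<le> k" for j
    using that
  proof (induction rule: dec_induct)
    case base
    show ?case using rec_support[OF u, of m] m(1) by simp
  next
    case (step j)
    have "of_nat (k - j) * u j = of_nat (j + 1) * (\<alpha> + of_nat j) * u (j + 1)"
      using rec_step[OF u, of j] step m(1) by simp
    moreover have "u j = 0" using step by simp
    moreover have "of_nat (j + 1) \<noteq> (0::complex)" by (metis Suc_eq_plus1 of_nat_neq_0)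
    ultimately show ?case using nz[of j] step by simp
  qed
  then show False using top m(2) by simp
qed

lemma solvable_rec:
  assumes "solvable k l \<alpha>"
  obtains u where "recurrence k l \<alpha> u" "u k = 1"
proof -
  \<comment> \<open>The recurrence solved downwards from the value 1 at \<open>k\<close>;
    \<open>u\<close> truncates it to admissible indices.\<close>
  define p where "p j = (\<Prod>i\<in>{j..<k}. of_nat (i + 1) * (\<alpha> + of_nat i) / of_nat (k - i))" for j
  define u where "u j = (if j \<le> k \<and> 0 \<le> l + int j then p j else 0)" for j
  have kl: "0 \<le> l + int k" using assms by (auto simp: solvable_def)
  have "of_nat (k - j) * u j = of_nat (j + 1) * (\<alpha> + of_nat j) * u (j + 1)"
    if j: "j < k" "0 \<le> l + int j + 1" for j
  proof -
    have p: "of_nat (k - j) * p j = of_nat (j + 1) * (\<alpha> + of_nat j) * p (j + 1)"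
    proof -
      have "{j..<k} = insert j {j + 1..<k}" using j(1) by auto
      then have "p j = of_nat (j + 1) * (\<alpha> + of_nat j) / of_nat (k - j) * p (j + 1)"
        by (simp add: p_def)
      then show ?thesis using j(1) by (simp del: of_nat_diff)
    qed
    have u1: "u (j + 1) = p (j + 1)" using j by (simp add: u_def)
    show ?thesis
    proof (cases "0 \<le> l + int j")
      case True
      then show ?thesis unfolding u1 using p j by (simp add: u_def)
    next
      case False
      then obtain i where i: "i < k" "0 \<le> l + int i + 1" "\<alpha> + of_nat i = 0"
        using assms by (auto simp: solvable_def)
      \<comment> \<open>Here j = -l - 1, so the index i of the vanishing factor is at least j and
        occurs in the product: the truncation is consistent.\<close>
      have "p j = 0"
        unfolding p_def using i j False by (intro prod_zero) auto
      then have "of_nat (j + 1) * (\<alpha> + of_nat j) * p (j + 1) = 0"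
        using p by simp
      then show ?thesis unfolding u1 using False by (simp add: u_def)
    qed
  qed
  then have "recurrence k l \<alpha> u" by (auto simp: recurrence_def u_def)
  moreover have "u k = 1" using kl by (simp add: u_def p_def)
  ultimately show ?thesis using that by blast
qed

text \<open>Matching monomials lie on a line, parametrised by the exponent \<open>j\<close> of \<open>elem 2 1\<close> (if \<open>i = 1\<close>) or of
  \<open>elem 3 2\<close> (otherwise).\<close>

definition line :: "nat \<Rightarrow> nat \<Rightarrow> int \<Rightarrow> nat \<Rightarrow> nat \<times> nat \<times> nat" where
  "line i k l j = (if i = 1 then (j, k - j, nat (l + int j)) else (nat (l + int j), k - j, j))"

text \<open>\<open>k\<close> and \<open>l\<close> are the quantities constant along a line of
  monomials: \<open>a + b\<close> and \<open>c - a\<close> for \<open>i = 1\<close>,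
  \<open>b + c\<close> and \<open>a - c\<close> otherwise. Modulo 2 their signs do not
  matter.\<close>

definition params :: "nat \<Rightarrow> bit^3 \<Rightarrow> complex^3 \<Rightarrow> bit^2 \<Rightarrow> complex^2 \<Rightarrow> nat \<Rightarrow> int \<Rightarrow> bool" where
  "params i \<xi> lam \<eta> \<nu> k l \<longleftrightarrow> (if i = 1
    then \<nu>$1 - lam$1 = of_nat k \<and> \<nu>$2 - lam$2 = of_int l \<and>
      \<xi>$1 + \<eta>$1 = of_nat k \<and> \<xi>$2 + \<eta>$2 = of_int l
    else lam$3 - \<nu>$2 = of_nat k \<and> lam$2 - \<nu>$1 = of_int l \<and>
      \<xi>$3 + \<eta>$2 = of_nat k \<and> \<xi>$2 + \<eta>$1 = of_int l)"

text \<open>Up to sign, the bracket in \<open>up\<close> that couples the points j and j + 1 of a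
  line, with its summand j split off.\<close>

definition rec_shift :: "nat \<Rightarrow> complex^3 \<Rightarrow> nat \<Rightarrow> int \<Rightarrow> complex" where
  "rec_shift i lam k l = (if i = 1 then lam$2 - lam$1 + of_int l - of_nat k + 2 else lam$2 - lam$3)"

definition on_line :: "nat \<Rightarrow> nat \<Rightarrow> int \<Rightarrow> (nat \<times> nat \<times> nat \<Rightarrow> complex) \<Rightarrow> nat \<Rightarrow> complex" where
  "on_line i k l \<phi> j = (if j \<le> k \<and> 0 \<le> l + int j then \<phi> (line i k l j) else 0)"

lemma matching_params:
  assumes "matching i \<xi> lam \<eta> \<nu> x"
  obtains k l j where "params i \<xi> lam \<eta> \<nu> k l" "j \<le> k" "0 \<le> l + int j" "x = line i k l j"
proof (cases x)
  case (fields a b c)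
  have m: "\<nu> $ j = lam $ pos i j - of_int (wt i j x)" "\<xi> $ pos i j + \<eta> $ j = of_int (wt i j x)" for j
    using assms by (simp_all add: matching_def)
  show ?thesis
  proof (cases "i = 1")
    case True
    have "params i \<xi> lam \<eta> \<nu> (a + b) (int c - int a)"
      using m(1)[of 1] m(1)[of 2] m(2)[of 1] m(2)[of 2] True
      by (simp add: params_def fields pos_def del: add_bit_eq_xor)
    moreover have "x = line i (a + b) (int c - int a) a"
      using True by (simp add: fields line_def)
    ultimately show ?thesis using that[of "a + b" "int c - int a" a] by simp
  next
    case False
    have "params i \<xi> lam \<eta> \<nu> (b + c) (int a - int c)"
      using m(1)[of 1] m(1)[of 2] m(2)[of 1] m(2)[of 2] False
      by (simp add: params_def fields pos_def del: add_bit_eq_xor)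
    moreover have "x = line i (b + c) (int a - int c) c"
      using False by (simp add: fields line_def)
    ultimately show ?thesis using that[of "b + c" "int a - int c" c] by simp
  qed
qed

lemma params_matching:
  assumes "params i \<xi> lam \<eta> \<nu> k l" "j \<le> k" "0 \<le> l + int j"
  shows "matching i \<xi> lam \<eta> \<nu> (line i k l j)"
proof -
  have "of_nat (k - j) + of_nat j = (of_nat k :: complex)" "of_nat (k - j) + of_nat j = (of_nat k :: bit)"
    unfolding of_nat_add[symmetric] using assms(2) by simp_all
  then show ?thesis
    using assms by (cases "i = 1")
      (simp_all add: matching_def forall_2 params_def line_def pos_def del: add_bit_eq_xor of_nat_diff, auto simp: algebra_simps)
qed

lemma params_unique:
  "params i \<xi> lam \<eta> \<nu> k l \<Longrightarrow> params i \<xi> lam \<eta> \<nu> k' l' \<Longrightarrow> k = k' \<and> l = l'"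
  by (auto simp: params_def split: if_splits)

lemma sol_rec:
  assumes sol: "sol i \<xi> lam \<eta> \<nu> \<phi>"
  shows "recurrence k l (rec_shift i lam k l) (on_line i k l \<phi>)"
  unfolding recurrence_def
proof (intro conjI allI impI)
  fix j assume j: "on_line i k l \<phi> j \<noteq> 0"
  show "j \<le> k" "0 \<le> l + int j" using j by (auto simp: on_line_def split: if_splits)
next
  fix j assume j: "j < k" "0 \<le> l + int j + 1"
  have up: "up i lam \<phi> x = 0" for x using sol unfolding sol_def by blast
  have kj: "k - Suc j + 1 = k - j" "(of_nat (k - Suc j) :: complex) = of_nat k - of_nat j - 1"
    using j(1) by (simp_all add: of_nat_diff)
  have lj: "nat (l + int j + 1) = nat (l + int (j + 1))" by (simp add: add_ac)
  have cl: "(of_nat (nat (l + int j + 1)) :: complex) = of_int l + of_nat j + 1"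
    using j(2) by (simp add: of_nat_nat)
  have next_point: "on_line i k l \<phi> (j + 1) = \<phi> (line i k l (j + 1))"
    using j by (simp add: on_line_def)
  have here: "on_line i k l \<phi> j = (if nat (l + int j + 1) = 0 then 0 else \<phi> (line i k l j))"
    using j by (auto simp: on_line_def)
  have pred: "nat (l + int j + 1) - 1 = nat (l + int j)" by simp
  show "of_nat (k - j) * on_line i k l \<phi> j
      = of_nat (j + 1) * (rec_shift i lam k l + of_nat j) * on_line i k l \<phi> (j + 1)"
  proof (cases "i = 1")
    case True
    \<comment> \<open>At this point \<open>up\<close> reads exactly the line points j + 1 and, where
      the exponents allow it, j.\<close>
    have "up i lam \<phi> (j, k - Suc j, nat (l + int j + 1)) =
        of_nat (j + 1) * (rec_shift i lam k l + of_nat j) * on_line i k l \<phi> (j + 1)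
        - of_nat (k - j) * on_line i k l \<phi> j"
      unfolding next_point here up.simps kj cl pred
      using True by (simp add: line_def rec_shift_def lj algebra_simps del: of_nat_diff)
    then show ?thesis using up by (simp del: up.simps)
  next
    case False
    have "up i lam \<phi> (nat (l + int j + 1), k - Suc j, j) =
        of_nat (k - j) * on_line i k l \<phi> j -
        of_nat (j + 1) * (rec_shift i lam k l + of_nat j) * on_line i k l \<phi> (j + 1)"
      unfolding next_point here up.simps kj cl pred
      using False by (simp add: line_def rec_shift_def lj algebra_simps del: of_nat_diff)
    then show ?thesis using up by (simp del: up.simps)
  qed
qed

definition from_line :: "nat \<Rightarrow> nat \<Rightarrow> int \<Rightarrow> (nat \<Rightarrow> complex) \<Rightarrow> nat \<times> nat \<times> nat \<Rightarrow> complex" where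
  "from_line i k l u = (\<lambda>(a, b, c). if i = 1
    then if a + b = k \<and> int c = l + int a then u a else 0
    else if b + c = k \<and> int a = l + int c then u c else 0)"

lemma from_line_on_line: "j \<le> k \<Longrightarrow> 0 \<le> l + int j \<Longrightarrow> from_line i k l u (line i k l j) = u j"
  by (simp add: from_line_def line_def)

lemma from_line_nonzero:
  assumes "from_line i k l u x \<noteq> 0"
  obtains j where "j \<le> k" "0 \<le> l + int j" "x = line i k l j"
proof (cases x)
  case (fields a b c)
  show ?thesis
    by (rule that[of "if i = 1 then a else c"])
      (use assms in \<open>auto simp: fields from_line_def line_def split: if_splits\<close>)
qed

lemma from_line_sol:
  assumes p: "params i \<xi> lam \<eta> \<nu> k l" and u: "recurrence k l (rec_shift i lam k l) u"
  shows "sol i \<xi> lam \<eta> \<nu> (from_line i k l u)"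
proof -
  have "support (from_line i k l u) \<subseteq> line i k l ` {..k}"
    by (auto simp: support_def elim: from_line_nonzero)
  then have "finite (support (from_line i k l u))"
    by (rule finite_subset) simp
  moreover have "matching i \<xi> lam \<eta> \<nu> x" if "from_line i k l u x \<noteq> 0" for x
    using that params_matching[OF p] by (elim from_line_nonzero) simp
  moreover have "up i lam (from_line i k l u) (a, b, c) = 0" for a b c
  proof -
    have u0: "u j = 0" if "l + int j < 0" for j
      using rec_support[OF u] that by blast
    have rec: "of_nat (k - j) * u j = of_nat (j + 1) * (rec_shift i lam k l + of_nat j) * u (j + 1)"
      if "j < k" "0 \<le> l + int j + 1" for j
      by (rule rec_step[OF u that])
    show ?thesis
    proof (cases "i = 1")
      case True
      show ?thesis
      \<comment> \<open>\<open>up\<close> at (a, b, c) reads (a + 1, b, c) and (a, b + 1, c - 1).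
        The condition says that they lie on the line; otherwise both contributions are 0.\<close>
      proof (cases "a + b + 1 = k \<and> int c = l + int a + 1")
        case on: True
        have k: "k - a = b + 1" "(of_nat k :: complex) = of_nat a + of_nat b + 1" using on by auto
        have l: "(of_int l :: complex) = of_nat c - of_nat a - 1"
        proof -
          have "l = int c - int a - 1" using on by simp
          then show ?thesis by simp
        qed
        have f1: "from_line i k l u (a + 1, b, c) = u (a + 1)"
          using on True by (simp add: from_line_def)
        \<comment> \<open>If c = 0, then a = -l - 1 lies below the admissible range, so
          \<open>u a\<close> is 0 as well.\<close>
        have f2: "(if c = 0 then 0 else from_line i k l u (a, b + 1, c - 1)) = u a"
          using on True u0[of a] by (auto simp: from_line_def)
        have r: "of_nat (b + 1) * u a = of_nat (a + 1) * (rec_shift i lam k l + of_nat a) * u (a + 1)"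
          using rec[of a] on k(1) by simp
        have rs: "rec_shift i lam k l + of_nat a = lam $ 2 - lam $ 1 - of_nat b + of_nat c - of_nat a"
          using True k(2) l by (simp add: rec_shift_def)
        show ?thesis
          unfolding up.simps if_P[OF True] f1 f2 rs[symmetric] r by simp
      next
        case False
        then show ?thesis using True by (auto simp: from_line_def)
      qed
    next
      case i: False
      show ?thesis
      proof (cases "b + c + 1 = k \<and> int a = l + int c + 1")
        case on: True
        have k: "k - c = b + 1" using on by auto
        have "from_line i k l u (a, b, c + 1) = u (c + 1)"
          using on i by (simp add: from_line_def)
        moreover have "(if a = 0 then 0 else from_line i k l u (a - 1, b + 1, c)) = u c"
          using on i u0[of c] by (auto simp: from_line_def)
        moreover have "of_nat (b + 1) * u c = of_nat (c + 1) * (lam $ 2 - lam $ 3 + of_nat c) * u (c + 1)"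
          using rec[of c] on k i by (simp add: rec_shift_def)
        ultimately show ?thesis using i by (simp add: algebra_simps)
      next
        case False
        then show ?thesis using i by (auto simp: from_line_def)
      qed
    qed
  qed
  ultimately show ?thesis unfolding sol_def by (metis prod_cases3)
qed

section \<open>Comparison with the support sets\<close>

lemma cong_mod2_of_int: "cong_mod2 b (of_int m) \<longleftrightarrow> b = of_int m"
  by (auto simp: cong_mod2_def)

lemma Npos_of_nat: "z \<in> Npos \<longleftrightarrow> (\<exists>n>0. z = of_nat n)"
  by (auto simp: Npos_def Nats_def)

lemma of_int_Nats: "of_int m \<in> (\<nat> :: complex set) \<longleftrightarrow> 0 \<le> m"
proof
  assume "of_int m \<in> (\<nat> :: complex set)"
  then obtain n where "of_int m = (of_int (int n) :: complex)" by (auto elim!: Nats_cases)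
  then have "m = int n" by (simp only: of_int_eq_iff)
  then show "0 \<le> m" by simp
next
  assume "0 \<le> m"
  then show "of_int m \<in> (\<nat> :: complex set)" by (metis of_int_of_nat_eq of_nat_in_Nats zero_le_imp_eq_int)
qed

lemma of_int_interval: "of_int m \<in> {1..of_int n} \<inter> (\<int> :: complex set) \<longleftrightarrow> 1 \<le> m \<and> m \<le> n"
  by (simp add: less_eq_complex_def)

text \<open>The two kinds of parameters are l \<ge> 0 and l < 0. On the right the second alternative
  may overlap the first, and k > 0 follows there from l < 0 \<le> k + l.\<close>

lemma phi_cases:
  fixes x y z :: complex
  shows "((x \<in> \<nat> \<and> y \<in> \<nat>) \<or> (x \<in> Npos \<and> - y \<in> Npos \<and> x + y \<in> \<nat> \<and> z \<in> {1..x + y + 1} \<inter> \<int>)) \<longleftrightarrow>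
    (\<exists>k l. x = of_nat k \<and> y = of_int l \<and>
      (0 \<le> l \<or> (0 \<le> int k + l \<and> (\<exists>m. z = of_int m \<and> 1 \<le> m \<and> m \<le> int k + l + 1))))"
    (is "?A \<or> ?B \<longleftrightarrow> ?R")
proof
  assume "?A \<or> ?B"
  then show ?R
  proof
    assume ?A
    then obtain k n where "x = of_nat k" "y = of_nat n" by (auto elim!: Nats_cases)
    then show ?R by (intro exI[of _ k] exI[of _ "int n"]) simp
  next
    assume B: ?B
    then obtain k n where kn: "x = of_nat k" "- y = of_nat n" by (auto simp: Npos_of_nat)
    then have y: "y = of_int (- int n)" by (metis of_int_minus of_int_of_nat_eq minus_minus)
    obtain m where m: "z = of_int m" using B by (auto elim!: Ints_cases)
    have xy: "x + y = of_int (int k - int n)" by (simp add: kn y)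
    have "of_int (int k - int n) \<in> (\<nat> :: complex set)" using B xy by simp
    then have "0 \<le> int k - int n" by (simp only: of_int_Nats)
    moreover have "of_int m \<in> {1..of_int (int k - int n + 1)} \<inter> (\<int> :: complex set)"
      using B m xy by simp
    then have "1 \<le> m \<and> m \<le> int k - int n + 1" by (simp only: of_int_interval)
    ultimately show ?R using kn y m by (intro exI[of _ k] exI[of _ "- int n"]) auto
  qed
next
  assume ?R
  then obtain k l where kl: "x = of_nat k" "y = of_int l"
    "0 \<le> l \<or> (0 \<le> int k + l \<and> (\<exists>m. z = of_int m \<and> 1 \<le> m \<and> m \<le> int k + l + 1))" by blast
  show "?A \<or> ?B"
  proof (cases "0 \<le> l")
    case True
    then have ?A using kl by (simp add: of_int_Nats)
    then show ?thesis ..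
  next
    case False
    then obtain m where m: "0 \<le> int k + l" "z = of_int m" "1 \<le> m" "m \<le> int k + l + 1" using kl by auto
    have xy: "x + y = of_int (int k + l)" "x + y + 1 = of_int (int k + l + 1)" by (simp_all add: kl)
    have "x \<in> Npos" unfolding Npos_of_nat using False m(1) kl by (intro exI[of _ k]) auto
    moreover have "- y \<in> Npos"
      unfolding Npos_of_nat using False kl by (intro exI[of _ "nat (- l)"]) simp
    moreover have "x + y \<in> \<nat>" unfolding xy(1) of_int_Nats using m by simp
    moreover have "z \<in> {1..x + y + 1} \<inter> \<int>" unfolding xy(2) m(2) of_int_interval using m by simp
    ultimately show ?thesis by blast
  qed
qed

text \<open>The common form of the cases i = 1 and i = 2; the assumption translates a vanishing
  factor of the recurrence into the interval condition on \<open>z\<close>.\<close>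

lemma phi_cong_iff_solvable:
  fixes x y z :: complex
  assumes "\<And>k l. x = of_nat k \<Longrightarrow> l < 0 \<Longrightarrow> (\<exists>j<k. 0 \<le> l + int j + 1 \<and> \<alpha> k l + of_nat j = 0) \<longleftrightarrow>
    (\<exists>m. z = of_int m \<and> 1 \<le> m \<and> m \<le> int k + l + 1)"
  shows "((x \<in> \<nat> \<and> y \<in> \<nat>) \<or> (x \<in> Npos \<and> - y \<in> Npos \<and> x + y \<in> \<nat> \<and> z \<in> {1..x + y + 1} \<inter> \<int>)) \<and>
      cong_mod2 b x \<and> cong_mod2 c y \<longleftrightarrow>
    (\<exists>k l. (x = of_nat k \<and> y = of_int l \<and> b = of_nat k \<and> c = of_int l) \<and> solvable k l (\<alpha> k l))"
proof -
  have "solvable k l (\<alpha> k l) \<longleftrightarrow>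
      0 \<le> l \<or> (0 \<le> int k + l \<and> (\<exists>m. z = of_int m \<and> 1 \<le> m \<and> m \<le> int k + l + 1))"
    if "x = of_nat k" for k l
    unfolding solvable_def using assms[OF that, of l] by (cases "0 \<le> l") auto
  moreover have "cong_mod2 b x \<longleftrightarrow> b = of_nat k" if "x = of_nat k" for k
    using that cong_mod2_of_int[of b "int k"] by simp
  ultimately show ?thesis
    unfolding phi_cases using cong_mod2_of_int[of c] by auto
qed

lemma Supp_iff:
  "(\<xi>, \<eta>, lam, \<nu>) \<in> Supp i \<longleftrightarrow>
    (\<exists>k l. params i \<xi> lam \<eta> \<nu> k l \<and> solvable k l (rec_shift i lam k l))"
proof (cases "i = 1")
  case True
  let ?x = "\<nu>$1 - lam$1" and ?y = "\<nu>$2 - lam$2" and ?z = "\<nu>$1 - lam$2"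
  have "(\<exists>j<k. 0 \<le> l + int j + 1 \<and> rec_shift i lam k l + of_nat j = 0) \<longleftrightarrow>
      (\<exists>m. ?z = of_int m \<and> 1 \<le> m \<and> m \<le> int k + l + 1)" if k: "?x = of_nat k" and l: "l < 0" for k l
  proof -
    \<comment> \<open>Hence j from -l - 1 to k - 1 corresponds to z from 1 to k + l + 1, the
      interval of \<open>\<Phi>1b\<close>.\<close>
    have shift: "rec_shift i lam k l + of_nat j = 0 \<longleftrightarrow> ?z = of_int (l + int j + 2)" for j
      using True k by (auto simp: rec_shift_def algebra_simps)
    show ?thesis
      unfolding shift
    proof
      assume "\<exists>m. ?z = of_int m \<and> 1 \<le> m \<and> m \<le> int k + l + 1"
      then obtain m where m: "?z = of_int m" "1 \<le> m" "m \<le> int k + l + 1" by blast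
      show "\<exists>j<k. 0 \<le> l + int j + 1 \<and> ?z = of_int (l + int j + 2)"
        by (rule exI[of _ "nat (m - l - 2)"]) (use m l in auto)
    next
      assume "\<exists>j<k. 0 \<le> l + int j + 1 \<and> ?z = of_int (l + int j + 2)"
      then obtain j where "j < k" "0 \<le> l + int j + 1" "?z = of_int (l + int j + 2)" by blast
      then show "\<exists>m. ?z = of_int m \<and> 1 \<le> m \<and> m \<le> int k + l + 1"
        by (intro exI[of _ "l + int j + 2"]) auto
    qed
  qed
  from phi_cong_iff_solvable[where x = ?x and y = ?y and b = "\<xi>$1 + \<eta>$1" and c = "\<xi>$2 + \<eta>$2", OF this]
  show ?thesis
    using True by (simp add: Supp_def \<Phi>_def \<Phi>1a_def \<Phi>1b_def params_def add_diff_eq del: add_bit_eq_xor)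
next
  case False
  let ?x = "lam$3 - \<nu>$2" and ?y = "lam$2 - \<nu>$1" and ?z = "lam$2 - \<nu>$2"
  have "(\<exists>j<k. 0 \<le> l + int j + 1 \<and> rec_shift i lam k l + of_nat j = 0) \<longleftrightarrow>
      (\<exists>m. ?z = of_int m \<and> 1 \<le> m \<and> m \<le> int k + l + 1)" if k: "?x = of_nat k" and l: "l < 0" for k l
  proof -
    \<comment> \<open>Now z = k - j decreases with j; the same range of j again yields 1 to k + l +
      1.\<close>
    have shift: "rec_shift i lam k l + of_nat j = 0 \<longleftrightarrow> ?z = of_int (int k - int j)" for j
      using False k by (auto simp: rec_shift_def algebra_simps)
    show ?thesis
      unfolding shift
    proof
      assume "\<exists>m. ?z = of_int m \<and> 1 \<le> m \<and> m \<le> int k + l + 1"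
      then obtain m where m: "?z = of_int m" "1 \<le> m" "m \<le> int k + l + 1" by blast
      show "\<exists>j<k. 0 \<le> l + int j + 1 \<and> ?z = of_int (int k - int j)"
        by (rule exI[of _ "nat (int k - m)"]) (use m l in auto)
    next
      assume "\<exists>j<k. 0 \<le> l + int j + 1 \<and> ?z = of_int (int k - int j)"
      then obtain j where "j < k" "0 \<le> l + int j + 1" "?z = of_int (int k - int j)" by blast
      then show "\<exists>m. ?z = of_int m \<and> 1 \<le> m \<and> m \<le> int k + l + 1"
        by (intro exI[of _ "int k - int j"]) auto
    qed
  qed
  from phi_cong_iff_solvable[where x = ?x and y = ?y and b = "\<xi>$3 + \<eta>$2" and c = "\<xi>$2 + \<eta>$1", OF this]
  show ?thesis
    using False by (simp add: Supp_def \<Phi>_def \<Phi>2a_def \<Phi>2b_def params_def add_diff_eq conj_ac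
        del: add_bit_eq_xor)
qed

section \<open>The space of operators\<close>

lemma Diff_generated:
  assumes "(\<xi>, \<eta>, lam, \<nu>) \<in> Supp i"
  obtains T where "T \<in> Diff i \<xi> lam \<eta> \<nu>" "T \<noteq> 0"
    "\<forall>T'\<in>Diff i \<xi> lam \<eta> \<nu>. \<exists>w. T' = op_scale w T"
proof -
  obtain k l where p: "params i \<xi> lam \<eta> \<nu> k l" and s: "solvable k l (rec_shift i lam k l)"
    using assms Supp_iff by blast
  obtain u where u: "recurrence k l (rec_shift i lam k l) u" "u k = 1"
    using solvable_rec[OF s] by blast
  have kl: "0 \<le> l + int k" using s by (auto simp: solvable_def)
  let ?\<psi> = "from_line i k l u"
  have sol: "sol i \<xi> lam \<eta> \<nu> ?\<psi>" by (rule from_line_sol[OF p u(1)])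
  show ?thesis
  proof (rule that)
    show "sbo i \<xi> lam ?\<psi> \<in> Diff i \<xi> lam \<eta> \<nu>" by (rule sbo_in_Diff[OF sol])
    have "finite (support ?\<psi>)" using sol unfolding sol_def by blast
    moreover have "?\<psi> (line i k l k) \<noteq> 0"
      by (simp add: from_line_on_line kl u(2))
    ultimately show "sbo i \<xi> lam ?\<psi> \<noteq> 0" by (rule sbo_nonzero)
    show "\<forall>T'\<in>Diff i \<xi> lam \<eta> \<nu>. \<exists>w. T' = op_scale w (sbo i \<xi> lam ?\<psi>)"
    proof
      fix T' assume "T' \<in> Diff i \<xi> lam \<eta> \<nu>"
      then obtain \<phi> where \<phi>: "sol i \<xi> lam \<eta> \<nu> \<phi>" "T' = sbo i \<xi> lam \<phi>"
        unfolding Diff_iff_sol by blast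
      \<comment> \<open>The coefficient at the top of the line, where the generator has the value
        1.\<close>
      define w where "w = on_line i k l \<phi> k"
      have "\<phi> x = w * ?\<psi> x" for x
      \<comment> \<open>A nonzero coefficient of either function makes \<open>x\<close> matching,
        and \<open>params_unique\<close> then puts it on the line of the fixed k and l.\<close>
      proof (cases "\<phi> x = 0 \<and> ?\<psi> x = 0")
        case False
        then have "matching i \<xi> lam \<eta> \<nu> x" using \<phi>(1) sol unfolding sol_def by blast
        then obtain k' l' j where "params i \<xi> lam \<eta> \<nu> k' l'" "j \<le> k'" "0 \<le> l' + int j" "x = line i k' l' j"
          by (rule matching_params)
        then have j: "j \<le> k" "0 \<le> l + int j" "x = line i k l j"
          using params_unique[OF p] by blast+
        then show ?thesis
          using rec_proportional[OF sol_rec[OF \<phi>(1)] u, of j]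
          by (simp add: on_line_def from_line_on_line w_def)
      qed simp
      then have "\<phi> = (\<lambda>x. w * ?\<psi> x)" by blast
      then have "T' = op_scale w (sbo i \<xi> lam ?\<psi>)" using \<phi>(2) sbo_scale by metis
      then show "\<exists>w. T' = op_scale w (sbo i \<xi> lam ?\<psi>)" by blast
    qed
  qed
qed

lemma zero_in_Diff: "0 \<in> Diff i \<xi> lam \<eta> \<nu>"
proof -
  have "up i lam (\<lambda>x. 0) y = 0" for y by (cases y) simp
  then have "sol i \<xi> lam \<eta> \<nu> (\<lambda>x. 0)" by (simp add: sol_def support_def)
  moreover have "sbo i \<xi> lam (\<lambda>x. 0) = 0" by (simp add: sbo_def dop_def support_def fun_eq_iff)
  ultimately show ?thesis using sbo_in_Diff by metis
qed

lemma Diff_nonzero_Supp: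
  assumes "T \<in> Diff i \<xi> lam \<eta> \<nu>" "T \<noteq> 0"
  shows "(\<xi>, \<eta>, lam, \<nu>) \<in> Supp i"
proof -
  obtain \<phi> where \<phi>: "sol i \<xi> lam \<eta> \<nu> \<phi>" "T = sbo i \<xi> lam \<phi>"
    using assms(1) unfolding Diff_iff_sol by blast
  obtain x where x: "\<phi> x \<noteq> 0"
  proof (rule ccontr)
    assume "\<not> thesis"
    then have "support \<phi> = {}" using that by (auto simp: support_def)
    then have "T = 0" by (simp add: \<phi>(2) sbo_def dop_def fun_eq_iff)
    then show False using assms(2) by blast
  qed
  then have "matching i \<xi> lam \<eta> \<nu> x" using \<phi>(1) unfolding sol_def by blast
  then obtain k l j where p: "params i \<xi> lam \<eta> \<nu> k l" "j \<le> k" "0 \<le> l + int j" "x = line i k l j"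
    by (rule matching_params)
  then have "on_line i k l \<phi> j \<noteq> 0" using x by (simp add: on_line_def)
  then show ?thesis
    using rec_solvable[OF sol_rec[OF \<phi>(1)]] p(1) Supp_iff by blast
qed

theorem theoremC:
  fixes i :: nat
    and \<xi> :: "bit^3" and \<eta> :: "bit^2"
    and lam :: "complex^3" and \<nu> :: "complex^2"
  assumes "i \<in> {1, 2}"
  shows "(Diff i \<xi> lam \<eta> \<nu> \<noteq> {0} \<longleftrightarrow> op_dim (Diff i \<xi> lam \<eta> \<nu>) = 1) \<and>
         (op_dim (Diff i \<xi> lam \<eta> \<nu>) = 1 \<longleftrightarrow> (\<xi>, \<eta>, lam, \<nu>) \<in> Supp i)"
proof (cases "(\<xi>, \<eta>, lam, \<nu>) \<in> Supp i")
  case True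
  then obtain T where T: "T \<in> Diff i \<xi> lam \<eta> \<nu>" "T \<noteq> 0"
    "\<forall>T'\<in>Diff i \<xi> lam \<eta> \<nu>. \<exists>w. T' = op_scale w T" by (rule Diff_generated)
  have "op_dim (Diff i \<xi> lam \<eta> \<nu>) = 1"
  proof (rule op_space.dim_unique[of "{T}"])
    show "Diff i \<xi> lam \<eta> \<nu> \<subseteq> op_space.span {T}"
      using T(3) by (auto simp: op_space.span_singleton)
  qed (use T(1,2) in auto)
  moreover have "Diff i \<xi> lam \<eta> \<nu> \<noteq> {0}" using T by blast
  ultimately show ?thesis using True by simp
next
  case False
  then have zero: "Diff i \<xi> lam \<eta> \<nu> = {0}"
    using Diff_nonzero_Supp zero_in_Diff by blast
  \<comment> \<open>The zero space has dimension 0, not 1, so the first two conditions fail together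
    with the third.\<close>
  have "op_dim (Diff i \<xi> lam \<eta> \<nu>) = 0"
    unfolding zero by (rule op_space.dim_unique[of "{}"]) (auto simp: op_space.independent_empty)
  then show ?thesis using zero False by simp
qed

end
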